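(* Let $\lambda$ be a partition inside an $n\times m$ board (at most $n$ parts, each at most $m$) with number of nonzero parts $\ell(\lambda)=k\le\lambda_1$. Then $$X_\lambda({\bf x},q)=[k]!\,H_k^{n+m-k}(\lambda)\, e_{m+n-k,k}+\sum_{j=0}^{k-1}q^j\,[j]!\,[n+m-2j]\,H_j^{m+n-j-1}(\lambda)\, e_{m+n-j,j},$$ where $X_\lambda({\bf x},q)$ is the chromatic quasisymmetric function of the graph on $m+n$ vertices associated with $\lambda$, $H_j^{N}(\lambda)$ are the $q$-hit numbers of $\lambda$ in the $N\times N$ square board, and $e_{a,b}=e_ae_b$ is the product of elementary symmetric functions ($e_0=1$).
   Context: $q$-notation: $[x]=(1-q^x)/(1-q)$, $[a]_k=[a][a-1]\cdots[a-k+1]$, $[a]!=[a]_a$, and $(x;q)_k=\prod_{i=0}^{k-1}(1-xq^i)$; $q$ is an indeterminate. Boards and partitions: an $n\times m$ board has $n$ rows and $m$ columns; cell $(i,j)$ is in row $i$ from the top and column $j$ from the left. A partition $\lambda=(\lambda_1\ge\lambda_2\ge\cdots\ge\lambda_n\ge 0)$ with $\lambda_1\le m$ is identified with the set of cells $(i,j)$ with $j\le\lambda_i$; $|\lambda|$ is its number of cells. Graph of $\lambda$: $G(\lambda)$ has vertices $1,\dots,m+n$; all pairs $a<b$ are edges except those with $a\le m<b$ and $a\le\lambda_{m+n+1-b}$ (i.e. cell $(i,a)\in\lambda$ corresponds to the non-edge $\{a,m+n+1-i\}$). This is the graph whose edges correspond to the cells under the abelian Dyck path $\mathsf{n}^m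 w(\lambda)\mathsf{e}^n$. Chromatic quasisymmetric function: $X_\lambda({\bf x},q)=\sum_\kappa q^{\mathrm{asc}(\kappa)}\prod_{v}x_{\kappa(v)}$, the sum over proper colorings $\kappa:\{1,\dots,m+n\}\to\{1,2,3,\dots\}$ of $G(\lambda)$, where $\mathrm{asc}(\kappa)$ is the number of edges $\{a,b\}$ with $a<b$ and $\kappa(a)<\kappa(b)$. $q$-rook numbers: $R_k(\lambda)=\sum_p q^{\mathrm{inv}(p)}$ over all placements $p$ of $k$ non-attacking rooks on cells of $\lambda$ (no two in the same row or column), where $\mathrm{inv}(p)$ is the number of cells of $\lambda$ left after each rook cancels its own cell, the cells of $\lambda$ North of it in its column, and the cells West of it in its row. $q$-hit numbers of a square board: for $\lambda$ inside an $N\times N$ board, the $H_i^{N}(\lambda)$ are defined by $$\sum_{i=0}^N H_i^{N}(\lambda)x^i=q^{-|\lambda|}\sum_{i=0}^N R_i(\lambda)\,[N-i]!\,(-1)^i q^{Ni-\binom i2}(x;q)_i .$$ *)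

theory Defs
  imports
    "HOL-Library.FuncSet"
    "HOL-Library.Multiset"
    "HOL-Computational_Algebra.Computational_Algebra"
begin

section \<open>\<open>q\<close>-notation\<close>

text \<open>The indeterminate \<open>q\<close> lives in \<open>\<rat>(q)\<close>, the fraction field of \<open>\<int>[q]\<close>.\<close>

type_synonym qrat = "int poly fract"

definition q :: qrat where
  "q = Fract [:0, 1:] 1"

definition qint :: "nat \<Rightarrow> qrat" where
  "qint a = (1 - q ^ a) / (1 - q)"

definition qfalling :: "nat \<Rightarrow> nat \<Rightarrow> qrat" where
  "qfalling a k = (\<Prod>i<k. qint (a - i))"

definition qfact :: "nat \<Rightarrow> qrat" where
  "qfact a = qfalling a a"

text \<open>\<open>(x;q)\<^sub>k\<close> as a polynomial in a second indeterminate \<open>x\<close> over \<open>\<rat>(q)\<close>.\<close>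

definition qpoch_poly :: "nat \<Rightarrow> qrat poly" where
  "qpoch_poly k = (\<Prod>i<k. 1 - smult (q ^ i) [:0, 1:])"


section \<open>Partitions and boards\<close>

text \<open>A partition is a function of which only the values at indices \<open>\<ge> 1\<close> matter; it is
  extended by zeros, so it does not depend on the board containing it.\<close>

definition partition_in_board :: "nat \<Rightarrow> nat \<Rightarrow> (nat \<Rightarrow> nat) \<Rightarrow> bool" where
  "partition_in_board n m lam \<longleftrightarrow>
     (\<forall>i j. 1 \<le> i \<and> i \<le> j \<longrightarrow> lam j \<le> lam i) \<and> lam 1 \<le> m \<and> (\<forall>i>n. lam i = 0)"

definition num_parts :: "(nat \<Rightarrow> nat) \<Rightarrow> nat" where
  "num_parts lam = card {i. 1 \<le> i \<and> lam i \<noteq> 0}"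

definition cells :: "(nat \<Rightarrow> nat) \<Rightarrow> (nat \<times> nat) set" where
  "cells lam = {(i, j). 1 \<le> i \<and> 1 \<le> j \<and> j \<le> lam i}"

lemma finite_cells:
  assumes "partition_in_board n m lam"
  shows "finite (cells lam)"
proof (rule finite_subset)
  show "cells lam \<subseteq> {1..n} \<times> {1..m}"
  proof (clarsimp simp: cells_def)
    fix i j assume ij: "Suc 0 \<le> i" "Suc 0 \<le> j" "j \<le> lam i"
    have "lam i \<le> lam 1" "lam 1 \<le> m" "i > n \<Longrightarrow> lam i = 0"
      using assms ij by (auto simp: partition_in_board_def)
    with ij show "i \<le> n \<and> j \<le> m"
      by (metis le_trans not_less not_less_eq_eq le0)
  qed
qed simp


section \<open>\<open>q\<close>-rook and \<open>q\<close>-hit numbers\<close>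

definition rook_placements :: "(nat \<Rightarrow> nat) \<Rightarrow> nat \<Rightarrow> (nat \<times> nat) set set" where
  "rook_placements lam k =
     {p. p \<subseteq> cells lam \<and> card p = k \<and>
         (\<forall>r\<in>p. \<forall>s\<in>p. r \<noteq> s \<longrightarrow> fst r \<noteq> fst s \<and> snd r \<noteq> snd s)}"

text \<open>The cells cancelled by a rook at \<open>(i, j)\<close>: its own cell, those North of it (smaller row
  index, same column) and those West of it (smaller column index, same row).\<close>

definition cancelled :: "nat \<times> nat \<Rightarrow> (nat \<times> nat) set" where
  "cancelled r = {(i, j). (j = snd r \<and> i \<le> fst r) \<or> (i = fst r \<and> j \<le> snd r)}"

definition rook_inv :: "(nat \<Rightarrow> nat) \<Rightarrow> (nat \<times> nat) set \<Rightarrow> nat" where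
  "rook_inv lam p = card (cells lam - (\<Union>r\<in>p. cancelled r))"

definition qrook :: "nat \<Rightarrow> (nat \<Rightarrow> nat) \<Rightarrow> qrat" where
  "qrook k lam = (\<Sum>p\<in>rook_placements lam k. q ^ rook_inv lam p)"

definition qhit_poly :: "nat \<Rightarrow> (nat \<Rightarrow> nat) \<Rightarrow> qrat poly" where
  "qhit_poly N lam =
     smult (q powi (- int (card (cells lam))))
       (\<Sum>i\<le>N. smult (qrook i lam * qfact (N - i) * (-1) ^ i * q ^ (N * i - (i choose 2)))
                  (qpoch_poly i))"

text \<open>\<open>qhit i N lam\<close> is \<open>H\<^sub>i\<^sup>N(\<lambda>)\<close>, the \<open>q\<close>-hit number in the \<open>N \<times> N\<close> board.\<close>

definition qhit :: "nat \<Rightarrow> nat \<Rightarrow> (nat \<Rightarrow> nat) \<Rightarrow> qrat" where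
  "qhit i N lam = coeff (qhit_poly N lam) i"

lemma degree_qpoch_poly: "degree (qpoch_poly k) \<le> k"
proof -
  have "degree (qpoch_poly k) \<le> (\<Sum>i<k. degree (1 - smult (q ^ i) [:0, 1:]))"
    unfolding qpoch_poly_def by (rule order.trans[OF degree_prod_sum_le]) auto
  also have "\<dots> \<le> (\<Sum>i<k. 1)"
    by (intro sum_mono degree_diff_le) (auto intro: order.trans[OF degree_smult_le])
  finally show ?thesis by simp
qed

lemma qhit_generating_function:
  "(\<Sum>i\<le>N. monom (qhit i N lam) i) = qhit_poly N lam"
proof -
  have "degree (qhit_poly N lam) \<le> N"
    unfolding qhit_poly_def
    by (intro order.trans[OF degree_smult_le] degree_sum_le)
       (auto intro!: order.trans[OF degree_smult_le] order.trans[OF degree_qpoch_poly])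
  then show ?thesis
    unfolding qhit_def by (rule poly_as_sum_of_monoms')
qed


section \<open>Formal power series in infinitely many variables\<close>

text \<open>A monomial in \<open>x\<^sub>1, x\<^sub>2, \<dots>\<close> is the multiset of its variable indices, so that
  \<open>{#1, 1, 3#}\<close> stands for \<open>x\<^sub>1\<^sup>2 x\<^sub>3\<close> and multiplication of monomials is multiset sum. A power
  series is the function giving the coefficient of each monomial. The index 0 is not used as a
  variable.\<close>

type_synonym xseries = "nat multiset \<Rightarrow> qrat"

text \<open>The formal sum of the terms \<open>c a \<cdot> x\<^bsup>mon a\<^esup>\<close> over \<open>a \<in> A\<close>; \<open>A\<close> may be infinite, but each
  monomial must occur only finitely often.\<close>

definition formal_sum :: "'a set \<Rightarrow> ('a \<Rightarrow> qrat) \<Rightarrow> ('a \<Rightarrow> nat multiset) \<Rightarrow> xseries" where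
  "formal_sum A c mon = (\<lambda>\<alpha>. \<Sum>a\<in>{a\<in>A. mon a = \<alpha>}. c a)"

definition series_mult :: "xseries \<Rightarrow> xseries \<Rightarrow> xseries" where
  "series_mult f g = (\<lambda>\<alpha>. \<Sum>(\<beta>, \<gamma>)\<in>{(\<beta>, \<gamma>). \<beta> + \<gamma> = \<alpha>}. f \<beta> * g \<gamma>)"

lemma finite_multiset_splits:
  "finite {(\<beta>, \<gamma>). \<beta> + \<gamma> = (\<alpha> :: 'a multiset)}"
proof (induction \<alpha>)
  case empty
  have "{(\<beta>, \<gamma>). \<beta> + \<gamma> = ({#} :: 'a multiset)} = {({#}, {#})}" by auto
  then show ?case by simp
next
  case (add x \<alpha>)
  let ?S = "{(\<beta>, \<gamma>). \<beta> + \<gamma> = \<alpha>}"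
  have "{(\<beta>, \<gamma>). \<beta> + \<gamma> = add_mset x \<alpha>} \<subseteq>
      (\<lambda>(\<beta>, \<gamma>). (add_mset x \<beta>, \<gamma>)) ` ?S \<union> (\<lambda>(\<beta>, \<gamma>). (\<beta>, add_mset x \<gamma>)) ` ?S"
  proof (clarsimp)
    fix \<beta> \<gamma> assume eq: "\<beta> + \<gamma> = add_mset x \<alpha>"
      and notin: "(\<beta>, \<gamma>) \<notin> (\<lambda>(\<beta>, \<gamma>). (\<beta>, add_mset x \<gamma>)) ` ?S"
    have "x \<in># \<beta> \<or> x \<in># \<gamma>"
      using eq by (metis union_iff union_single_eq_member)
    then show "(\<beta>, \<gamma>) \<in> (\<lambda>(\<beta>, \<gamma>). (add_mset x \<beta>, \<gamma>)) ` ?S"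
    proof
      assume "x \<in># \<beta>"
      then obtain \<beta>' where b: "\<beta> = add_mset x \<beta>'" by (metis insert_DiffM)
      with eq have "(\<beta>', \<gamma>) \<in> ?S" by simp
      with b show ?thesis by (auto intro: image_eqI[of _ _ "(\<beta>', \<gamma>)"])
    next
      assume "x \<in># \<gamma>"
      then obtain \<gamma>' where c: "\<gamma> = add_mset x \<gamma>'" by (metis insert_DiffM)
      with eq have "(\<beta>, \<gamma>') \<in> ?S" by simp
      with c have "(\<beta>, \<gamma>) \<in> (\<lambda>(\<beta>, \<gamma>). (\<beta>, add_mset x \<gamma>)) ` ?S"
        by (auto intro: image_eqI[of _ _ "(\<beta>, \<gamma>')"])
      with notin show ?thesis by contradiction
    qed
  qed
  then show ?case using add.IH by (auto intro: finite_subset)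
qed

definition elem_sym :: "nat \<Rightarrow> xseries" where
  "elem_sym r = formal_sum {S. S \<subseteq> {1..} \<and> finite S \<and> card S = r} (\<lambda>S. 1) mset_set"

definition elem_sym2 :: "nat \<Rightarrow> nat \<Rightarrow> xseries" where
  "elem_sym2 a b = series_mult (elem_sym a) (elem_sym b)"


section \<open>The chromatic quasisymmetric function\<close>

text \<open>Each edge \<open>{a, b}\<close> is represented by the pair \<open>(a, b)\<close> with \<open>a < b\<close>.\<close>

definition graph_edges :: "nat \<Rightarrow> nat \<Rightarrow> (nat \<Rightarrow> nat) \<Rightarrow> (nat \<times> nat) set" where
  "graph_edges n m lam =
     {(a, b). 1 \<le> a \<and> a < b \<and> b \<le> m + n \<and>
              \<not> (a \<le> m \<and> m < b \<and> a \<le> lam (m + n + 1 - b))}"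

definition proper_colorings :: "nat \<Rightarrow> nat \<Rightarrow> (nat \<Rightarrow> nat) \<Rightarrow> (nat \<Rightarrow> nat) set" where
  "proper_colorings n m lam =
     {\<kappa> \<in> {1..m + n} \<rightarrow>\<^sub>E {1..}. \<forall>(a, b)\<in>graph_edges n m lam. \<kappa> a \<noteq> \<kappa> b}"

definition asc :: "nat \<Rightarrow> nat \<Rightarrow> (nat \<Rightarrow> nat) \<Rightarrow> (nat \<Rightarrow> nat) \<Rightarrow> nat" where
  "asc n m lam \<kappa> = card {(a, b) \<in> graph_edges n m lam. \<kappa> a < \<kappa> b}"

definition chromatic_qsym :: "nat \<Rightarrow> nat \<Rightarrow> (nat \<Rightarrow> nat) \<Rightarrow> xseries" where
  "chromatic_qsym n m lam =
     formal_sum (proper_colorings n m lam) (\<lambda>\<kappa>. q ^ asc n m lam \<kappa>)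
       (\<lambda>\<kappa>. image_mset \<kappa> (mset_set {1..m + n}))"

lemma finite_colorings_of_monomial:
  "finite {\<kappa> \<in> proper_colorings n m lam. image_mset \<kappa> (mset_set {1..m + n}) = \<alpha>}"
proof (rule finite_subset)
  show "{\<kappa> \<in> proper_colorings n m lam. image_mset \<kappa> (mset_set {1..m + n}) = \<alpha>}
      \<subseteq> {1..m + n} \<rightarrow>\<^sub>E set_mset \<alpha>"
    by (auto simp: proper_colorings_def PiE_iff extensional_def)
qed (simp add: finite_PiE)

end

theory Submission
  imports Defs
begin

text \<open>
  The graph of \<open>\<lambda>\<close> is the union of a clique of \<open>m\<close> columns and a clique of \<open>n\<close> rows, with
  edges missing exactly at the cells of \<open>\<lambda>\<close>; a colour class is therefore empty, a single vertex,
  or the column and the row of a cell. Both sides of the identity vanish on a monomial with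
  an exponent \<open>\<ge> 3\<close> or of degree \<open>\<noteq> m + n\<close>. If a monomial of degree \<open>N = m + n\<close> has \<open>r\<close>
  exponents equal to \<open>2\<close> and the others equal to \<open>1\<close>, then its coefficient in \<open>e\<^bsub>N-j,j\<^esub>\<close> is
  \<open>binomial (N - 2 r) (j - r)\<close>. Hence it suffices to show that
  \<open>\<Sum>\<^sub>\<kappa> q\<^bsup>asc(\<kappa>)\<^esup> = \<Sum>\<^sub>j c\<^sub>j \<sqdot> binomial (N - 2 r) (j - r)\<close> with
  \<open>c\<^sub>j = q\<^sup>j [j]! [N - 2 j] H\<^sub>j\<^bsup>N-j-1\<^esup>\<close> for \<open>2 j < N\<close> (\<open>elem_coeff\<close>, \<open>monomial_coeff\<close>);
  for \<open>k = \<ell>(\<lambda>)\<close> one has \<open>c\<^sub>k = [k]! H\<^sub>k\<^bsup>N-k\<^esup>\<close>, and \<open>c\<^sub>j = 0\<close> for \<open>j > k\<close> (\<open>elem_coeff_top\<close>).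

  The proof deletes the class of the largest colour \<open>c\<close>. All edges from a smaller vertex into this
  class are ascents, so the sum over colourings is the sum, over the possible classes \<open>S\<close>, of a
  power of \<open>q\<close> times the sum over the colourings of the remaining graph
  (\<open>color_sum_remove_max\<close>), and removing \<open>S\<close> deletes a column, a row, or the column and the row of
  a cell from the board. The boards that arise are the restrictions of \<open>\<lambda>\<close> to a set \<open>A\<close> of
  columns and a set \<open>B\<close> of rows. Since the coefficients \<open>c\<^sub>j\<close> satisfy the same recursions
  (\<open>elem_coeff_delete_vertex\<close>, \<open>elem_coeff_delete_pair\<close>), the identity follows by induction on the
  degree (\<open>color_sum_eq_monomial_coeff\<close>). In particular no symmetry of the chromatic
  quasisymmetric function is used.

  The recursions for \<open>c\<^sub>j\<close> rest on three identities for \<open>q\<close>-rook numbers, in which \<open>R\<^sub>s\<close> denotes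
  the number for the columns \<open>A\<close> and rows \<open>B\<close>:
  \<^item> \<open>\<Sum>\<^sub>a q\<^bsup>#{x < a} + #{i. a \<le> \<lambda>\<^sub>i}\<^esup> R\<^sub>s(A - a, B) = q\<^sup>s [|A| - s] R\<^sub>s\<close> (\<open>sum_delete_column\<close>);
  \<^item> \<open>\<Sum>\<^sub>i q\<^bsup>#{j > i}\<^esup> R\<^sub>s(A, B - i) = [|B| - s] R\<^sub>s + q\<^bsup>|B|-s-1\<^esup> (1 - q\<^bsup>s+1\<^esup>) R\<^bsub>s+1\<^esub>\<close>
    (\<open>sum_delete_row\<close>);
  \<^item> \<open>\<Sum>\<^bsub>(i,a)\<^esub> q\<^bsup>#{x < a} + #{j > i. a \<le> \<lambda>\<^sub>j}\<^esup> R\<^sub>s(A - a, B - i) = [s + 1] R\<^bsub>s+1\<^esub>\<close>, the sum being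
    over the cells \<open>(i, a)\<close> (\<open>sum_delete_cell\<close>).

  Each follows by induction on the number of rows from the recursion for adding a top row
  (\<open>sub_rook_Suc_insert\<close>). The definition of the \<open>q\<close>-hit numbers and the \<open>q\<close>-binomial theorem
  (\<open>coeff_qpoch_poly\<close>) give \<open>c\<^sub>j\<close> as a combination of \<open>q\<close>-rook numbers, with coefficients
  \<open>elem_weight\<close>, and the recursions become identities between these coefficients.
\<close>

section \<open>Arithmetic of \<open>q\<close>-integers\<close>

lemma q_nonzero [simp]: "q \<noteq> 0"
  by (simp add: q_def Zero_fract_def eq_fract)

lemma q_power: "q ^ k = Fract (monom 1 k) 1"
  by (induction k)
     (auto simp: q_def One_fract_def monom_Suc)

lemma q_power_eq_one_iff [simp]: "q ^ k = 1 \<longleftrightarrow> k = 0"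
proof
  assume "q ^ k = 1"
  then have "monom (1::int) k = 1"
    by (simp add: q_power One_fract_def eq_fract)
  then have "degree (monom (1::int) k) = 0" by simp
  then show "k = 0" by (simp add: degree_monom_eq)
qed simp

lemma q_neq_1 [simp]: "q \<noteq> 1"
  using q_power_eq_one_iff[of 1] by (simp del: q_power_eq_one_iff)

lemma qint_0 [simp]: "qint 0 = 0"
  by (simp add: qint_def)

lemma qint_1 [simp]: "qint (Suc 0) = 1"
  by (simp add: qint_def)

lemma qint_eq_0_iff [simp]: "qint k = 0 \<longleftrightarrow> k = 0"
  by (simp add: qint_def)

lemma qint_add: "qint (a + b) = qint a + q ^ a * qint b"
  by (simp add: qint_def diff_divide_distrib power_add algebra_simps)

lemma qint_Suc: "qint (Suc a) = qint a + q ^ a"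
  using qint_add[of a 1] by simp

lemma qfact_0 [simp]: "qfact 0 = 1"
  by (simp add: qfact_def qfalling_def)

lemma qfact_Suc [simp]: "qfact (Suc k) = qint (Suc k) * qfact k"
  by (simp add: qfact_def qfalling_def prod.lessThan_Suc_shift del: prod.lessThan_Suc)

lemma qfact_nonzero [simp]: "qfact k \<noteq> 0"
  by (induction k) auto

lemma sum_q_power_rank_less:
  assumes "finite (A :: nat set)"
  shows "(\<Sum>a\<in>A. q ^ card {x \<in> A. x < a}) = qint (card A)"
  using assms
proof (induction A rule: finite_linorder_max_induct)
  case (insert b A)
  have "(\<Sum>a\<in>A. q ^ card {x \<in> insert b A. x < a}) = (\<Sum>a\<in>A. q ^ card {x \<in> A. x < a})"
    using insert.hyps by (intro sum.cong refl arg_cong[where f = "\<lambda>S. q ^ card S"]) auto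
  moreover have "{x \<in> insert b A. x < b} = A" using insert.hyps by auto
  moreover have "b \<notin> A" using insert.hyps by auto
  ultimately show ?case using insert by (simp add: qint_Suc)
qed simp

lemma sum_q_power_rank_greater:
  assumes "finite (A :: nat set)"
  shows "(\<Sum>a\<in>A. q ^ card {x \<in> A. a < x}) = qint (card A)"
  using assms
proof (induction A rule: finite_linorder_min_induct)
  case (insert b A)
  have "(\<Sum>a\<in>A. q ^ card {x \<in> insert b A. a < x}) = (\<Sum>a\<in>A. q ^ card {x \<in> A. a < x})"
    using insert.hyps by (intro sum.cong refl arg_cong[where f = "\<lambda>S. q ^ card S"]) auto
  moreover have "{x \<in> insert b A. b < x} = A" using insert.hyps by auto
  moreover have "b \<notin> A" using insert.hyps by auto
  ultimately show ?case using insert by (simp add: qint_Suc)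
qed simp

section \<open>Rook numbers of sub-boards\<close>

text \<open>The cells of \<open>\<lambda>\<close> in the columns \<open>A\<close> and the rows \<open>B\<close>. Columns and rows keep their labels
  when others are deleted.\<close>

definition subcells :: "(nat \<Rightarrow> nat) \<Rightarrow> nat set \<Rightarrow> nat set \<Rightarrow> (nat \<times> nat) set" where
  "subcells lam A B = {(i, a). i \<in> B \<and> a \<in> A \<and> a \<le> lam i}"

text \<open>Placements of \<open>k\<close> non-attacking rooks on the cells in the columns \<open>A\<close> and the rows \<open>B\<close>.\<close>

definition sub_placements ::
    "(nat \<Rightarrow> nat) \<Rightarrow> nat set \<Rightarrow> nat set \<Rightarrow> nat \<Rightarrow> (nat \<times> nat) set set" where
  "sub_placements lam A B k =
     {p. p \<subseteq> subcells lam A B \<and> card p = k \<and>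
         (\<forall>r\<in>p. \<forall>s\<in>p. r \<noteq> s \<longrightarrow> fst r \<noteq> fst s \<and> snd r \<noteq> snd s)}"

text \<open>The number of these cells that no rook of \<open>p\<close> cancels.\<close>

definition sub_inv :: "(nat \<Rightarrow> nat) \<Rightarrow> nat set \<Rightarrow> nat set \<Rightarrow> (nat \<times> nat) set \<Rightarrow> nat" where
  "sub_inv lam A B p = card (subcells lam A B - (\<Union>r\<in>p. cancelled r))"

text \<open>The \<open>q\<close>-rook number \<open>R\<^sub>k\<close> of the board with columns \<open>A\<close> and rows \<open>B\<close>.\<close>

definition sub_rook :: "(nat \<Rightarrow> nat) \<Rightarrow> nat set \<Rightarrow> nat set \<Rightarrow> nat \<Rightarrow> qrat" where
  "sub_rook lam A B k = (\<Sum>p\<in>sub_placements lam A B k. q ^ sub_inv lam A B p)"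

text \<open>The columns of \<open>A\<close> that row \<open>i\<close> meets.\<close>

definition row_set :: "(nat \<Rightarrow> nat) \<Rightarrow> nat set \<Rightarrow> nat \<Rightarrow> nat set" where
  "row_set lam A i = {a \<in> A. a \<le> lam i}"

lemma finite_row_set [simp]: "finite A \<Longrightarrow> finite (row_set lam A i)"
  by (simp add: row_set_def)

lemma subcells_subset: "subcells lam A B \<subseteq> B \<times> A"
  by (auto simp: subcells_def)

lemma finite_subcells [simp]: "finite A \<Longrightarrow> finite B \<Longrightarrow> finite (subcells lam A B)"
  by (rule finite_subset[OF subcells_subset]) simp

lemma finite_sub_placements [simp]:
  "finite A \<Longrightarrow> finite B \<Longrightarrow> finite (sub_placements lam A B k)"
  by (rule finite_subset[of _ "Pow (subcells lam A B)"]) (auto simp: sub_placements_def)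

lemma sub_placements_nonattacking:
  assumes "p \<in> sub_placements lam A B k" "r \<in> p" "s \<in> p" "r \<noteq> s"
  shows "fst r \<noteq> fst s \<and> snd r \<noteq> snd s"
  using assms by (simp add: sub_placements_def)

lemma sub_placements_inj:
  assumes "p \<in> sub_placements lam A B k"
  shows "inj_on fst p" "inj_on snd p"
proof -
  have *: "fst r \<noteq> fst s \<and> snd r \<noteq> snd s" if "r \<in> p" "s \<in> p" "r \<noteq> s" for r s
    using sub_placements_nonattacking[OF assms that] .
  show "inj_on fst p" "inj_on snd p" using * by (meson inj_onI)+
qed

lemma finite_placement:
  assumes "finite A" "finite B" "p \<in> sub_placements lam A B k"
  shows "finite p"
  using assms finite_subset[OF _ finite_subcells[of A B lam]] by (simp add: sub_placements_def)

lemma sub_rook_eq_0: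
  assumes "finite A" "finite B" "card A < k \<or> card B < k"
  shows "sub_rook lam A B k = 0"
proof -
  have False if p: "p \<in> sub_placements lam A B k" for p
  proof -
    note inj = sub_placements_inj[OF p]
    have "fst ` p \<subseteq> B" "snd ` p \<subseteq> A" "card p = k"
      using p by (auto simp: sub_placements_def subcells_def)
    then have "k \<le> card B" "k \<le> card A"
      using assms card_mono[of B "fst ` p"] card_mono[of A "snd ` p"]
        card_image[OF inj(1)] card_image[OF inj(2)] by simp_all
    with assms show False by auto
  qed
  then have "sub_placements lam A B k = {}" by blast
  then show ?thesis by (simp add: sub_rook_def)
qed

text \<open>The rook numbers depend only on the set of cells; an empty column or row may be dropped.\<close>

lemma sub_rook_cong:
  assumes "subcells lam A B = subcells lam' A' B'"
  shows "sub_rook lam A B k = sub_rook lam' A' B' k"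
  unfolding sub_rook_def sub_placements_def sub_inv_def assms ..

lemma sub_placements_0 [simp]:
  assumes "finite A" "finite B" 
  shows "sub_placements lam A B 0 = {{}}"
  using finite_subset[OF _ finite_subcells[OF assms, of lam]] by (auto simp: sub_placements_def)

lemma sub_rook_0:
  assumes "finite A" "finite B" 
  shows "sub_rook lam A B 0 = q ^ card (subcells lam A B)"
  using assms by (simp add: sub_rook_def sub_inv_def)

lemma subcells_insert:
  "subcells lam A (insert b B) = subcells lam A B \<union> {b} \<times> row_set lam A b"
  by (auto simp: subcells_def row_set_def)

lemma card_subcells_insert:
  assumes "finite A" "finite B" "b \<notin> B"
  shows "card (subcells lam A (insert b B)) = card (subcells lam A B) + card (row_set lam A b)"
proof -
  have "card (subcells lam A B \<union> {b} \<times> row_set lam A b)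
      = card (subcells lam A B) + card ({b} \<times> row_set lam A b)"
    using assms by (intro card_Un_disjoint finite_subcells) (auto simp: subcells_def)
  then show ?thesis by (simp add: subcells_insert card_cartesian_product)
qed

lemma sub_rook_0_insert:
  assumes "finite A" "finite B" "b \<notin> B"
  shows "sub_rook lam A (insert b B) 0 = q ^ card (row_set lam A b) * sub_rook lam A B 0"
  using assms by (simp add: sub_rook_0 card_subcells_insert power_add)

text \<open>The rooks lie in columns that meet every row at least as long as the rows in \<open>B\<close>, so each of
  them blocks a cell of such a row.\<close>

lemma sub_placements_free_columns:
  assumes "finite A" "finite B" "p \<in> sub_placements lam A B k" "\<forall>i\<in>B. lam i \<le> lam b"
  shows "card (row_set lam A b - snd ` p) = card (row_set lam A b) - k"
proof -
  have "snd ` p \<subseteq> row_set lam A b"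
  proof
    fix a assume "a \<in> snd ` p"
    then obtain i where i: "(i, a) \<in> p" by auto
    then have "i \<in> B" "a \<in> A" "a \<le> lam i"
      using assms(3) by (auto simp: sub_placements_def subcells_def)
    then show "a \<in> row_set lam A b" using assms(4) by (auto simp: row_set_def)
  qed
  moreover have "card (snd ` p) = k"
    using card_image[OF sub_placements_inj(2)[OF assms(3)]] assms(3)
    by (simp add: sub_placements_def)
  ultimately show ?thesis
    using assms(1) finite_placement[OF assms(1-3)] by (simp add: card_Diff_subset)
qed

lemma cancelled_in_top_row:
  assumes "\<forall>i\<in>B. b < i" "p \<in> sub_placements lam A B k"
  shows "(b, x) \<in> (\<Union>r\<in>p. cancelled r) \<longleftrightarrow> x \<in> snd ` p"
proof -
  have below: "b < fst r" if "r \<in> p" for r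
    using assms that by (auto simp: sub_placements_def subcells_def)
  show ?thesis
  proof
    assume "(b, x) \<in> (\<Union>r\<in>p. cancelled r)"
    then obtain r where "r \<in> p" "(b, x) \<in> cancelled r" by blast
    moreover from this have "b \<noteq> fst r" using below by blast
    ultimately show "x \<in> snd ` p" by (auto simp: cancelled_def)
  next
    assume "x \<in> snd ` p"
    then obtain r where "r \<in> p" "x = snd r" by blast
    moreover from this have "b < fst r" using below by blast
    ultimately show "(b, x) \<in> (\<Union>r\<in>p. cancelled r)"
      by (intro UN_I[of r]) (simp_all add: cancelled_def)
  qed
qed

lemma remove_from_row:
  assumes "\<And>x. (b, x) \<in> U \<longleftrightarrow> x \<in> S"
  shows "(C \<union> {b} \<times> T) - U = (C - U) \<union> {b} \<times> (T - S)"
  using assms by auto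

lemma remove_from_row_with_rook:
  fixes a :: "'a :: linorder"
  assumes "C \<inter> V = {}" "\<And>x. (b, x) \<in> V \<longleftrightarrow> x \<le> a" "\<And>x. (b, x) \<in> U \<longleftrightarrow> x \<in> S"
  shows "(C \<union> {b} \<times> T) - (V \<union> U) = (C - U) \<union> {b} \<times> {x \<in> T - S. a < x}"
  using assms by (auto simp: not_le)

lemma sub_inv_insert_empty_row:
  assumes "finite A" "finite B" "\<forall>i\<in>B. b < i" "p \<in> sub_placements lam A B k"
    "\<forall>i\<in>B. lam i \<le> lam b"
  shows "sub_inv lam A (insert b B) p = sub_inv lam A B p + (card (row_set lam A b) - k)"
proof -
  have eq: "subcells lam A (insert b B) - (\<Union>r\<in>p. cancelled r) =
     (subcells lam A B - (\<Union>r\<in>p. cancelled r)) \<union> {b} \<times> (row_set lam A b - snd ` p)"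
    (is "_ = ?X \<union> ?Y")
    unfolding subcells_insert using cancelled_in_top_row[OF assms(3,4)] by (rule remove_from_row)
  have "card (?X \<union> ?Y) = card ?X + card ?Y"
    using assms by (intro card_Un_disjoint finite_Diff finite_subcells) (auto simp: subcells_def)
  then show ?thesis
    unfolding sub_inv_def eq
    using sub_placements_free_columns[OF assms(1,2,4,5)] by (simp add: card_cartesian_product)
qed

lemma sub_inv_insert_rook:
  assumes "finite A" "finite B" "\<forall>i\<in>B. b < i" "p \<in> sub_placements lam A B k"
    "a \<in> row_set lam A b - snd ` p"
  shows "sub_inv lam A (insert b B) (insert (b, a) p) =
     sub_inv lam A B p + card {x \<in> row_set lam A b - snd ` p. a < x}"
proof -
  have eq: "subcells lam A (insert b B) - (\<Union>r\<in>insert (b, a) p. cancelled r) =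
     (subcells lam A B - (\<Union>r\<in>p. cancelled r)) \<union>
     {b} \<times> {x \<in> row_set lam A b - snd ` p. a < x}" (is "_ = ?X \<union> ?Y")
  proof -
    have "subcells lam A B \<inter> cancelled (b, a) = {}"
      using assms(3) by (auto simp: cancelled_def subcells_def)
    moreover have "(b, x) \<in> cancelled (b, a) \<longleftrightarrow> x \<le> a" for x
      by (auto simp: cancelled_def)
    ultimately show ?thesis
      unfolding subcells_insert UN_insert
      using cancelled_in_top_row[OF assms(3,4)] by (intro remove_from_row_with_rook)
  qed
  have "card (?X \<union> ?Y) = card ?X + card ?Y"
    using assms by (intro card_Un_disjoint finite_Diff finite_subcells) (auto simp: subcells_def)
  then show ?thesis
    unfolding sub_inv_def eq by (simp add: card_cartesian_product)
qed

lemma sub_placements_insert: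
  assumes "finite A" "finite B" "\<forall>i\<in>B. b < i"
  shows "sub_placements lam A (insert b B) (Suc k) = sub_placements lam A B (Suc k) \<union>
     (\<lambda>(p, a). insert (b, a) p) `
       (SIGMA p:sub_placements lam A B k. row_set lam A b - snd ` p)" (is "?L = ?M \<union> ?R")
proof (intro equalityI subsetI)
  fix p assume p: "p \<in> ?L"
  have fin: "finite p" using finite_placement[OF _ _ p] assms by simp
  show "p \<in> ?M \<union> ?R"
  proof (cases "b \<in> fst ` p")
    case False
    have "p \<subseteq> subcells lam A B"
    proof
      fix r assume r: "r \<in> p"
      then have "fst r \<noteq> b" using False by blast
      moreover have "r \<in> subcells lam A (insert b B)"
        using p r by (auto simp: sub_placements_def)
      ultimately show "r \<in> subcells lam A B" by (auto simp: subcells_def)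
    qed
    then have "p \<in> ?M" using p by (simp add: sub_placements_def)
    then show ?thesis ..
  next
    case True
    then obtain a where a: "(b, a) \<in> p" by auto
    define p' where "p' = p - {(b, a)}"
    have p': "p = insert (b, a) p'" "(b, a) \<notin> p'" using a by (auto simp: p'_def)
    have other: "fst r \<noteq> b \<and> snd r \<noteq> a" if "r \<in> p'" for r
    proof -
      have r: "r \<in> p" "(b, a) \<noteq> r" using that p' by blast+
      show ?thesis using sub_placements_nonattacking[OF p a r] by auto
    qed
    have "card p' = k" using p fin a unfolding p'_def by (simp add: sub_placements_def)
    moreover have "p' \<subseteq> subcells lam A B"
    proof
      fix r assume r: "r \<in> p'"
      then have "r \<in> subcells lam A (insert b B)"
        using p p'(1) by (auto simp: sub_placements_def)
      then show "r \<in> subcells lam A B" using other[OF r] by (auto simp: subcells_def)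
    qed
    ultimately have "p' \<in> sub_placements lam A B k"
      using sub_placements_nonattacking[OF p] p'(1) by (simp add: sub_placements_def)
    moreover have "(b, a) \<in> subcells lam A (insert b B)"
      using p a by (auto simp: sub_placements_def)
    then have "a \<in> row_set lam A b - snd ` p'"
      using other by (auto simp: subcells_def row_set_def)
    ultimately have "(p', a) \<in> (SIGMA p:sub_placements lam A B k. row_set lam A b - snd ` p)"
      by blast
    then show ?thesis using p'(1) by (intro UnI2 image_eqI[of _ _ "(p', a)"]) simp_all
  qed
next
  fix p assume "p \<in> ?M \<union> ?R"
  then show "p \<in> ?L"
  proof
    assume "p \<in> ?M"
    then show ?thesis unfolding sub_placements_def subcells_insert by auto
  next
    assume "p \<in> ?R"
    then obtain p' a where p': "p' \<in> sub_placements lam A B k" "a \<in> row_set lam A b"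
      "a \<notin> snd ` p'" "p = insert (b, a) p'" by auto
    have "fst r \<in> B" if "r \<in> p'" for r
      using p'(1) that by (auto simp: sub_placements_def subcells_def)
    then have below: "fst r \<noteq> b" if "r \<in> p'" for r
      using that assms(3) by blast
    have other: "snd r \<noteq> a" if "r \<in> p'" for r
      using that p'(3) by blast
    have "finite p'" using finite_placement[OF _ _ p'(1)] assms by simp
    moreover have "(b, a) \<notin> p'" using below[of "(b, a)"] by auto
    ultimately have "card p = Suc k" using p' by (simp add: sub_placements_def)
    moreover have "p \<subseteq> subcells lam A (insert b B)"
      using p' unfolding subcells_insert by (simp add: sub_placements_def le_supI1)
    moreover have "fst r \<noteq> fst s \<and> snd r \<noteq> snd s" if "r \<in> p" "s \<in> p" "r \<noteq> s" for r s
    proof -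
      consider "r \<in> p'" "s \<in> p'" | "r = (b, a)" "s \<in> p'" | "r \<in> p'" "s = (b, a)"
        using \<open>r \<in> p\<close> \<open>s \<in> p\<close> \<open>r \<noteq> s\<close> unfolding p'(4) by blast
      then show ?thesis
      proof cases
        case 1
        then show ?thesis by (rule sub_placements_nonattacking[OF p'(1) _ _ \<open>r \<noteq> s\<close>])
      next
        case 2
        then show ?thesis using below[of s] other[of s] by auto
      next
        case 3
        then show ?thesis using below[of r] other[of r] by auto
      qed
    qed
    ultimately show ?thesis by (simp add: sub_placements_def)
  qed
qed

text \<open>The recursion for a new top row \<open>b\<close> of length \<open>T = card (row_set lam A b)\<close>. If all \<open>k + 1\<close> rooks
  are below it, \<open>T - k - 1\<close> of its cells survive. If \<open>k\<close> rooks are below it, the rook in it occupies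
  one of \<open>T - k\<close> unblocked cells and leaves the unblocked cells to its right, which gives the
  factor \<open>[T - k]\<close>. The truncated subtractions are
  harmless because \<open>R\<^sub>k(A, B) = 0\<close> for \<open>k > T\<close>.\<close>

lemma sub_rook_Suc_insert:
  assumes "finite A" "finite B" "\<forall>i\<in>B. b < i" "\<forall>i\<in>B. lam i \<le> lam b"
  shows "sub_rook lam A (insert b B) (Suc k) =
     q ^ (card (row_set lam A b) - Suc k) * sub_rook lam A B (Suc k)
     + qint (card (row_set lam A b) - k) * sub_rook lam A B k"
proof -
  let ?T = "row_set lam A b" and ?f = "\<lambda>(p, a). insert (b, a) p"
  let ?S = "SIGMA p:sub_placements lam A B k. ?T - snd ` p"
  have rowB: "(b, x) \<notin> p" if "p \<in> sub_placements lam A B j" for p x j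
    using that assms(3) by (auto simp: sub_placements_def subcells_def)
  have "inj_on ?f ?S"
  proof (rule inj_onI, clarify)
    fix p a p' a'
    assume h: "p \<in> sub_placements lam A B k" "p' \<in> sub_placements lam A B k"
      "insert (b, a) p = insert (b, a') p'"
    then have "(b, a) \<in> insert (b, a') p'" by blast
    then have "a = a'" using rowB[OF h(2)] by simp
    with h show "p = p' \<and> a = a'"
      using rowB[OF h(1)] rowB[OF h(2)] insert_ident[of "(b, a)" p p'] by simp
  qed
  then have "(\<Sum>p\<in>?f ` ?S. q ^ sub_inv lam A (insert b B) p)
      = (\<Sum>(p, a)\<in>?S. q ^ sub_inv lam A (insert b B) (insert (b, a) p))"
    by (simp add: sum.reindex case_prod_unfold o_def)
  also have "\<dots> = (\<Sum>(p, a)\<in>?S. q ^ sub_inv lam A B p * q ^ card {x \<in> ?T - snd ` p. a < x})"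
  proof (rule sum.cong[OF refl], clarify)
    fix p a assume "p \<in> sub_placements lam A B k" "a \<in> ?T" "a \<notin> snd ` p"
    then show "q ^ sub_inv lam A (insert b B) (insert (b, a) p) =
        q ^ sub_inv lam A B p * q ^ card {x \<in> ?T - snd ` p. a < x}"
      using sub_inv_insert_rook[OF assms(1-3), of p lam k a] by (simp add: power_add)
  qed
  also have "\<dots> = (\<Sum>p\<in>sub_placements lam A B k. \<Sum>a\<in>?T - snd ` p.
       q ^ sub_inv lam A B p * q ^ card {x \<in> ?T - snd ` p. a < x})"
    using assms by (subst sum.Sigma) auto
  also have "\<dots> = (\<Sum>p\<in>sub_placements lam A B k. q ^ sub_inv lam A B p * qint (card ?T - k))"
  proof (rule sum.cong[OF refl])
    fix p assume p: "p \<in> sub_placements lam A B k"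
    show "(\<Sum>a\<in>?T - snd ` p. q ^ sub_inv lam A B p * q ^ card {x \<in> ?T - snd ` p. a < x})
        = q ^ sub_inv lam A B p * qint (card ?T - k)"
      using sum_q_power_rank_greater[of "?T - snd ` p"] assms(1)
        sub_placements_free_columns[OF assms(1,2) p assms(4)]
      by (simp add: sum_distrib_left [symmetric])
  qed
  finally have with_rook: "(\<Sum>p\<in>?f ` ?S. q ^ sub_inv lam A (insert b B) p)
      = qint (card ?T - k) * sub_rook lam A B k"
    by (simp add: sub_rook_def sum_distrib_left mult.commute)
  have without_rook: "(\<Sum>p\<in>sub_placements lam A B (Suc k). q ^ sub_inv lam A (insert b B) p)
      = q ^ (card ?T - Suc k) * sub_rook lam A B (Suc k)"
    unfolding sub_rook_def sum_distrib_left
  proof (rule sum.cong[OF refl])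
    fix p assume p: "p \<in> sub_placements lam A B (Suc k)"
    show "q ^ sub_inv lam A (insert b B) p = q ^ (card ?T - Suc k) * q ^ sub_inv lam A B p"
      using sub_inv_insert_empty_row[OF assms(1-3) p assms(4)] by (simp add: power_add)
  qed
  have disj: "sub_placements lam A B (Suc k) \<inter> ?f ` ?S = {}"
  proof -
    have False if "insert (b, a) p \<in> sub_placements lam A B (Suc k)" for a p
      using rowB[OF that] by blast
    then show ?thesis by auto
  qed
  show ?thesis
    unfolding sub_rook_def[of _ _ "insert b B"] sub_placements_insert[OF assms(1-3)]
    by (subst sum.union_disjoint) (use assms without_rook with_rook disj in simp_all)
qed

lemma sub_rook_row_set:
  assumes "\<forall>i\<in>B. lam i \<le> lam b"
  shows "sub_rook lam (row_set lam A b) B k = sub_rook lam A B k"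
  using assms by (intro sub_rook_cong) (auto simp: subcells_def row_set_def)

lemma sub_rook_eq_0_row:
  assumes "finite A" "finite B" "\<forall>i\<in>B. lam i \<le> lam b" "card (row_set lam A b) < k"
  shows "sub_rook lam A B k = 0"
  using sub_rook_eq_0[of "row_set lam A b" B k lam] sub_rook_row_set[OF assms(3)] assms by simp

section \<open>Deletion identities for rook numbers\<close>

lemma sub_rook_delete_empty_column:
  assumes "\<forall>i\<in>B. lam i < a"
  shows "sub_rook lam (A - {a}) B k = sub_rook lam A B k"
  using assms by (intro sub_rook_cong) (auto simp: subcells_def)

text \<open>Induction on the rows, for all column sets at once: after a top row is added, the columns meeting
  it are handled by the induction hypothesis for \<open>row_set lam A b\<close>, and deleting any other column
  does not change the rook number.\<close>

lemma sum_delete_column: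
  assumes "finite B" "finite A" "\<forall>i\<in>B. \<forall>j\<in>B. i \<le> j \<longrightarrow> lam j \<le> lam i"
  shows "(\<Sum>a\<in>A. q ^ (card {x \<in> A. x < a} + card {i \<in> B. a \<le> lam i}) * sub_rook lam (A - {a}) B s)
     = q ^ s * qint (card A - s) * sub_rook lam A B s"
  using assms
proof (induction B arbitrary: A s rule: finite_linorder_min_induct)
  case empty
  have *: "sub_rook lam A' {} s = (if s = 0 then 1 else 0)" if "finite A'" for A'
    using that sub_rook_eq_0[of A' "{}" s lam] sub_rook_0[of A' "{}" lam]
    by (auto simp: subcells_def)
  show ?case
    using empty(1) sum_q_power_rank_less[of A] by (simp add: *)
next
  case (insert b B)
  let ?A = "row_set lam A b" and ?R = "sub_rook lam (row_set lam A b) B"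
  let ?T = "card ?A"
  have finA: "finite A" "finite ?A" using insert.prems by auto
  have anti: "\<forall>i\<in>B. \<forall>j\<in>B. i \<le> j \<longrightarrow> lam j \<le> lam i" and top: "\<forall>i\<in>B. lam i \<le> lam b"
    using insert by (auto simp: less_imp_le)
  have bB: "b \<notin> B" using insert.hyps by auto
  note rook = sub_rook_Suc_insert[OF _ insert.hyps(1,2) top]
  have R: "sub_rook lam A B k = ?R k" for k
    by (rule sub_rook_row_set[OF top, symmetric])
  have RD: "sub_rook lam (A - {a}) B k = sub_rook lam (?A - {a}) B k" for a k
    using sub_rook_row_set[OF top, of "A - {a}" k] by (simp add: row_set_def set_diff_eq conj_ac)
  have IH: "(\<Sum>a\<in>?A. q ^ (card {x \<in> ?A. x < a} + card {i \<in> B. a \<le> lam i}) * sub_rook lam (?A - {a}) B k)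
     = q ^ k * qint (?T - k) * ?R k" for k
    using insert.IH[OF finA(2) anti, of k] .
  have AU: "A = ?A \<union> (A - ?A)" by (auto simp: row_set_def)
  have subA: "?A \<subseteq> A" by (auto simp: row_set_def)
  define w where "w a = q ^ (card {x \<in> A. x < a} + card {i \<in> insert b B. a \<le> lam i})" for a
  define w' where "w' a = q ^ (card {x \<in> ?A. x < a} + card {i \<in> B. a \<le> lam i})" for a
  define S where "S = sub_rook lam A (insert b B) s"
  have "(\<Sum>a\<in>A - ?A. w a *
         sub_rook lam (A - {a}) (insert b B) s) = (\<Sum>a\<in>A - ?A. q ^ ?T * q ^ card {x \<in> A - ?A. x < a} * S)"
  proof (rule sum.cong[OF refl])
    fix a assume a: "a \<in> A - ?A"
    then have "lam b < a" by (auto simp: row_set_def)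
    then have high: "lam i < a" if "i \<in> insert b B" for i
      using that top by (auto intro: le_less_trans)
    then have none: "{i \<in> insert b B. a \<le> lam i} = {}" by (auto simp: not_le)
    have "{x \<in> A. x < a} = ?A \<union> {x \<in> A - ?A. x < a}"
      using a by (auto simp: row_set_def)
    moreover have "card (?A \<union> {x \<in> A - ?A. x < a}) = ?T + card {x \<in> A - ?A. x < a}"
      using finA by (intro card_Un_disjoint) auto
    ultimately have lower: "card {x \<in> A. x < a} = ?T + card {x \<in> A - ?A. x < a}" by simp
    have "sub_rook lam (A - {a}) (insert b B) s = S"
      unfolding S_def using high by (intro sub_rook_delete_empty_column) auto
    then show "w a *
         sub_rook lam (A - {a}) (insert b B) s = q ^ ?T * q ^ card {x \<in> A - ?A. x < a} * S"
      unfolding none w_def by (simp add: lower power_add)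
  qed
  also have "\<dots> = q ^ ?T * qint (card A - ?T) * S"
    using sum_q_power_rank_less[of "A - ?A"] finA subA
    by (simp add: sum_distrib_left [symmetric] sum_distrib_right [symmetric] card_Diff_subset)
  finally have high: "(\<Sum>a\<in>A - ?A. w a *
         sub_rook lam (A - {a}) (insert b B) s) = q ^ ?T * qint (card A - ?T) * S" .
  have IH': "(\<Sum>a\<in>?A. w' a * sub_rook lam (?A - {a}) B k) = q ^ k * qint (?T - k) * ?R k" for k
    unfolding w'_def by (rule IH)
  have expo: "w a = q * w' a" if "a \<in> ?A" for a
  proof -
    have "{x \<in> A. x < a} = {x \<in> ?A. x < a}" using that by (auto simp: row_set_def)
    moreover have "{i \<in> insert b B. a \<le> lam i} = insert b {i \<in> B. a \<le> lam i}"
      using that by (auto simp: row_set_def)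
    ultimately show ?thesis using bB insert.hyps(1) by (simp add: w_def w'_def)
  qed
  have rowD: "row_set lam (A - {a}) b = ?A - {a}" for a by (auto simp: row_set_def)
  have low: "(\<Sum>a\<in>?A. w a *
         sub_rook lam (A - {a}) (insert b B) s) = q ^ s * qint (?T - s) * S"
  proof (cases s)
    case 0
    have "sub_rook lam (A - {a}) (insert b B) 0 = q ^ (?T - 1) * sub_rook lam (?A - {a}) B 0"
      if "a \<in> ?A" for a
      using sub_rook_0_insert[of "A - {a}" B b lam] finA insert.hyps(1) bB that
      by (simp add: rowD RD)
    then have "(\<Sum>a\<in>?A. w a *
         sub_rook lam (A - {a}) (insert b B) s) = (\<Sum>a\<in>?A. q * q ^ (?T - 1) *
          (w' a * sub_rook lam (?A - {a}) B 0))"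
      by (intro sum.cong refl) (simp add: expo 0 mult_ac)
    also have "\<dots> = q * q ^ (?T - 1) * (qint ?T * ?R 0)"
      using IH'[of 0] by (simp add: sum_distrib_left [symmetric])
    also have "\<dots> = q ^ s * qint (?T - s) * S"
      using 0 sub_rook_0_insert[OF finA(1) insert.hyps(1) bB] by (cases ?T) (simp_all add: S_def R)
    finally show ?thesis .
  next
    case (Suc r)
    have "sub_rook lam (A - {a}) (insert b B) (Suc r) =
        q ^ (?T - 1 - Suc r) * sub_rook lam (?A - {a}) B (Suc r)
        + qint (?T - 1 - r) * sub_rook lam (?A - {a}) B r" if "a \<in> ?A" for a
      using rook[of "A - {a}" r] finA that by (simp add: rowD RD)
    then have "(\<Sum>a\<in>?A. w a *
         sub_rook lam (A - {a}) (insert b B) s) =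
        (\<Sum>a\<in>?A. q * q ^ (?T - 1 - Suc r) *
          (w' a * sub_rook lam (?A - {a}) B (Suc r))
         + q * qint (?T - 1 - r) *
          (w' a * sub_rook lam (?A - {a}) B r))"
      by (intro sum.cong refl) (simp add: expo Suc algebra_simps)
    also have "\<dots> = q * q ^ (?T - 1 - Suc r) * (q ^ Suc r * qint (?T - Suc r) * ?R (Suc r))
         + q * qint (?T - 1 - r) * (q ^ r * qint (?T - r) * ?R r)"
      unfolding sum.distrib sum_distrib_left [symmetric] IH' ..
    also have "q * q ^ (?T - 1 - Suc r) * (q ^ Suc r * qint (?T - Suc r) * ?R (Suc r))
        = q ^ Suc r * qint (?T - Suc r) * (q ^ (?T - Suc r) * ?R (Suc r))"
    proof (cases "Suc r < ?T")
      case True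
      then have "?T - Suc r = Suc (?T - 1 - Suc r)" by simp
      then have "q ^ (?T - Suc r) = q * q ^ (?T - 1 - Suc r)" by (metis power_Suc)
      then show ?thesis by (simp add: mult_ac)
    qed simp
    finally show ?thesis
      using rook[OF finA(1), of r] by (simp add: S_def Suc R algebra_simps)
  qed
  have "(\<Sum>a\<in>A. w a *
         sub_rook lam (A - {a}) (insert b B) s)
      = q ^ s * qint (?T - s) * S + q ^ ?T * qint (card A - ?T) * S"
    unfolding sum.subset_diff[OF subA finA(1)] low high by (rule add.commute)
  also have "\<dots> = q ^ s * qint (card A - s) * S"
  proof (cases "s \<le> ?T")
    case True
    have "?T \<le> card A" using subA finA by (simp add: card_mono)
    then have "card A - s = (?T - s) + (card A - ?T)" using True by simp
    then have "qint (card A - s) = qint (?T - s) + q ^ (?T - s) * qint (card A - ?T)"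
      by (simp only: qint_add)
    moreover have "q ^ ?T = q ^ s * q ^ (?T - s)" using True by (simp flip: power_add)
    ultimately show ?thesis by (simp add: algebra_simps)
  next
    case False
    then have "S = 0"
      unfolding S_def using finA insert.hyps(1) top
      by (intro sub_rook_eq_0_row[where b = b]) auto
    then show ?thesis by simp
  qed
  finally show ?case unfolding S_def w_def .
qed

lemma sub_rook_insert_delete:
  assumes "\<forall>i\<in>B. (b::nat) < i" "i \<in> B"
  shows "insert b B - {i} = insert b (B - {i})"
  using assms by auto

lemma card_rows_below_insert:
  assumes "\<forall>i\<in>B. (b::nat) < i" "i \<in> B"
  shows "{j \<in> insert b B. i < j \<and> P j} = {j \<in> B. i < j \<and> P j}"
  using assms by auto

text \<open>The coefficient of \<open>R\<^sub>i\<close> in the induction step for \<open>sum_delete_row\<close>.\<close>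

lemma delete_row_step:
  assumes "i \<le> n" "i \<le> t"
  shows "q ^ n + q ^ (t - i) * qint (n - i) + qint (Suc t - i) * q ^ (n - i) * (1 - q ^ i)
       = qint (Suc n - i) * q ^ (t - i) + q ^ (n - i) * (1 - q ^ Suc i) * qint (t - i)"
proof -
  obtain u v where uv: "n = i + u" "t = i + v" using assms by (metis le_Suc_ex)
  have "Suc n - i = Suc u" "Suc t - i = Suc v" using uv by auto
  then show ?thesis
    by (simp add: uv qint_def power_add divide_simps) (simp add: algebra_simps)
qed

lemma delete_row_collect:
  fixes e :: "'a :: comm_ring"
  assumes "e * (f * X) = g * (h * X)" "(p + e * v + w * g * y) * Y = (u * e + g * z * t) * Y"
  shows "p * Y + (e * (v * Y + f * z * X) + w * (u * Z + g * y * Y))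
       = u * (e * Y + w * Z) + g * z * (h * X + t * Y)"
proof -
  have "p * Y + (e * (v * Y + f * z * X) + w * (u * Z + g * y * Y))
      = (p + e * v + w * g * y) * Y + z * (e * (f * X)) + w * u * Z"
    by (simp add: algebra_simps)
  also have "\<dots> = u * (e * Y + w * Z) + g * z * (h * X + t * Y)"
    unfolding assms by (simp add: algebra_simps)
  finally show ?thesis .
qed

text \<open>Unlike in \<open>sum_delete_column\<close>, the exponent does not involve the length of the deleted line; as a
  result \<open>R\<^bsub>s+1\<^esub>\<close> enters, with a coefficient that vanishes at \<open>q = 1\<close>.\<close>

lemma sum_delete_row:
  assumes "finite B" "finite A" "\<forall>i\<in>B. \<forall>j\<in>B. i \<le> j \<longrightarrow> lam j \<le> lam i"
  shows "(\<Sum>i\<in>B. q ^ card {j \<in> B. i < j} * sub_rook lam A (B - {i}) s)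
     = qint (card B - s) * sub_rook lam A B s
       + q ^ (card B - Suc s) * (1 - q ^ Suc s) * sub_rook lam A B (Suc s)"
  using assms
proof (induction B arbitrary: s rule: finite_linorder_min_induct)
  case empty
  then show ?case using sub_rook_eq_0[of A "{}" "Suc s" lam] by simp
next
  case (insert b B)
  let ?R = "sub_rook lam A B" and ?T = "card (row_set lam A b)" and ?n = "card B"
  have anti: "\<forall>i\<in>B. \<forall>j\<in>B. i \<le> j \<longrightarrow> lam j \<le> lam i" and top: "\<forall>i\<in>B. lam i \<le> lam b"
    using insert by (auto simp: less_imp_le)
  note finA = insert.prems(1) and finB = insert.hyps(1)
  have bB: "b \<notin> B" using insert.hyps by auto
  have R0: "?R k = 0" if "?T < k \<or> ?n < k" for k
    using that sub_rook_eq_0_row[OF finA finB top] sub_rook_eq_0[OF finA finB] by blast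
  note rook = sub_rook_Suc_insert[OF finA finB insert.hyps(2) top]
  have rookD: "sub_rook lam A (insert b B - {i}) (Suc k) =
      q ^ (?T - Suc k) * sub_rook lam A (B - {i}) (Suc k) + qint (?T - k) * sub_rook lam A (B - {i}) k"
    if "i \<in> B" for i k
    using sub_rook_Suc_insert[of A "B - {i}" b lam k] finA finB insert.hyps(2) top that
    by (simp add: sub_rook_insert_delete)
  have rook0D: "sub_rook lam A (insert b B - {i}) 0 = q ^ ?T * sub_rook lam A (B - {i}) 0"
    if "i \<in> B" for i
    using sub_rook_0_insert[of A "B - {i}" b lam] finA finB insert.hyps(2) bB that
    by (simp add: sub_rook_insert_delete)
  have IH: "(\<Sum>i\<in>B. q ^ card {j \<in> B. i < j} * sub_rook lam A (B - {i}) k)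
     = qint (?n - k) * ?R k + q ^ (?n - Suc k) * (1 - q ^ Suc k) * ?R (Suc k)" for k
    using insert.IH[OF finA anti] .
  have "{j \<in> insert b B. b < j} = B" using insert.hyps by auto
  moreover have "(\<Sum>i\<in>B. q ^ card {j \<in> insert b B. i < j} * sub_rook lam A (insert b B - {i}) s)
     = (\<Sum>i\<in>B. q ^ card {j \<in> B. i < j} * sub_rook lam A (insert b B - {i}) s)"
    using card_rows_below_insert[OF insert.hyps(2), of _ "\<lambda>_. True"] by (intro sum.cong refl) simp
  ultimately have "(\<Sum>i\<in>insert b B. q ^ card {j \<in> insert b B. i < j} * sub_rook lam A (insert b B - {i}) s)
     = q ^ ?n * ?R s + (\<Sum>i\<in>B. q ^ card {j \<in> B. i < j} * sub_rook lam A (insert b B - {i}) s)"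
    using finB bB by simp
  also have "\<dots> = qint (card (insert b B) - s) * sub_rook lam A (insert b B) s
       + q ^ (card (insert b B) - Suc s) * (1 - q ^ Suc s) * sub_rook lam A (insert b B) (Suc s)"
  proof (cases s)
    case 0
    have "(\<Sum>i\<in>B. q ^ card {j \<in> B. i < j} * sub_rook lam A (insert b B - {i}) s)
        = q ^ ?T * (\<Sum>i\<in>B. q ^ card {j \<in> B. i < j} * sub_rook lam A (B - {i}) 0)"
      unfolding sum_distrib_left 0 by (intro sum.cong refl) (simp add: rook0D mult_ac)
    moreover have "q ^ ?T * (q ^ (?n - Suc 0) * ?R (Suc 0)) = q ^ ?n * (q ^ (?T - Suc 0) * ?R (Suc 0))"
    proof (cases "?T = 0 \<or> ?n = 0")
      case False
      then show ?thesis by (cases ?T; cases ?n) auto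
    qed (use R0[of 1] in auto)
    moreover have "q ^ ?n + q ^ ?T * qint ?n = qint (Suc ?n) * q ^ ?T + q ^ ?n * (1 - q) * qint ?T"
      using delete_row_step[of 0 ?n ?T] by simp
    then have "q ^ ?n * ?R 0 + q ^ ?T * (qint ?n * ?R 0)
       = qint (Suc ?n) * (q ^ ?T * ?R 0) + q ^ ?n * (1 - q) * (qint ?T * ?R 0)"
      by (simp flip: distrib_right mult.assoc)
    ultimately show ?thesis
      using finB bB sub_rook_0_insert[OF finA finB bB] rook[of 0] IH[of 0]
      by (simp add: 0 distrib_left mult.left_commute[of "1 - q"] flip: add.assoc)
  next
    case (Suc r)
    have "(\<Sum>i\<in>B. q ^ card {j \<in> B. i < j} * sub_rook lam A (insert b B - {i}) s)
        = q ^ (?T - Suc r) * (\<Sum>i\<in>B. q ^ card {j \<in> B. i < j} * sub_rook lam A (B - {i}) (Suc r))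
          + qint (?T - r) * (\<Sum>i\<in>B. q ^ card {j \<in> B. i < j} * sub_rook lam A (B - {i}) r)"
      unfolding sum_distrib_left Suc sum.distrib [symmetric]
      by (intro sum.cong refl) (simp add: rookD algebra_simps)
    also have "\<dots> = q ^ (?T - s) * (qint (?n - s) * ?R s + q ^ (?n - Suc s) * (1 - q ^ Suc s) * ?R (Suc s))
         + qint (?T - r) * (qint (?n - r) * ?R r + q ^ (?n - s) * (1 - q ^ s) * ?R s)"
      unfolding IH Suc ..
    finally have sumB: "(\<Sum>i\<in>B. q ^ card {j \<in> B. i < j} * sub_rook lam A (insert b B - {i}) s) = \<dots>" .
    have A1: "q ^ (?T - s) * (q ^ (?n - Suc s) * ?R (Suc s)) = q ^ (?n - s) * (q ^ (?T - Suc s) * ?R (Suc s))"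
    proof (cases "Suc s \<le> ?T \<and> Suc s \<le> ?n")
      case True
      then have "?T - s = Suc (?T - Suc s)" "?n - s = Suc (?n - Suc s)" by auto
      then show ?thesis by simp
    qed (use R0[of "Suc s"] in auto)
    have A2: "(q ^ ?n + q ^ (?T - s) * qint (?n - s) + qint (?T - r) * q ^ (?n - s) * (1 - q ^ s)) * ?R s
       = (qint (?n - r) * q ^ (?T - s) + q ^ (?n - s) * (1 - q ^ Suc s) * qint (?T - s)) * ?R s"
    proof (cases "s \<le> ?T \<and> s \<le> ?n")
      case True
      then show ?thesis using delete_row_step[of s ?n ?T] by (simp add: Suc)
    qed (use R0[of "s"] in auto)
    have "card (insert b B) - s = ?n - r" "card (insert b B) - Suc s = ?n - s"
      using finB bB Suc by auto
    moreover have "sub_rook lam A (insert b B) s = q ^ (?T - s) * ?R s + qint (?T - r) * ?R r"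
      using rook[of r] Suc by simp
    ultimately show ?thesis
      unfolding sumB rook[of s] by (simp only: delete_row_collect[OF A1 A2])
  qed
  finally show ?case .
qed

text \<open>At \<open>q = 1\<close> this counts the pairs of a placement of \<open>s + 1\<close> rooks and one of its rooks. For general
  \<open>q\<close> it does not hold rook by rook, since the exponent counts the cells West and South of the
  deleted cell, while a rook cancels those West and North.\<close>

lemma sum_delete_cell:
  assumes "finite B" "finite A" "\<forall>i\<in>B. \<forall>j\<in>B. i \<le> j \<longrightarrow> lam j \<le> lam i"
  shows "(\<Sum>i\<in>B. \<Sum>a\<in>row_set lam A i.
        q ^ (card {x \<in> A. x < a} + card {j \<in> B. i < j \<and> a \<le> lam j}) * sub_rook lam (A - {a}) (B - {i}) s)
     = qint (Suc s) * sub_rook lam A B (Suc s)"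
  using assms
proof (induction B arbitrary: s rule: finite_linorder_min_induct)
  case empty
  then show ?case using sub_rook_eq_0[of A "{}" "Suc s" lam] by simp
next
  case (insert b B)
  let ?R = "sub_rook lam A B" and ?A = "row_set lam A b"
  let ?T = "card ?A"
  have anti: "\<forall>i\<in>B. \<forall>j\<in>B. i \<le> j \<longrightarrow> lam j \<le> lam i" and top: "\<forall>i\<in>B. lam i \<le> lam b"
    using insert by (auto simp: less_imp_le)
  note finA = insert.prems(1) and finB = insert.hyps(1)
  have bB: "b \<notin> B" using insert.hyps by auto
  have R: "?R k = sub_rook lam ?A B k" for k
    by (rule sub_rook_row_set[OF top, symmetric])
  have RD: "sub_rook lam (A - {a}) B k = sub_rook lam (?A - {a}) B k" for a k
    using sub_rook_row_set[OF top, of "A - {a}" k] by (simp add: row_set_def set_diff_eq conj_ac)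
  have R0: "?R k = 0" if "?T < k" for k
    using that sub_rook_eq_0_row[OF finA finB top] by blast
  note rook = sub_rook_Suc_insert[OF finA finB insert.hyps(2) top]
  define w where "w i a = q ^ (card {x \<in> A. x < a} + card {j \<in> B. i < j \<and> a \<le> lam j})" for i a
  have IH: "(\<Sum>i\<in>B. \<Sum>a\<in>row_set lam A i. w i a * sub_rook lam (A - {a}) (B - {i}) k)
     = qint (Suc k) * ?R (Suc k)" for k
    unfolding w_def using insert.IH[OF finA anti] .
  have rowsub: "row_set lam A i \<subseteq> ?A" if "i \<in> B" for i
    using top that by (auto simp: row_set_def)
  have cardD: "card (row_set lam (A - {a}) b) = ?T - 1" if "a \<in> ?A" for a
  proof -
    have "row_set lam (A - {a}) b = ?A - {a}" by (auto simp: row_set_def)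
    then show ?thesis using that finA by simp
  qed
  have rookD: "sub_rook lam (A - {a}) (insert b B - {i}) (Suc k) =
      q ^ (?T - 1 - Suc k) * sub_rook lam (A - {a}) (B - {i}) (Suc k)
      + qint (?T - 1 - k) * sub_rook lam (A - {a}) (B - {i}) k"
    if "i \<in> B" "a \<in> row_set lam A i" for i a k
    using sub_rook_Suc_insert[of "A - {a}" "B - {i}" b lam k] finA finB insert.hyps(2) top that(1)
      cardD[OF subsetD[OF rowsub[OF that(1)] that(2)]] by (simp add: sub_rook_insert_delete)
  have rook0D: "sub_rook lam (A - {a}) (insert b B - {i}) 0 = q ^ (?T - 1) * sub_rook lam (A - {a}) (B - {i}) 0"
    if "i \<in> B" "a \<in> row_set lam A i" for i a
    using sub_rook_0_insert[of "A - {a}" "B - {i}" b lam] finA finB insert.hyps(2) bB that(1)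
      cardD[OF subsetD[OF rowsub[OF that(1)] that(2)]] by (simp add: sub_rook_insert_delete)
  have "(\<Sum>a\<in>?A. q ^ (card {x \<in> A. x < a} + card {j \<in> insert b B. b < j \<and> a \<le> lam j}) *
      sub_rook lam (A - {a}) (insert b B - {b}) s)
     = (\<Sum>a\<in>?A. q ^ (card {x \<in> ?A. x < a} + card {j \<in> B. a \<le> lam j}) * sub_rook lam (?A - {a}) B s)"
  proof (rule sum.cong[OF refl])
    fix a assume a: "a \<in> ?A"
    have "{x \<in> A. x < a} = {x \<in> ?A. x < a}" using a by (auto simp: row_set_def)
    moreover have "{j \<in> insert b B. b < j \<and> a \<le> lam j} = {j \<in> B. a \<le> lam j}"
      using insert.hyps(2) by auto
    moreover have "insert b B - {b} = B" using bB by simp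
    ultimately show "q ^ (card {x \<in> A. x < a} + card {j \<in> insert b B. b < j \<and> a \<le> lam j}) *
        sub_rook lam (A - {a}) (insert b B - {b}) s =
        q ^ (card {x \<in> ?A. x < a} + card {j \<in> B. a \<le> lam j}) * sub_rook lam (?A - {a}) B s"
      by (simp add: RD)
  qed
  also have "\<dots> = q ^ s * qint (?T - s) * ?R s"
    unfolding R by (rule sum_delete_column) (use finA finB anti in auto)
  finally have row_b: "(\<Sum>a\<in>?A. q ^ (card {x \<in> A. x < a} + card {j \<in> insert b B. b < j \<and> a \<le> lam j}) *
      sub_rook lam (A - {a}) (insert b B - {b}) s) = q ^ s * qint (?T - s) * ?R s" .
  have w_insert: "q ^ (card {x \<in> A. x < a} + card {j \<in> insert b B. i < j \<and> a \<le> lam j}) = w i a"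
    if "i \<in> B" for i a
    unfolding w_def using card_rows_below_insert[OF insert.hyps(2) that, of "\<lambda>j. a \<le> lam j"] by simp
  have rows_B: "(\<Sum>i\<in>B. \<Sum>a\<in>row_set lam A i. w i a * sub_rook lam (A - {a}) (insert b B - {i}) s)
     = q ^ (?T - Suc s) * (qint (Suc s) * ?R (Suc s)) + qint (?T - s) * (qint s * ?R s)"
  proof (cases s)
    case 0
    have "(\<Sum>i\<in>B. \<Sum>a\<in>row_set lam A i. w i a * sub_rook lam (A - {a}) (insert b B - {i}) s)
       = q ^ (?T - 1) * (\<Sum>i\<in>B. \<Sum>a\<in>row_set lam A i. w i a * sub_rook lam (A - {a}) (B - {i}) 0)"
      unfolding sum_distrib_left 0 by (intro sum.cong refl) (simp add: rook0D mult_ac)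
    then show ?thesis by (simp add: IH 0)
  next
    case (Suc r)
    have "(\<Sum>i\<in>B. \<Sum>a\<in>row_set lam A i. w i a * sub_rook lam (A - {a}) (insert b B - {i}) s)
       = q ^ (?T - 1 - s) * (\<Sum>i\<in>B. \<Sum>a\<in>row_set lam A i. w i a * sub_rook lam (A - {a}) (B - {i}) s)
         + qint (?T - 1 - r) * (\<Sum>i\<in>B. \<Sum>a\<in>row_set lam A i. w i a * sub_rook lam (A - {a}) (B - {i}) r)"
      unfolding sum_distrib_left Suc sum.distrib [symmetric]
      by (intro sum.cong refl) (simp add: rookD algebra_simps)
    then show ?thesis by (simp add: IH Suc)
  qed
  have "(\<Sum>i\<in>insert b B. \<Sum>a\<in>row_set lam A i.
        q ^ (card {x \<in> A. x < a} + card {j \<in> insert b B. i < j \<and> a \<le> lam j}) *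
          sub_rook lam (A - {a}) (insert b B - {i}) s)
     = q ^ s * qint (?T - s) * ?R s
       + (q ^ (?T - Suc s) * (qint (Suc s) * ?R (Suc s)) + qint (?T - s) * (qint s * ?R s))"
    unfolding sum.insert[OF finB bB] row_b rows_B[symmetric]
    by (intro arg_cong2[where f = "(+)"] refl sum.cong) (simp only: w_insert)
  also have "\<dots> = qint (Suc s) * sub_rook lam A (insert b B) (Suc s)"
    unfolding rook qint_Suc[of s] by (simp add: algebra_simps)
  finally show ?case .
qed

section \<open>Weights of the rook numbers\<close>

text \<open>The coefficient of \<open>q\<^bsup>-|\<lambda>|\<^esup> R\<^bsub>j+x\<^esub>\<close> in \<open>c\<^sub>j = q\<^sup>j [j]! [N - 2 j] H\<^sub>j\<^bsup>N-j-1\<^esup>\<close>, where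
  \<open>N = 2 j + x + t + 1\<close>. In these parameters all exponents are natural numbers.\<close>

definition gen_weight :: "nat \<Rightarrow> nat \<Rightarrow> nat \<Rightarrow> qrat" where
  "gen_weight j x t = (-1) ^ x * (qfact (j + x) / qfact x)
     * q ^ (j + j * j + j * x + (Suc x choose 2) + t * (j + x)) * (qint (x + t + 1) * qfact t)"

text \<open>The same coefficient indexed by \<open>i = j + x\<close>. For \<open>2 j = N\<close>, where the formula would contain
  \<open>[0] [-1]!\<close>, this product is replaced by \<open>1\<close>; the resulting \<open>c\<^sub>j\<close> agrees with \<open>[j]! H\<^sub>j\<^sup>j\<close>.\<close>

definition elem_weight :: "nat \<Rightarrow> nat \<Rightarrow> nat \<Rightarrow> qrat" where
  "elem_weight N j i =
     (if j \<le> i \<and> i + j < N then gen_weight j (i - j) (N - 1 - i - j)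
      else if i = j \<and> 2 * j = N then qfact j * q ^ (j * j) else 0)"

text \<open>What remains of \<open>gen_weight_rec\<close> after the common factors are removed: a polynomial identity in
  \<open>q\<close>, \<open>q\<^sup>y\<close> and \<open>q\<^sup>u\<close>.\<close>

lemma gen_weight_core:
  "(1 - q) * (qint (y + 1) * q ^ (y + u + 1) * (qint (2 * y + u + 1) * qint (y + u)))
     - q ^ (2 * y + u + 1) * (qint (2 * y + u + 1) * qint u)
   = qint (y + 1) * q ^ (y + u + 1) * qint (2 * y + u)
     - q ^ (2 * y + u + 1) * (qint (2 * y + u + 2) * qint (y + u))"
proof -
  define Y U where "Y = q ^ y" and "U = q ^ u"
  have "1 - q \<noteq> 0" by simp
  then show ?thesis
    unfolding qint_def power_add mult_2 power_one_right power2_eq_square Y_def[symmetric] U_def[symmetric]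
    by (simp add: divide_simps) algebra
qed

lemma choose_2_Suc: "(Suc x choose 2) = (x choose 2) + x"
  by (simp add: numeral_2_eq_2)

lemma gen_weight_rec:
  assumes "y + u = Suc s"
  shows "gen_weight j (Suc y) s * q ^ (j + Suc y) * qint u
       + gen_weight j y (Suc s) * q ^ (j + Suc y + u) * (1 - q ^ (j + Suc y))
       = gen_weight j (Suc y) (Suc s) + gen_weight (Suc j) y s"
proof -
  define e where "e = j + j * j + j * y + (Suc y choose 2) + s * (j + y) + (j + y)"
  define K where "K = (-1) ^ y * qfact (j + y) * qfact s / (qint (y + 1) * qfact y) * qint (j + Suc y)"
  define P where "P = K * (q ^ e * q ^ j)"
  have e1: "j + j * j + j * y + (Suc y choose 2) + Suc s * (j + y) = e"
    and e2: "j + j * j + j * Suc y + (Suc (Suc y) choose 2) + s * (j + Suc y) = e + 1 + s"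
    and e3: "j + j * j + j * Suc y + (Suc (Suc y) choose 2) + Suc s * (j + Suc y) = e + 1 + s + j + y + 1"
    and e4: "Suc j + Suc j * Suc j + Suc j * y + (Suc y choose 2) + s * (Suc j + y) = e + j + 2 + s"
    by (simp_all add: e_def choose_2_Suc algebra_simps)
  have Q: "1 - q ^ (j + Suc y) = (1 - q) * qint (j + Suc y)" by (simp add: qint_def)
  have J: "qfact (j + Suc y) = qint (j + Suc y) * qfact (j + y)" by simp
  have S: "qfact (Suc s) = qint (y + u) * qfact s" by (simp add: assms)
  have Y: "qfact (Suc y) = qint (y + 1) * qfact y" by simp
  have nz: "qint (y + Suc 0) \<noteq> 0" by simp
  have g1: "gen_weight j (Suc y) s * q ^ (j + Suc y) * qint u = - P * (q ^ (2 * y + u + 1) * (qint (2 * y + u + 1) * qint u))"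
  proof -
    have pow: "q ^ (e + 1 + s) * q ^ (j + Suc y) = q ^ e * q ^ j * q ^ (2 * y + u + 1)"
      unfolding power_add [symmetric] using assms by (intro arg_cong[where f = "power q"]) linarith
    have arg: "Suc y + s + 1 = 2 * y + u + 1" using assms by linarith
    have "gen_weight j (Suc y) s * q ^ (j + Suc y) * qint u = - K * (q ^ (e + 1 + s) * q ^ (j + Suc y)) * (qint (2 * y + u + 1) * qint u)"
      unfolding gen_weight_def e2 J Y arg by (simp add: K_def nz del: add_Suc_right)
    then show ?thesis unfolding pow P_def by (simp add: mult_ac)
  qed
  have g2: "gen_weight j y (Suc s) * q ^ (j + Suc y + u) * (1 - q ^ (j + Suc y)) = P * ((1 - q) * (qint (y + 1) * q ^ (y + u + 1) * (qint (2 * y + u + 1) * qint (y + u))))"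
  proof -
    have pow: "q ^ e * q ^ (j + Suc y + u) = q ^ e * q ^ j * q ^ (y + u + 1)"
      unfolding power_add [symmetric] using assms by (intro arg_cong[where f = "power q"]) linarith
    have arg: "y + Suc s + 1 = 2 * y + u + 1" using assms by linarith
    have "gen_weight j y (Suc s) * q ^ (j + Suc y + u) * (1 - q ^ (j + Suc y)) = K * (q ^ e * q ^ (j + Suc y + u)) * ((1 - q) * (qint (y + 1) * (qint (2 * y + u + 1) * qint (y + u))))"
      unfolding gen_weight_def e1 S Q arg by (simp add: K_def nz del: add_Suc_right)
    then show ?thesis unfolding pow P_def by (simp add: mult_ac)
  qed
  have g3: "gen_weight j (Suc y) (Suc s) = - P * (q ^ (2 * y + u + 1) * (qint (2 * y + u + 2) * qint (y + u)))"
  proof -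
    have pow: "q ^ (e + 1 + s + j + y + 1) = q ^ e * q ^ j * q ^ (2 * y + u + 1)"
      unfolding power_add [symmetric] using assms by (intro arg_cong[where f = "power q"]) linarith
    have arg: "Suc y + Suc s + 1 = 2 * y + u + 2" using assms by linarith
    have "gen_weight j (Suc y) (Suc s) = - K * q ^ (e + 1 + s + j + y + 1) * (qint (2 * y + u + 2) * qint (y + u))"
      unfolding gen_weight_def e3 J Y S arg by (simp add: K_def nz del: add_Suc_right)
    then show ?thesis unfolding pow P_def by (simp add: mult_ac)
  qed
  have g4: "gen_weight (Suc j) y s = P * (qint (y + 1) * q ^ (y + u + 1) * qint (2 * y + u))"
  proof -
    have pow: "q ^ (e + j + 2 + s) = q ^ e * q ^ j * q ^ (y + u + 1)"
      unfolding power_add [symmetric] using assms by (intro arg_cong[where f = "power q"]) linarith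
    have arg: "y + s + 1 = 2 * y + u" using assms by linarith
    have "gen_weight (Suc j) y s = K * q ^ (e + j + 2 + s) * (qint (y + 1) * qint (2 * y + u))"
      unfolding gen_weight_def e4 arg unfolding add_Suc_shift J by (simp add: K_def nz del: add_Suc_right)
    then show ?thesis unfolding pow P_def by (simp add: mult_ac)
  qed
  show ?thesis
    unfolding g1 g2 g3 g4 using arg_cong[OF gen_weight_core[of y u], of "(*) P"]
    by (simp only: right_diff_distrib minus_mult_left [symmetric])
qed

text \<open>The degenerate instance \<open>y + u = 0\<close> of \<open>gen_weight_rec\<close>.\<close>

lemma gen_weight_rec_balanced:
  "gen_weight j 0 0 * q ^ Suc j * (1 - q ^ Suc j)
     = gen_weight j 1 0 + 2 * (qfact (Suc j) * q ^ (Suc j * Suc j))"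
proof -
  have two: "qint (Suc (Suc 0)) = 1 + q" by (simp add: qint_Suc)
  have J: "1 - q ^ Suc j = (1 - q) * qint (Suc j)" by (simp add: qint_def)
  have X: "q ^ (Suc j * Suc j) = q ^ (j + j * j) * q ^ Suc j"
    unfolding power_add [symmetric] by (simp add: algebra_simps)
  have "gen_weight j 0 0 = qfact j * q ^ (j + j * j)"
    by (simp add: gen_weight_def choose_2_Suc numeral_2_eq_2)
  moreover have "gen_weight j 1 0 = - qfact (Suc j) * q ^ (Suc j * Suc j) * (1 + q)"
    by (simp add: gen_weight_def two add.commute numeral_2_eq_2)
  ultimately show ?thesis
    unfolding J X by (simp del: power_Suc) (simp add: algebra_simps del: power_Suc)
qed

lemma elem_weight_eq_0: "N < 2 * j \<Longrightarrow> elem_weight N j i = 0" "i < j \<Longrightarrow> elem_weight N j i = 0"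
  by (auto simp: elem_weight_def)

text \<open>On weights, the effect of deleting one vertex from a graph with \<open>N + 1\<close> vertices: the coefficient
  of \<open>x\<^sub>c\<close> in \<open>e\<^bsub>N+1-j,j\<^esub>\<close> is \<open>e\<^bsub>N-j,j\<^esub> + e\<^bsub>N+1-j,j-1\<^esub>\<close> (in the variables other than \<open>x\<^sub>c\<close>), so
  \<open>e\<^bsub>N-j,j\<^esub>\<close> receives \<open>c\<^sub>j + c\<^bsub>j+1\<^esub>\<close>. The exceptions occur near \<open>j = N / 2\<close>, where the two terms
  coincide or the indices of \<open>e\<^bsub>N-j,j\<^esub>\<close> change order.\<close>

lemma elem_weight_delete_vertex:
  assumes "2 * i \<le> Suc N"
  shows "elem_weight N j i * (q ^ i * qint (Suc N - 2 * i))
       + (if i = 0 then 0 else elem_weight N j (i - 1) * (q ^ (Suc N - i) * (1 - q ^ i)))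
       = (if 2 * j = Suc N then 0 else elem_weight (Suc N) j i)
       + (if Suc (2 * j) = N then 2 else 1) * elem_weight (Suc N) (Suc j) i"
proof -
  consider "i < j" | "i = j" | "j < i" by linarith
  then show ?thesis
  proof cases
    case 1
    then show ?thesis using elem_weight_eq_0(2)[of i j] by (simp add: elem_weight_eq_0)
  next
    case 2
    consider "2 * j < N" | "2 * j = N" | "2 * j = Suc N" using assms 2 by linarith
    then have "elem_weight N j j * (q ^ j * qint (Suc N - 2 * j))
        = (if 2 * j = Suc N then 0 else elem_weight (Suc N) j j)"
    proof cases
      case 1
      then obtain t where t: "N = Suc (2 * j + t)" using less_iff_Suc_add by auto
      have "elem_weight N j j = gen_weight j 0 t" "elem_weight (Suc N) j j = gen_weight j 0 (Suc t)"
        using t by (simp_all add: elem_weight_def)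
      moreover have "Suc N - 2 * j = Suc (Suc t)" using t by simp
      ultimately show ?thesis
        using 1 by (simp add: gen_weight_def power_add del: qfact_Suc) (simp add: mult_ac)
    next
      case 2
      then have "elem_weight N j j = qfact j * q ^ (j * j)" "elem_weight (Suc N) j j = gen_weight j 0 0"
        by (auto simp: elem_weight_def)
      moreover have "Suc N - 2 * j = 1" "2 * j \<noteq> Suc N" using 2 by auto
      ultimately show ?thesis by (simp add: gen_weight_def power_add choose_2_Suc)
    qed simp
    then show ?thesis using 2 by (simp add: elem_weight_eq_0)
  next
    case 3
    then obtain y where y: "i = j + Suc y" using less_iff_Suc_add by auto
    define u where "u = Suc N - 2 * i"
    have N: "N = 2 * j + 2 * y + 1 + u" using assms y by (simp add: u_def)
    show ?thesis
    proof (cases "y + u")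
      case 0
      then have "N = 2 * j + 1" "i = Suc j" using N y by auto
      then show ?thesis using gen_weight_rec_balanced[of j]
        by (simp add: elem_weight_def del: qfact_Suc power_Suc)
    next
      case (Suc s)
      have "elem_weight N j i = gen_weight j (Suc y) s" "elem_weight N j (i - 1) = gen_weight j y (Suc s)"
        "elem_weight (Suc N) j i = gen_weight j (Suc y) (Suc s)"
        "elem_weight (Suc N) (Suc j) i = gen_weight (Suc j) y s"
        using N y Suc unfolding elem_weight_def by (auto intro!: arg_cong2[where f = "gen_weight _"])
      moreover have "Suc N - 2 * i = u" "Suc N - i = j + Suc y + u" "i \<noteq> 0" "2 * j \<noteq> Suc N" "Suc (2 * j) \<noteq> N"
        using N y Suc by auto
      ultimately show ?thesis using gen_weight_rec[OF Suc, of j] y by (simp add: mult_ac del: power_Suc)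
    qed
  qed
qed

lemma elem_weight_delete_pair:
  "elem_weight (N + 2) (Suc j) (Suc i) = q ^ Suc N * qint (Suc i) * elem_weight N j i"
proof -
  consider "j \<le> i" "i + j < N" | "i = j" "2 * j = N" | "\<not> (j \<le> i \<and> i + j < N)" "\<not> (i = j \<and> 2 * j = N)"
    by blast
  then show ?thesis
  proof cases
    case 1
    then obtain x t where x: "i = j + x" "N = Suc (2 * j + x + t)"
      by (metis add.assoc add.left_commute le_Suc_ex less_iff_Suc_add mult_2)
    have "elem_weight (N + 2) (Suc j) (Suc i) = gen_weight (Suc j) x t" "elem_weight N j i = gen_weight j x t"
      using x by (auto simp: elem_weight_def intro!: arg_cong2[where f = "gen_weight _"])
    moreover have "q ^ (Suc j + Suc j * Suc j + Suc j * x + (Suc x choose 2) + t * (Suc j + x))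
        = q ^ Suc N * q ^ (j + j * j + j * x + (Suc x choose 2) + t * (j + x))"
      unfolding power_add [symmetric] by (intro arg_cong[where f = "power q"]) (simp add: x algebra_simps)
    ultimately show ?thesis
      by (simp add: gen_weight_def x(1) mult_ac del: power_Suc mult_Suc)
  next
    case 2
    then have "q ^ (Suc j * Suc j) = q ^ Suc N * q ^ (j * j)"
      unfolding power_add [symmetric] by (intro arg_cong[where f = "power q"]) simp
    moreover have "elem_weight (N + 2) (Suc j) (Suc i) = qfact (Suc j) * q ^ (Suc j * Suc j)"
      "elem_weight N j i = qfact j * q ^ (j * j)"
      using 2 by (auto simp: elem_weight_def)
    ultimately show ?thesis using 2 by (simp add: mult_ac del: power_Suc mult_Suc)
  next
    case 3
    then show ?thesis by (auto simp: elem_weight_def)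
  qed
qed

section \<open>Coefficients of the elementary products\<close>

text \<open>The coefficient \<open>c\<^sub>j\<close> of \<open>e\<^bsub>N-j,j\<^esub>\<close>, \<open>N = |A| + |B|\<close>, for the board with columns \<open>A\<close> and rows
  \<open>B\<close>, expressed through rook numbers. It vanishes for \<open>2 j > N\<close>.\<close>

definition elem_coeff :: "(nat \<Rightarrow> nat) \<Rightarrow> nat set \<Rightarrow> nat set \<Rightarrow> nat \<Rightarrow> qrat" where
  "elem_coeff lam A B j = (\<Sum>i\<le>card A + card B. sub_rook lam A B i * elem_weight (card A + card B) j i)
     / q ^ card (subcells lam A B)"

lemma card_subcells_delete_row:
  assumes "finite A" "finite B" "i \<in> B"
  shows "card (subcells lam A B) = card (subcells lam A (B - {i})) + card (row_set lam A i)"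
  using card_subcells_insert[of A "B - {i}" i lam] assms by (simp add: insert_absorb)

lemma card_subcells_delete_column:
  assumes "finite A" "finite B" "a \<in> A"
  shows "card (subcells lam A B) = card (subcells lam (A - {a}) B) + card {i \<in> B. a \<le> lam i}"
proof -
  have "subcells lam A B = subcells lam (A - {a}) B \<union> {i \<in> B. a \<le> lam i} \<times> {a}"
    using assms by (auto simp: subcells_def)
  moreover have "card (subcells lam (A - {a}) B \<union> {i \<in> B. a \<le> lam i} \<times> {a}) =
      card (subcells lam (A - {a}) B) + card ({i \<in> B. a \<le> lam i} \<times> {a})"
    using assms by (intro card_Un_disjoint finite_subcells) (auto simp: subcells_def)
  ultimately show ?thesis by (simp add: card_cartesian_product)
qed

lemma card_columns_right:
  assumes "finite A"
  shows "card {x \<in> A. lam i < x} + card (row_set lam A i) = card A"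
proof -
  have "A = {x \<in> A. lam i < x} \<union> row_set lam A i" by (auto simp: row_set_def)
  moreover have "card ({x \<in> A. lam i < x} \<union> row_set lam A i)
      = card {x \<in> A. lam i < x} + card (row_set lam A i)"
    using assms by (intro card_Un_disjoint) (auto simp: row_set_def)
  ultimately show ?thesis by simp
qed

lemma elem_coeff_bound:
  assumes "finite A" "finite B" "min (card A) (card B) \<le> K"
  shows "elem_coeff lam A B j =
     (\<Sum>i\<le>K. sub_rook lam A B i * elem_weight (card A + card B) j i) / q ^ card (subcells lam A B)"
proof -
  have "(\<Sum>i\<le>L. sub_rook lam A B i * elem_weight (card A + card B) j i)
      = (\<Sum>i\<le>min (card A) (card B). sub_rook lam A B i * elem_weight (card A + card B) j i)"
    if "min (card A) (card B) \<le> L" for L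
    using that assms by (intro sum.mono_neutral_right) (auto intro!: sub_rook_eq_0)
  from this[OF assms(3)] this[of "card A + card B"] show ?thesis
    by (simp add: elem_coeff_def)
qed

lemma elem_coeff_eq_0: "card A + card B < 2 * j \<Longrightarrow> elem_coeff lam A B j = 0"
  by (simp add: elem_coeff_def elem_weight_eq_0)

text \<open>The exponent \<open>#{x < a}\<close> is the number of edges from smaller vertices into column \<open>a\<close>. The
  factor \<open>q\<^bsup>-|\<lambda>|\<^esup>\<close> in \<open>elem_coeff\<close> contributes the length of the deleted column, which yields the
  exponent in \<open>sum_delete_column\<close>.\<close>

lemma elem_coeff_sum_columns:
  assumes "finite A" "finite B" "\<forall>i\<in>B. \<forall>j\<in>B. i \<le> j \<longrightarrow> lam j \<le> lam i"
    and N: "card A + card B = Suc N"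
  shows "(\<Sum>a\<in>A. q ^ card {x \<in> A. x < a} * elem_coeff lam (A - {a}) B j) =
     (\<Sum>i\<le>N. elem_weight N j i * (q ^ i * qint (card A - i) * sub_rook lam A B i))
       / q ^ card (subcells lam A B)"
proof -
  let ?c = "q ^ card (subcells lam A B)"
  have "q ^ card {x \<in> A. x < a} * elem_coeff lam (A - {a}) B j =
     (\<Sum>i\<le>N. elem_weight N j i * (q ^ (card {x \<in> A. x < a} + card {i \<in> B. a \<le> lam i})
        * sub_rook lam (A - {a}) B i)) / ?c" if a: "a \<in> A" for a
  proof -
    have "card (A - {a}) + card B = N"
      using N a assms(1) by (metis card_Suc_Diff1 add_Suc Suc_inject)
    moreover from this have "elem_coeff lam (A - {a}) B j =
        (\<Sum>i\<le>N. sub_rook lam (A - {a}) B i * elem_weight (card (A - {a}) + card B) j i)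
         / q ^ card (subcells lam (A - {a}) B)"
      using assms by (intro elem_coeff_bound) auto
    moreover have "?c = q ^ card (subcells lam (A - {a}) B) * q ^ card {i \<in> B. a \<le> lam i}"
      using card_subcells_delete_column[OF assms(1,2) a, of lam] by (simp add: power_add)
    ultimately show ?thesis
      by (simp add: power_add sum_distrib_left sum_divide_distrib mult_ac)
  qed
  then have "(\<Sum>a\<in>A. q ^ card {x \<in> A. x < a} * elem_coeff lam (A - {a}) B j) =
     (\<Sum>a\<in>A. \<Sum>i\<le>N. elem_weight N j i * (q ^ (card {x \<in> A. x < a} + card {i \<in> B. a \<le> lam i})
        * sub_rook lam (A - {a}) B i)) / ?c"
    by (simp add: sum_divide_distrib)
  also have "\<dots> = (\<Sum>i\<le>N. elem_weight N j i * (\<Sum>a\<in>A. q ^ (card {x \<in> A. x < a} + card {i \<in> B. a \<le> lam i})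
        * sub_rook lam (A - {a}) B i)) / ?c"
    by (subst sum.swap) (simp add: sum_distrib_left)
  finally show ?thesis unfolding sum_delete_column[OF assms(2,1,3)] .
qed

text \<open>Here the exponent counts the edges from smaller vertices into a row. The columns not meeting row
  \<open>b\<close>, together with its cells, make up all of \<open>A\<close>, whence the factor \<open>q\<^bsup>|A|\<^esup>\<close>.\<close>

lemma elem_coeff_sum_rows:
  assumes "finite A" "finite B" "\<forall>i\<in>B. \<forall>j\<in>B. i \<le> j \<longrightarrow> lam j \<le> lam i"
    and N: "card A + card B = Suc N"
  shows "(\<Sum>b\<in>B. q ^ (card {x \<in> A. lam b < x} + card {i \<in> B. b < i}) * elem_coeff lam A (B - {b}) j) =
     (\<Sum>i\<le>N. elem_weight N j i * (q ^ card A * (qint (card B - i) * sub_rook lam A B i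
        + q ^ (card B - Suc i) * (1 - q ^ Suc i) * sub_rook lam A B (Suc i))))
       / q ^ card (subcells lam A B)"
proof -
  let ?c = "q ^ card (subcells lam A B)"
  have "q ^ (card {x \<in> A. lam b < x} + card {i \<in> B. b < i}) * elem_coeff lam A (B - {b}) j =
     (\<Sum>i\<le>N. elem_weight N j i * (q ^ card A * (q ^ card {i \<in> B. b < i}
        * sub_rook lam A (B - {b}) i))) / ?c" if b: "b \<in> B" for b
  proof -
    have "card A + card (B - {b}) = N"
      using N b assms(2) by (metis card_Suc_Diff1 add_Suc_right Suc_inject)
    moreover from this have "elem_coeff lam A (B - {b}) j =
        (\<Sum>i\<le>N. sub_rook lam A (B - {b}) i * elem_weight (card A + card (B - {b})) j i)
         / q ^ card (subcells lam A (B - {b}))"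
      using assms by (intro elem_coeff_bound) auto
    moreover have "?c = q ^ card (subcells lam A (B - {b})) * q ^ card (row_set lam A b)"
      using card_subcells_delete_row[OF assms(1,2) b, of lam] by (simp add: power_add)
    moreover have "q ^ card A = q ^ card {x \<in> A. lam b < x} * q ^ card (row_set lam A b)"
      using card_columns_right[OF assms(1), of lam b] by (simp flip: power_add)
    ultimately show ?thesis
      by (simp add: power_add sum_distrib_left sum_divide_distrib mult_ac)
  qed
  then have "(\<Sum>b\<in>B. q ^ (card {x \<in> A. lam b < x} + card {i \<in> B. b < i}) * elem_coeff lam A (B - {b}) j) =
     (\<Sum>b\<in>B. \<Sum>i\<le>N. elem_weight N j i * (q ^ card A * (q ^ card {i \<in> B. b < i}
        * sub_rook lam A (B - {b}) i))) / ?c"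
    by (simp add: sum_divide_distrib)
  also have "\<dots> = (\<Sum>i\<le>N. elem_weight N j i * (q ^ card A * (\<Sum>b\<in>B. q ^ card {i \<in> B. b < i}
        * sub_rook lam A (B - {b}) i))) / ?c"
    by (subst sum.swap) (simp add: sum_distrib_left)
  finally show ?thesis unfolding sum_delete_row[OF assms(2,1,3)] .
qed

lemma vertex_collect:
  fixes e :: "'a :: comm_ring"
  assumes "(x + a * y) * R = z * R" "a * b * S = c * S"
  shows "e * (x * R) + e * (a * (y * R + b * d * S)) = e * z * R + e * (c * d) * S"
proof -
  have "e * (x * R) + e * (a * (y * R + b * d * S)) = e * ((x + a * y) * R) + e * d * (a * b * S)"
    by (simp add: algebra_simps)
  then show ?thesis unfolding assms by (simp add: algebra_simps)
qed

lemma elem_coeff_delete_vertex: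
  assumes "finite A" "finite B" "\<forall>i\<in>B. \<forall>j\<in>B. i \<le> j \<longrightarrow> lam j \<le> lam i"
    and N: "card A + card B = Suc N"
  shows "(\<Sum>a\<in>A. q ^ card {x \<in> A. x < a} * elem_coeff lam (A - {a}) B j)
     + (\<Sum>b\<in>B. q ^ (card {x \<in> A. lam b < x} + card {i \<in> B. b < i}) * elem_coeff lam A (B - {b}) j)
     = (if 2 * j = Suc N then 0 else elem_coeff lam A B j)
       + (if Suc (2 * j) = N then 2 else 1) * elem_coeff lam A B (Suc j)"
proof -
  let ?R = "sub_rook lam A B" and ?c = "q ^ card (subcells lam A B)"
  have R0: "?R i = 0" if "card A < i \<or> card B < i" for i
    using that sub_rook_eq_0[OF assms(1,2)] by blast
  have "elem_weight N j i * (q ^ i * qint (card A - i) * ?R i)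
      + elem_weight N j i * (q ^ card A * (qint (card B - i) * ?R i
          + q ^ (card B - Suc i) * (1 - q ^ Suc i) * ?R (Suc i)))
     = elem_weight N j i * (q ^ i * qint (Suc N - 2 * i)) * ?R i
      + elem_weight N j i * (q ^ (N - i) * (1 - q ^ Suc i)) * ?R (Suc i)" for i
  proof -
    have "(q ^ i * qint (card A - i) + q ^ card A * qint (card B - i)) * ?R i
        = q ^ i * qint (Suc N - 2 * i) * ?R i"
    proof (cases "i \<le> card A \<and> i \<le> card B")
      case True
      then have "Suc N - 2 * i = (card A - i) + (card B - i)" using N by simp
      moreover have "q ^ card A = q ^ i * q ^ (card A - i)" using True by (simp flip: power_add)
      ultimately show ?thesis by (simp add: qint_add algebra_simps)
    qed (use R0 in auto)
    moreover have "q ^ card A * q ^ (card B - Suc i) * ?R (Suc i) = q ^ (N - i) * ?R (Suc i)"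
    proof (cases "Suc i \<le> card A \<and> Suc i \<le> card B")
      case True
      then have "N - i = card A + (card B - Suc i)" using N by simp
      then show ?thesis by (simp add: power_add)
    qed (use R0 in auto)
    ultimately show ?thesis by (rule vertex_collect)
  qed
  then have "(\<Sum>a\<in>A. q ^ card {x \<in> A. x < a} * elem_coeff lam (A - {a}) B j)
     + (\<Sum>b\<in>B. q ^ (card {x \<in> A. lam b < x} + card {i \<in> B. b < i}) * elem_coeff lam A (B - {b}) j)
     = ((\<Sum>i\<le>N. elem_weight N j i * (q ^ i * qint (Suc N - 2 * i)) * ?R i)
        + (\<Sum>i\<le>N. elem_weight N j i * (q ^ (N - i) * (1 - q ^ Suc i)) * ?R (Suc i))) / ?c"
    unfolding elem_coeff_sum_columns[OF assms] elem_coeff_sum_rows[OF assms] add_divide_distrib [symmetric]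
      sum.distrib [symmetric] by (simp only:)
  also have "(\<Sum>i\<le>N. elem_weight N j i * (q ^ i * qint (Suc N - 2 * i)) * ?R i)
      = (\<Sum>i\<le>Suc N. elem_weight N j i * (q ^ i * qint (Suc N - 2 * i)) * ?R i)" by simp
  also have "(\<Sum>i\<le>N. elem_weight N j i * (q ^ (N - i) * (1 - q ^ Suc i)) * ?R (Suc i))
      = (\<Sum>i\<le>Suc N. (if i = 0 then 0 else elem_weight N j (i - 1) * (q ^ (Suc N - i) * (1 - q ^ i))) * ?R i)"
    unfolding sum.atMost_Suc_shift by (simp del: power_Suc)
  also have "(\<Sum>i\<le>Suc N. elem_weight N j i * (q ^ i * qint (Suc N - 2 * i)) * ?R i) + \<dots>
     = (\<Sum>i\<le>Suc N. (if 2 * j = Suc N then 0 else ?R i * elem_weight (Suc N) j i)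
       + (if Suc (2 * j) = N then 2 else 1) * (?R i * elem_weight (Suc N) (Suc j) i))"
    unfolding sum.distrib [symmetric]
  proof (rule sum.cong[OF refl])
    fix i
    show "elem_weight N j i * (q ^ i * qint (Suc N - 2 * i)) * ?R i
       + (if i = 0 then 0 else elem_weight N j (i - 1) * (q ^ (Suc N - i) * (1 - q ^ i))) * ?R i
       = (if 2 * j = Suc N then 0 else ?R i * elem_weight (Suc N) j i)
       + (if Suc (2 * j) = N then 2 else 1) * (?R i * elem_weight (Suc N) (Suc j) i)"
    proof (cases "i \<le> card A \<and> i \<le> card B")
      case True
      then have "2 * i \<le> Suc N" using N by simp
      show ?thesis
        unfolding distrib_right [symmetric] elem_weight_delete_vertex[OF \<open>2 * i \<le> Suc N\<close>]
        by (simp add: algebra_simps)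
    qed (use R0 in auto)
  qed
  also have "\<dots> / ?c = (if 2 * j = Suc N then 0 else elem_coeff lam A B j)
       + (if Suc (2 * j) = N then 2 else 1) * elem_coeff lam A B (Suc j)"
    unfolding elem_coeff_def N sum.distrib by (simp add: add_divide_distrib sum_distrib_left)
  finally show ?thesis .
qed

text \<open>Comparison of the exponent arising from the colourings with the one in \<open>sum_delete_cell\<close>: by
  antitonicity, every row above \<open>i\<close> also meets column \<open>a\<close>.\<close>

lemma pair_weight:
  assumes "finite A" "finite B" "\<forall>i\<in>B. \<forall>j\<in>B. i \<le> j \<longrightarrow> lam j \<le> lam i"
    and "i \<in> B" "a \<in> row_set lam A i"
  shows "card (subcells lam A B) + (card {x \<in> A. x < a} + (card {x \<in> A. lam i < x} + card {j \<in> B. i < j})) + 1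
     = card (subcells lam (A - {a}) (B - {i})) + (card {x \<in> A. x < a} + card {j \<in> B. i < j \<and> a \<le> lam j})
       + (card A + card B)"
proof -
  have a: "a \<in> A" "a \<le> lam i" using assms(5) by (auto simp: row_set_def)
  have "card (subcells lam A B) = card (subcells lam A (B - {i})) + card (row_set lam A i)"
    by (rule card_subcells_delete_row[OF assms(1,2,4)])
  moreover have "card (subcells lam A (B - {i})) =
      card (subcells lam (A - {a}) (B - {i})) + card {j \<in> B - {i}. a \<le> lam j}"
    using assms a by (intro card_subcells_delete_column) auto
  moreover have "card {x \<in> A. lam i < x} + card (row_set lam A i) = card A"
    by (rule card_columns_right[OF assms(1)])
  moreover have "card {j \<in> B - {i}. a \<le> lam j} = card {j \<in> B. j < i} + card {j \<in> B. i < j \<and> a \<le> lam j}"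
  proof -
    have "{j \<in> B - {i}. a \<le> lam j} = {j \<in> B. j < i} \<union> {j \<in> B. i < j \<and> a \<le> lam j}"
    proof (intro set_eqI iffI)
      fix j assume "j \<in> {j \<in> B. j < i} \<union> {j \<in> B. i < j \<and> a \<le> lam j}"
      then show "j \<in> {j \<in> B - {i}. a \<le> lam j}"
        using assms(3,4) a(2) by (auto intro: le_trans)
    qed auto
    also have "card \<dots> = card {j \<in> B. j < i} + card {j \<in> B. i < j \<and> a \<le> lam j}"
      using assms by (intro card_Un_disjoint) auto
    finally show ?thesis .
  qed
  moreover have "card B = Suc (card {j \<in> B. j < i} + card {j \<in> B. i < j})"
  proof -
    have "B - {i} = {j \<in> B. j < i} \<union> {j \<in> B. i < j}" by auto
    also have "card \<dots> = card {j \<in> B. j < i} + card {j \<in> B. i < j}"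
      using assms by (intro card_Un_disjoint) auto
    finally show ?thesis using assms(2,4) by (metis card_Suc_Diff1)
  qed
  ultimately show ?thesis by simp
qed

lemma elem_coeff_delete_pair:
  assumes "finite A" "finite B" "\<forall>i\<in>B. \<forall>j\<in>B. i \<le> j \<longrightarrow> lam j \<le> lam i"
    and N: "card A + card B = N + 2"
  shows "(\<Sum>i\<in>B. \<Sum>a\<in>row_set lam A i.
       q ^ (card {x \<in> A. x < a} + (card {x \<in> A. lam i < x} + card {j \<in> B. i < j}))
         * elem_coeff lam (A - {a}) (B - {i}) j) = elem_coeff lam A B (Suc j)"
proof -
  let ?R = "sub_rook lam A B" and ?c = "q ^ card (subcells lam A B)"
  have "q ^ (card {x \<in> A. x < a} + (card {x \<in> A. lam i < x} + card {j \<in> B. i < j}))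
         * elem_coeff lam (A - {a}) (B - {i}) j
      = (\<Sum>k\<le>Suc N. q ^ Suc N * elem_weight N j k *
          (q ^ (card {x \<in> A. x < a} + card {j \<in> B. i < j \<and> a \<le> lam j}) * sub_rook lam (A - {a}) (B - {i}) k)) / ?c"
    if i: "i \<in> B" "a \<in> row_set lam A i" for i a
  proof -
    have a: "a \<in> A" using i by (auto simp: row_set_def)
    have N': "card (A - {a}) + card (B - {i}) = N"
      using N card_Suc_Diff1[OF assms(1) a] card_Suc_Diff1[OF assms(2) i(1)] by linarith
    then have "elem_coeff lam (A - {a}) (B - {i}) j =
        (\<Sum>k\<le>Suc N. sub_rook lam (A - {a}) (B - {i}) k * elem_weight (card (A - {a}) + card (B - {i})) j k)
         / q ^ card (subcells lam (A - {a}) (B - {i}))"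
      using assms by (intro elem_coeff_bound) auto
    note E = this[unfolded N']
    define u v w where "u = card {x \<in> A. x < a} + (card {x \<in> A. lam i < x} + card {j \<in> B. i < j})"
      and "v = card {x \<in> A. x < a} + card {j \<in> B. i < j \<and> a \<le> lam j}"
      and "w = card (subcells lam (A - {a}) (B - {i}))"
    have "card (subcells lam A B) + u = w + v + Suc N"
      using pair_weight[OF assms(1-3) i] N unfolding u_def v_def w_def by simp
    then have "?c * q ^ u = q ^ w * (q ^ v * q ^ Suc N)"
      unfolding power_add [symmetric] by (intro arg_cong[where f = "power q"]) linarith
    then have "q ^ u / q ^ w = q ^ v * q ^ Suc N / ?c" by (simp add: frac_eq_eq mult_ac del: power_Suc)
    moreover have "q ^ u * (S / q ^ w) = q ^ u / q ^ w * S" for S by simp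
    ultimately have "q ^ u * ((\<Sum>k\<le>Suc N. sub_rook lam (A - {a}) (B - {i}) k * elem_weight N j k) / q ^ w)
        = q ^ v * q ^ Suc N / ?c * (\<Sum>k\<le>Suc N. sub_rook lam (A - {a}) (B - {i}) k * elem_weight N j k)"
      by (simp only:)
    then show ?thesis unfolding E u_def[symmetric] v_def[symmetric] w_def[symmetric]
      unfolding sum_distrib_left sum_divide_distrib by (simp add: mult_ac del: power_Suc)
  qed
  then have "(\<Sum>i\<in>B. \<Sum>a\<in>row_set lam A i.
       q ^ (card {x \<in> A. x < a} + (card {x \<in> A. lam i < x} + card {j \<in> B. i < j}))
         * elem_coeff lam (A - {a}) (B - {i}) j)
      = (\<Sum>i\<in>B. \<Sum>a\<in>row_set lam A i. \<Sum>k\<le>Suc N. q ^ Suc N * elem_weight N j k *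
          (q ^ (card {x \<in> A. x < a} + card {j \<in> B. i < j \<and> a \<le> lam j}) * sub_rook lam (A - {a}) (B - {i}) k)) / ?c"
    by (simp only: sum_divide_distrib cong: sum.cong)
  also have "\<dots> = (\<Sum>k\<le>Suc N. q ^ Suc N * elem_weight N j k * (\<Sum>i\<in>B. \<Sum>a\<in>row_set lam A i.
          (q ^ (card {x \<in> A. x < a} + card {j \<in> B. i < j \<and> a \<le> lam j}) * sub_rook lam (A - {a}) (B - {i}) k))) / ?c"
    unfolding sum_distrib_left
    by (subst sum.swap[of _ "{..Suc N}"]) (intro arg_cong2[where f = "(/)"] sum.cong refl sum.swap)
  also have "\<dots> = (\<Sum>k\<le>Suc N. ?R (Suc k) * elem_weight (N + 2) (Suc j) (Suc k)) / ?c"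
    unfolding sum_delete_cell[OF assms(2,1,3)] elem_weight_delete_pair by (simp only: mult_ac)
  also have "\<dots> = (\<Sum>k\<le>Suc (Suc N). ?R k * elem_weight (N + 2) (Suc j) k) / ?c"
    unfolding sum.atMost_Suc_shift[of _ "Suc N"] by (simp add: elem_weight_eq_0)
  also have "\<dots> = elem_coeff lam A B (Suc j)" unfolding elem_coeff_def N by simp
  finally show ?thesis .
qed

section \<open>Coefficients of monomials\<close>

text \<open>The coefficient in \<open>e\<^bsub>N-j,j\<^esub>\<close> of a monomial of degree \<open>N\<close> with \<open>r\<close> exponents \<open>2\<close> and the others
  \<open>1\<close>: the doubled variables occur in both factors, and \<open>j - r\<close> of the simple ones in the second.\<close>

definition split_count :: "nat \<Rightarrow> nat \<Rightarrow> nat \<Rightarrow> nat" where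
  "split_count N r j = (if r \<le> j then (N - 2 * r) choose (j - r) else 0)"

text \<open>The coefficient of such a monomial in \<open>\<Sum>\<^sub>j c\<^sub>j e\<^bsub>N-j,j\<^esub>\<close>.\<close>

definition monomial_coeff :: "(nat \<Rightarrow> nat) \<Rightarrow> nat set \<Rightarrow> nat set \<Rightarrow> nat \<Rightarrow> qrat" where
  "monomial_coeff lam A B r =
     (\<Sum>j\<le>card A + card B. elem_coeff lam A B j * of_nat (split_count (card A + card B) r j))"

lemma split_count_Suc:
  assumes "2 * r < Suc N"
  shows "split_count (Suc N) r (Suc j) = split_count N r (Suc j) + split_count N r j"
    and "split_count (Suc N) r 0 = split_count N r 0"
  using assms by (auto simp: split_count_def Suc_diff_le not_le le_Suc_eq)

lemma split_count_Suc_Suc: "split_count (N + 2) (Suc r) (Suc j) = split_count N r j"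
proof -
  have "N + 2 - 2 * Suc r = N - 2 * r" by simp
  then show ?thesis by (simp only: split_count_def Suc_le_mono diff_Suc_Suc)
qed

lemma split_count_symmetric:
  assumes "2 * r < N" "N = 2 * Suc h"
  shows "split_count (N - 1) r (Suc h) = split_count (N - 1) r h"
proof -
  have "N - 1 - 2 * r = (h - r) + (Suc h - r)" "r \<le> h" using assms by auto
  then show ?thesis
    using binomial_symmetric[of "h - r" "N - 1 - 2 * r"] by (simp add: split_count_def)
qed

lemma monomial_coeff_delete_vertex:
  assumes "finite A" "finite B" "\<forall>i\<in>B. \<forall>j\<in>B. i \<le> j \<longrightarrow> lam j \<le> lam i"
    and N: "card A + card B = Suc N" and r: "2 * r < Suc N"
  shows "(\<Sum>a\<in>A. q ^ card {x \<in> A. x < a} * monomial_coeff lam (A - {a}) B r)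
     + (\<Sum>b\<in>B. q ^ (card {x \<in> A. lam b < x} + card {i \<in> B. b < i}) * monomial_coeff lam A (B - {b}) r)
     = monomial_coeff lam A B r"
proof -
  let ?E = "elem_coeff lam A B" and ?C = "\<lambda>j. of_nat (split_count N r j) :: qrat"
  have NA: "card (A - {a}) + card B = N" if "a \<in> A" for a
    using N card_Suc_Diff1[OF assms(1) that] by linarith
  have NB: "card A + card (B - {b}) = N" if "b \<in> B" for b
    using N card_Suc_Diff1[OF assms(2) that] by linarith
  have MA: "monomial_coeff lam (A - {a}) B r = (\<Sum>j\<le>N. elem_coeff lam (A - {a}) B j * ?C j)"
    if "a \<in> A" for a
    unfolding monomial_coeff_def NA[OF that] ..
  have MB: "monomial_coeff lam A (B - {b}) r = (\<Sum>j\<le>N. elem_coeff lam A (B - {b}) j * ?C j)"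
    if "b \<in> B" for b
    unfolding monomial_coeff_def NB[OF that] ..
  have "(\<Sum>a\<in>A. q ^ card {x \<in> A. x < a} * monomial_coeff lam (A - {a}) B r)
     = (\<Sum>a\<in>A. \<Sum>j\<le>N. q ^ card {x \<in> A. x < a} * elem_coeff lam (A - {a}) B j * ?C j)"
    by (intro sum.cong refl) (simp only: MA sum_distrib_left mult.assoc)
  also have "\<dots> = (\<Sum>j\<le>N. (\<Sum>a\<in>A. q ^ card {x \<in> A. x < a} * elem_coeff lam (A - {a}) B j) * ?C j)"
    by (subst sum.swap) (simp add: sum_distrib_right)
  finally have SA: "(\<Sum>a\<in>A. q ^ card {x \<in> A. x < a} * monomial_coeff lam (A - {a}) B r) = \<dots>" .
  have "(\<Sum>b\<in>B. q ^ (card {x \<in> A. lam b < x} + card {i \<in> B. b < i}) * monomial_coeff lam A (B - {b}) r)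
     = (\<Sum>b\<in>B. \<Sum>j\<le>N. q ^ (card {x \<in> A. lam b < x} + card {i \<in> B. b < i})
          * elem_coeff lam A (B - {b}) j * ?C j)"
    by (intro sum.cong refl) (simp only: MB sum_distrib_left mult.assoc)
  also have "\<dots> = (\<Sum>j\<le>N. (\<Sum>b\<in>B. q ^ (card {x \<in> A. lam b < x} + card {i \<in> B. b < i})
          * elem_coeff lam A (B - {b}) j) * ?C j)"
    by (subst sum.swap) (simp add: sum_distrib_right)
  finally have SB: "(\<Sum>b\<in>B. q ^ (card {x \<in> A. lam b < x} + card {i \<in> B. b < i})
      * monomial_coeff lam A (B - {b}) r) = \<dots>" .
  have top: "?E (Suc N) = 0" by (rule elem_coeff_eq_0) (simp add: N)
  \<comment> \<open>For even \<open>N + 1\<close> the exceptional terms at the middle index cancel, by symmetry of the binomials.\<close>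
  have middle: "(\<Sum>j\<le>N. (if 2 * j = Suc N then ?E j * ?C j else 0))
      = (\<Sum>j\<le>N. (if Suc (2 * j) = N then ?E (Suc j) * ?C j else 0))"
  proof (cases "\<exists>h. Suc N = 2 * Suc h")
    case True
    then obtain h where h: "Suc N = 2 * Suc h" by blast
    have "(\<Sum>j\<le>N. (if 2 * j = Suc N then ?E j * ?C j else 0))
        = (\<Sum>j\<le>N. (if j = Suc h then ?E j * ?C j else 0))"
      using h by (intro sum.cong refl) auto
    also have "\<dots> = ?E (Suc h) * ?C (Suc h)" using h by (simp add: sum.delta)
    also have "\<dots> = ?E (Suc h) * ?C h"
      using split_count_symmetric[OF r h] by simp
    also have "\<dots> = (\<Sum>j\<le>N. (if j = h then ?E (Suc j) * ?C j else 0))"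
      using h by (simp add: sum.delta)
    also have "\<dots> = (\<Sum>j\<le>N. (if Suc (2 * j) = N then ?E (Suc j) * ?C j else 0))"
      using h by (intro sum.cong refl) auto
    finally show ?thesis .
  next
    case False
    have "2 * j \<noteq> Suc N" for j
      using False by (cases j) auto
    moreover from this[of "Suc _"] have "Suc (2 * j) \<noteq> N" for j by simp
    ultimately show ?thesis by simp
  qed
  have "(\<Sum>a\<in>A. q ^ card {x \<in> A. x < a} * monomial_coeff lam (A - {a}) B r)
     + (\<Sum>b\<in>B. q ^ (card {x \<in> A. lam b < x} + card {i \<in> B. b < i}) * monomial_coeff lam A (B - {b}) r)
     = (\<Sum>j\<le>N. ((if 2 * j = Suc N then 0 else ?E j) + (if Suc (2 * j) = N then 2 else 1) * ?E (Suc j)) * ?C j)"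
    unfolding SA SB sum.distrib [symmetric] distrib_right [symmetric]
      elem_coeff_delete_vertex[OF assms(1-4)] ..
  also have "\<dots> = (\<Sum>j\<le>N. (?E j * ?C j + ?E (Suc j) * ?C j)
      - (if 2 * j = Suc N then ?E j * ?C j else 0) + (if Suc (2 * j) = N then ?E (Suc j) * ?C j else 0))"
    by (intro sum.cong refl) (simp add: algebra_simps)
  also have "\<dots> = (\<Sum>j\<le>N. ?E j * ?C j) + (\<Sum>j\<le>N. ?E (Suc j) * ?C j)"
    unfolding sum.distrib sum_subtractf middle by simp
  also have "(\<Sum>j\<le>N. ?E j * ?C j) = (\<Sum>j\<le>Suc N. ?E j * ?C j)" using top by simp
  also have "\<dots> = ?E 0 * ?C 0 + (\<Sum>j\<le>N. ?E (Suc j) * ?C (Suc j))" by (rule sum.atMost_Suc_shift)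
  also have "\<dots> + (\<Sum>j\<le>N. ?E (Suc j) * ?C j)
      = ?E 0 * of_nat (split_count (Suc N) r 0) + (\<Sum>j\<le>N. ?E (Suc j) * of_nat (split_count (Suc N) r (Suc j)))"
    using split_count_Suc[OF r] by (simp add: sum.distrib distrib_left)
  also have "\<dots> = monomial_coeff lam A B r"
    unfolding monomial_coeff_def N by (rule sum.atMost_Suc_shift[symmetric])
  finally show ?thesis .
qed

lemma monomial_coeff_delete_pair:
  assumes "finite A" "finite B" "\<forall>i\<in>B. \<forall>j\<in>B. i \<le> j \<longrightarrow> lam j \<le> lam i"
    and N: "card A + card B = N + 2"
  shows "(\<Sum>i\<in>B. \<Sum>a\<in>row_set lam A i.
       q ^ (card {x \<in> A. x < a} + (card {x \<in> A. lam i < x} + card {j \<in> B. i < j}))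
         * monomial_coeff lam (A - {a}) (B - {i}) r) = monomial_coeff lam A B (Suc r)"
proof -
  define w where "w i a = q ^ (card {x \<in> A. x < a} + (card {x \<in> A. lam i < x} + card {j \<in> B. i < j}))" for i a
  let ?C = "\<lambda>j. of_nat (split_count N r j) :: qrat"
  have N': "card (A - {a}) + card (B - {i}) = N" if "i \<in> B" "a \<in> row_set lam A i" for i a
  proof -
    have "a \<in> A" using that by (auto simp: row_set_def)
    then show ?thesis
      using N card_Suc_Diff1[OF assms(1), of a] card_Suc_Diff1[OF assms(2) that(1)] by linarith
  qed
  have M': "monomial_coeff lam (A - {a}) (B - {i}) r = (\<Sum>j\<le>N. elem_coeff lam (A - {a}) (B - {i}) j * ?C j)"
    if "i \<in> B" "a \<in> row_set lam A i" for i a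
    unfolding monomial_coeff_def N'[OF that] ..
  have "(\<Sum>i\<in>B. \<Sum>a\<in>row_set lam A i. w i a * monomial_coeff lam (A - {a}) (B - {i}) r)
     = (\<Sum>i\<in>B. \<Sum>a\<in>row_set lam A i. \<Sum>j\<le>N. w i a * elem_coeff lam (A - {a}) (B - {i}) j * ?C j)"
    by (intro sum.cong refl) (simp only: M' sum_distrib_left mult.assoc)
  also have "\<dots> = (\<Sum>j\<le>N. (\<Sum>i\<in>B. \<Sum>a\<in>row_set lam A i. w i a * elem_coeff lam (A - {a}) (B - {i}) j) * ?C j)"
    unfolding sum_distrib_right
    by (subst sum.swap[of _ "{..N}"]) (intro sum.cong refl sum.swap)
  also have "\<dots> = (\<Sum>j\<le>N. elem_coeff lam A B (Suc j) * ?C j)"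
    unfolding w_def elem_coeff_delete_pair[OF assms] ..
  also have "\<dots> = (\<Sum>j\<le>Suc N. elem_coeff lam A B (Suc j) * of_nat (split_count (N + 2) (Suc r) (Suc j)))"
    using elem_coeff_eq_0[of A B "Suc (Suc N)" lam] N by (simp only: split_count_Suc_Suc) simp
  also have "\<dots> = (\<Sum>j\<le>N + 2. elem_coeff lam A B j * of_nat (split_count (N + 2) (Suc r) j))"
    using sum.atMost_Suc_shift[of "\<lambda>j. elem_coeff lam A B j * of_nat (split_count (N + 2) (Suc r) j)" "Suc N"]
    by (simp add: split_count_def)
  finally show ?thesis unfolding w_def monomial_coeff_def N .
qed

lemma monomial_coeff_empty: "monomial_coeff lam {} {} 0 = 1"
  by (simp add: monomial_coeff_def split_count_def elem_coeff_def elem_weight_def sub_rook_0 subcells_def)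

section \<open>Colourings and the largest colour class\<close>

text \<open>Independent sets of a graph whose edges are represented by ordered pairs.\<close>

definition indep :: "(nat \<times> nat) set \<Rightarrow> nat set \<Rightarrow> bool" where
  "indep E S \<longleftrightarrow> (\<forall>a\<in>S. \<forall>b\<in>S. (a, b) \<notin> E)"

text \<open>The proper colourings of the subgraph induced on \<open>V\<close> whose monomial is \<open>\<alpha>\<close>.\<close>

definition colorings :: "(nat \<times> nat) set \<Rightarrow> nat set \<Rightarrow> nat multiset \<Rightarrow> (nat \<Rightarrow> nat) set" where
  "colorings E V \<alpha> = {\<kappa> \<in> V \<rightarrow>\<^sub>E UNIV. (\<forall>a\<in>V. \<forall>b\<in>V. (a, b) \<in> E \<longrightarrow> \<kappa> a \<noteq> \<kappa> b) \<and>
     image_mset \<kappa> (mset_set V) = \<alpha>}"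

text \<open>The number of edges \<open>(a, b)\<close> within \<open>V\<close> along which the colour increases.\<close>

definition ascents :: "(nat \<times> nat) set \<Rightarrow> nat set \<Rightarrow> (nat \<Rightarrow> nat) \<Rightarrow> nat" where
  "ascents E V \<kappa> = card {(a, b). (a, b) \<in> E \<and> a \<in> V \<and> b \<in> V \<and> \<kappa> a < \<kappa> b}"

text \<open>The ascent generating function of these colourings.\<close>

definition color_sum :: "(nat \<times> nat) set \<Rightarrow> nat set \<Rightarrow> nat multiset \<Rightarrow> qrat" where
  "color_sum E V \<alpha> = (\<Sum>\<kappa>\<in>colorings E V \<alpha>. q ^ ascents E V \<kappa>)"

lemma finite_colorings:
  assumes "finite V"
  shows "finite (colorings E V \<alpha>)"
proof (rule finite_subset)
  show "colorings E V \<alpha> \<subseteq> V \<rightarrow>\<^sub>E set_mset \<alpha>"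
    using assms by (auto simp: colorings_def PiE_iff extensional_def)
qed (use assms in \<open>simp add: finite_PiE\<close>)

lemma image_mset_color_class:
  assumes "finite V" "S \<subseteq> V" "\<And>v. v \<in> S \<Longrightarrow> \<kappa> v = c" "\<And>v. v \<in> V - S \<Longrightarrow> \<kappa> v \<noteq> c"
  shows "count (image_mset \<kappa> (mset_set V)) c = card S"
    and "filter_mset (\<lambda>x. x \<noteq> c) (image_mset \<kappa> (mset_set V)) = image_mset \<kappa> (mset_set (V - S))"
    and "image_mset \<kappa> (mset_set V) = replicate_mset (card S) c + image_mset \<kappa> (mset_set (V - S))"
proof -
  have "mset_set V = mset_set S + mset_set (V - S)"
    using assms(1,2) mset_set_Union[of S "V - S"] finite_subset[OF assms(2,1)]
    by (simp add: Un_absorb1)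
  moreover have "image_mset \<kappa> (mset_set S) = replicate_mset (card S) c"
  proof -
    have "image_mset \<kappa> (mset_set S) = image_mset (\<lambda>_. c) (mset_set S)"
      using assms(3) finite_subset[OF assms(2,1)] by (intro image_mset_cong) simp
    then show ?thesis by (simp add: image_mset_const_eq)
  qed
  ultimately show eq: "image_mset \<kappa> (mset_set V) = replicate_mset (card S) c + image_mset \<kappa> (mset_set (V - S))"
    by simp
  have notc: "x \<noteq> c" if "x \<in># image_mset \<kappa> (mset_set (V - S))" for x
    using that assms(1,4) by auto
  then have "c \<notin># image_mset \<kappa> (mset_set (V - S))" by blast
  then have "count (image_mset \<kappa> (mset_set (V - S))) c = 0" by (rule not_in_iff[THEN iffD1])
  then show "count (image_mset \<kappa> (mset_set V)) c = card S"
    unfolding eq by simp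
  have "filter_mset (\<lambda>x. x \<noteq> c) (image_mset \<kappa> (mset_set (V - S))) = image_mset \<kappa> (mset_set (V - S))"
    using notc by (simp add: filter_mset_eq_conv)
  moreover have "filter_mset (\<lambda>x. x \<noteq> c) (replicate_mset (card S) c) = {#}"
    by (simp add: filter_mset_eq_conv)
  ultimately show "filter_mset (\<lambda>x. x \<noteq> c) (image_mset \<kappa> (mset_set V)) = image_mset \<kappa> (mset_set (V - S))"
    unfolding eq by simp
qed

lemma ascents_remove_max_class:
  assumes "finite V" "S \<subseteq> V" "indep E S" "\<And>v. v \<in> S \<Longrightarrow> \<kappa> v = c" "\<And>v. v \<in> V - S \<Longrightarrow> \<kappa> v < c"
    and "\<And>v. v \<in> V - S \<Longrightarrow> \<kappa>' v = \<kappa> v"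
  shows "ascents E V \<kappa> = card {(a, b). (a, b) \<in> E \<and> a \<in> V - S \<and> b \<in> S} + ascents E (V - S) \<kappa>'"
proof -
  let ?X = "{(a, b). (a, b) \<in> E \<and> a \<in> V - S \<and> b \<in> S}"
  let ?Y = "{(a, b). (a, b) \<in> E \<and> a \<in> V - S \<and> b \<in> V - S \<and> \<kappa>' a < \<kappa>' b}"
  have "{(a, b). (a, b) \<in> E \<and> a \<in> V \<and> b \<in> V \<and> \<kappa> a < \<kappa> b} = ?X \<union> ?Y"
  proof (intro equalityI subsetI)
    fix p assume "p \<in> {(a, b). (a, b) \<in> E \<and> a \<in> V \<and> b \<in> V \<and> \<kappa> a < \<kappa> b}"
    then obtain a b where h: "p = (a, b)" "(a, b) \<in> E" "a \<in> V" "b \<in> V" "\<kappa> a < \<kappa> b" by blast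
    have "\<kappa> b \<le> c" using assms(4)[of b] assms(5)[of b] h(4) by (cases "b \<in> S") auto
    then have "a \<notin> S" using assms(4)[of a] h(5) by auto
    then show "p \<in> ?X \<union> ?Y"
      using h assms(6)[of a] assms(6)[of b] by (cases "b \<in> S") auto
  next
    fix p assume "p \<in> ?X \<union> ?Y"
    then show "p \<in> {(a, b). (a, b) \<in> E \<and> a \<in> V \<and> b \<in> V \<and> \<kappa> a < \<kappa> b}"
    proof
      assume "p \<in> ?X"
      then obtain a b where "p = (a, b)" "(a, b) \<in> E" "a \<in> V - S" "b \<in> S" by blast
      then show ?thesis using assms(2,4,5) by auto
    next
      assume "p \<in> ?Y"
      then obtain a b where "p = (a, b)" "(a, b) \<in> E" "a \<in> V - S" "b \<in> V - S" "\<kappa>' a < \<kappa>' b"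
        by blast
      then show ?thesis using assms(6)[of a] assms(6)[of b] by auto
    qed
  qed
  moreover have "card (?X \<union> ?Y) = card ?X + card ?Y"
  proof (rule card_Un_disjoint)
    show "finite ?X" by (rule finite_subset[of _ "V \<times> V"]) (use assms(1,2) in auto)
    show "finite ?Y" by (rule finite_subset[of _ "V \<times> V"]) (use assms(1,2) in auto)
  qed auto
  ultimately show ?thesis by (simp add: ascents_def)
qed

text \<open>Every edge from outside into the class \<open>S\<close> of the largest colour is an ascent, an edge leaving
  \<open>S\<close> is not, and there are no edges within \<open>S\<close>.\<close>

lemma color_sum_remove_max:
  assumes "finite V" "\<And>x. x \<in># \<alpha> \<Longrightarrow> x \<le> c"
  shows "color_sum E V \<alpha> = (\<Sum>S\<in>{S. S \<subseteq> V \<and> card S = count \<alpha> c \<and> indep E S}.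
     q ^ card {(a, b). (a, b) \<in> E \<and> a \<in> V - S \<and> b \<in> S}
       * color_sum E (V - S) (filter_mset (\<lambda>x. x \<noteq> c) \<alpha>))"
proof -
  let ?\<alpha> = "filter_mset (\<lambda>x. x \<noteq> c) \<alpha>"
  let ?I = "{S. S \<subseteq> V \<and> card S = count \<alpha> c \<and> indep E S}"
  let ?w = "\<lambda>S. q ^ card {(a, b). (a, b) \<in> E \<and> a \<in> V - S \<and> b \<in> S}"
  have finI: "finite ?I" by (rule finite_subset[of _ "Pow V"]) (use assms(1) in auto)
  have "color_sum E V \<alpha> = (\<Sum>(S, \<kappa>)\<in>(SIGMA S:?I. colorings E (V - S) ?\<alpha>). ?w S * q ^ ascents E (V - S) \<kappa>)"
    unfolding color_sum_def
  proof (rule sum.reindex_bij_witness[of _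
      "\<lambda>(S, \<kappa>) v. if v \<in> S then c else \<kappa> v"
      "\<lambda>\<kappa>. ({v \<in> V. \<kappa> v = c}, restrict \<kappa> {v \<in> V. \<kappa> v \<noteq> c})"])
    fix \<kappa> assume \<kappa>: "\<kappa> \<in> colorings E V \<alpha>"
    define S where "S = {v \<in> V. \<kappa> v = c}"
    have VS: "{v \<in> V. \<kappa> v \<noteq> c} = V - S" by (auto simp: S_def)
    have ext: "\<kappa> \<in> extensional V" and proper: "\<forall>a\<in>V. \<forall>b\<in>V. (a, b) \<in> E \<longrightarrow> \<kappa> a \<noteq> \<kappa> b"
      and mon: "image_mset \<kappa> (mset_set V) = \<alpha>"
      using \<kappa> by (auto simp: colorings_def PiE_iff)
    have S: "S \<subseteq> V" "\<And>v. v \<in> S \<Longrightarrow> \<kappa> v = c" "\<And>v. v \<in> V - S \<Longrightarrow> \<kappa> v \<noteq> c"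
      by (auto simp: S_def)
    note cls = image_mset_color_class[where \<kappa> = \<kappa> and c = c, OF assms(1) S, unfolded mon]
    have less: "\<kappa> v < c" if "v \<in> V - S" for v
    proof -
      have "\<kappa> v \<in># \<alpha>" using mon that assms(1) by (auto simp flip: mon)
      then show ?thesis using assms(2)[of "\<kappa> v"] S(3)[OF that] by simp
    qed
    have ind: "indep E S" using proper S(1,2) unfolding indep_def by (metis subsetD)
    show "(case ({v \<in> V. \<kappa> v = c}, restrict \<kappa> {v \<in> V. \<kappa> v \<noteq> c}) of
        (S, \<kappa>) \<Rightarrow> \<lambda>v. if v \<in> S then c else \<kappa> v) = \<kappa>"
      using ext by (auto simp: extensional_def)
    have "restrict \<kappa> (V - S) \<in> colorings E (V - S) ?\<alpha>"
    proof -
      have "image_mset (restrict \<kappa> (V - S)) (mset_set (V - S)) = image_mset \<kappa> (mset_set (V - S))"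
        using assms(1) by (intro image_mset_cong) simp
      then show ?thesis using proper cls(2) by (simp add: colorings_def)
    qed
    then show "({v \<in> V. \<kappa> v = c}, restrict \<kappa> {v \<in> V. \<kappa> v \<noteq> c}) \<in> (SIGMA S:?I. colorings E (V - S) ?\<alpha>)"
      unfolding VS S_def[symmetric] using ind cls(1) S(1) by simp
    have "ascents E V \<kappa> = card {(a, b). (a, b) \<in> E \<and> a \<in> V - S \<and> b \<in> S}
        + ascents E (V - S) (restrict \<kappa> (V - S))"
      using S(2) less by (intro ascents_remove_max_class[OF assms(1) S(1) ind, of _ c]) auto
    then show "(case ({v \<in> V. \<kappa> v = c}, restrict \<kappa> {v \<in> V. \<kappa> v \<noteq> c}) of
        (S, \<kappa>) \<Rightarrow> ?w S * q ^ ascents E (V - S) \<kappa>) = q ^ ascents E V \<kappa>"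
      unfolding VS S_def[symmetric] by (simp add: power_add)
  next
    fix p assume p: "p \<in> (SIGMA S:?I. colorings E (V - S) ?\<alpha>)"
    obtain S \<kappa> where pS: "p = (S, \<kappa>)" by (cases p)
    define \<kappa>' where "\<kappa>' = (\<lambda>v. if v \<in> S then c else \<kappa> v)"
    have S: "S \<subseteq> V" "card S = count \<alpha> c" "indep E S" and \<kappa>: "\<kappa> \<in> colorings E (V - S) ?\<alpha>"
      using p pS by auto
    have ext: "\<kappa> \<in> extensional (V - S)"
      and proper: "\<forall>a\<in>V - S. \<forall>b\<in>V - S. (a, b) \<in> E \<longrightarrow> \<kappa> a \<noteq> \<kappa> b"
      and mon: "image_mset \<kappa> (mset_set (V - S)) = ?\<alpha>"
      using \<kappa> by (auto simp: colorings_def PiE_iff)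
    have notc: "\<kappa> v \<noteq> c" if "v \<in> V - S" for v
    proof -
      have "\<kappa> v \<in># ?\<alpha>" unfolding mon[symmetric] using that assms(1) by auto
      then show ?thesis by simp
    qed
    have c': "\<kappa>' v = c" if "v \<in> S" for v using that by (simp add: \<kappa>'_def)
    have nc': "\<kappa>' v \<noteq> c" if "v \<in> V - S" for v using that notc by (simp add: \<kappa>'_def)
    have cls: "{v \<in> V. \<kappa>' v = c} = S" "{v \<in> V. \<kappa>' v \<noteq> c} = V - S" using c' nc' S(1) by auto
    have "restrict \<kappa>' (V - S) = \<kappa>"
      using ext by (auto simp: \<kappa>'_def extensional_def restrict_def)
    then show "({v \<in> V. (case p of (S, \<kappa>) \<Rightarrow> \<lambda>v. if v \<in> S then c else \<kappa> v) v = c},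
        restrict (case p of (S, \<kappa>) \<Rightarrow> \<lambda>v. if v \<in> S then c else \<kappa> v)
         {v \<in> V. (case p of (S, \<kappa>) \<Rightarrow> \<lambda>v. if v \<in> S then c else \<kappa> v) v \<noteq> c}) = p"
      unfolding pS prod.case \<kappa>'_def[symmetric] cls by simp
    have "image_mset \<kappa>' (mset_set (V - S)) = ?\<alpha>"
      unfolding mon[symmetric] using assms(1) by (intro image_mset_cong) (simp add: \<kappa>'_def)
    then have "image_mset \<kappa>' (mset_set V) = replicate_mset (count \<alpha> c) c + ?\<alpha>"
      using image_mset_color_class(3)[OF assms(1) S(1) c' nc'] S(2) by simp
    also have "\<dots> = \<alpha>" by (rule multiset_eqI) simp
    finally have "image_mset \<kappa>' (mset_set V) = \<alpha>" .
    moreover have "\<kappa>' a \<noteq> \<kappa>' b" if "a \<in> V" "b \<in> V" "(a, b) \<in> E" for a b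
    proof (cases "a \<in> S \<or> b \<in> S")
      case True
      have "\<not> (a \<in> S \<and> b \<in> S)" using S(3) that(3) by (auto simp: indep_def)
      then show ?thesis using True c' nc' that by (metis Diff_iff)
    next
      case False
      then show ?thesis using proper that by (simp add: \<kappa>'_def)
    qed
    moreover have "\<kappa>' \<in> extensional V"
      using ext S(1) by (auto simp: \<kappa>'_def extensional_def)
    ultimately show "(case p of (S, \<kappa>) \<Rightarrow> \<lambda>v. if v \<in> S then c else \<kappa> v) \<in> colorings E V \<alpha>"
      unfolding pS prod.case \<kappa>'_def[symmetric] by (simp add: colorings_def PiE_def)
  qed
  also have "\<dots> = (\<Sum>S\<in>?I. \<Sum>\<kappa>\<in>colorings E (V - S) ?\<alpha>. ?w S * q ^ ascents E (V - S) \<kappa>)"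
    using finI assms(1) by (subst sum.Sigma) (auto intro: finite_colorings)
  finally show ?thesis by (simp add: color_sum_def sum_distrib_left)
qed

section \<open>Colourings of the graph of a sub-board\<close>

text \<open>The vertex of \<open>G(\<lambda>)\<close> representing row \<open>i\<close>; rows are numbered downwards, so the order is reversed.\<close>

definition row_vertex :: "nat \<Rightarrow> nat \<Rightarrow> nat \<Rightarrow> nat" where
  "row_vertex n m i = m + n + 1 - i"

text \<open>The vertices of \<open>G(\<lambda>)\<close> representing the columns \<open>A\<close> and the rows \<open>B\<close>.\<close>

definition board_vertices :: "nat \<Rightarrow> nat \<Rightarrow> nat set \<Rightarrow> nat set \<Rightarrow> nat set" where
  "board_vertices n m A B = A \<union> row_vertex n m ` B"

lemma row_vertex_bounds: "i \<in> {1..n} \<Longrightarrow> m < row_vertex n m i \<and> row_vertex n m i \<le> m + n"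
  by (auto simp: row_vertex_def)

lemma row_vertex_inverse: "i \<in> {1..n} \<Longrightarrow> m + n + 1 - row_vertex n m i = i"
  by (auto simp: row_vertex_def)

lemma row_vertex_less_iff:
  "i \<in> {1..n} \<Longrightarrow> j \<in> {1..n} \<Longrightarrow> row_vertex n m i < row_vertex n m j \<longleftrightarrow> j < i"
  by (auto simp: row_vertex_def)

lemma inj_on_row_vertex: "B \<subseteq> {1..n} \<Longrightarrow> inj_on (row_vertex n m) B"
  by (rule inj_on_inverseI[where g = "\<lambda>v. m + n + 1 - v"]) (blast intro: row_vertex_inverse)

context
  fixes n m :: nat and lam :: "nat \<Rightarrow> nat" and A B :: "nat set"
  assumes A: "A \<subseteq> {1..m}" and B: "B \<subseteq> {1..n}"
begin

private abbreviation "rv \<equiv> row_vertex n m"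
private abbreviation "E \<equiv> graph_edges n m lam"
private abbreviation "V \<equiv> board_vertices n m A B"

private lemma finA: "finite A" and finB: "finite B"
  using A B finite_subset by blast+

lemma finite_board_vertices: "finite V"
  using finA finB by (simp add: board_vertices_def)

private lemma row_gt: "i \<in> B \<Longrightarrow> m < rv i"
  using B row_vertex_bounds[of i n m] by blast

private lemma column_le: "a \<in> A \<Longrightarrow> a \<le> m" "a \<in> A \<Longrightarrow> 1 \<le> a"
  using A by auto

private lemma disjoint_vertices: "A \<inter> rv ` B = {}"
  using row_gt column_le(1) by (auto simp: not_le[symmetric])

lemma card_board_vertices: "card V = card A + card B"
  using finA finB disjoint_vertices card_image[OF inj_on_row_vertex[OF B]]
  by (simp add: board_vertices_def card_Un_disjoint)

lemma nonedge_cell: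
  assumes "x \<in> V" "y \<in> V" "x < y" "(x, y) \<notin> E"
  shows "x \<in> A \<and> (\<exists>i\<in>B. y = rv i \<and> x \<le> lam i)"
proof -
  have bounds: "1 \<le> v \<and> v \<le> m + n" if "v \<in> V" for v
    using that unfolding board_vertices_def
  proof
    assume "v \<in> A"
    then show ?thesis using A by auto
  next
    assume "v \<in> rv ` B"
    then obtain i where "i \<in> {1..n}" "v = rv i" using B by blast
    then show ?thesis using row_vertex_bounds[of i n m] by auto
  qed
  have ne: "x \<le> m" "m < y" "x \<le> lam (m + n + 1 - y)"
    using assms(3,4) bounds[OF assms(1)] bounds[OF assms(2)] by (auto simp: graph_edges_def)
  have "x \<notin> rv ` B" using ne(1) row_gt leD by blast
  then have "x \<in> A" using assms(1) by (simp add: board_vertices_def)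
  moreover have "y \<notin> A" using ne(2) column_le(1) leD by blast
  then obtain i where "i \<in> B" "y = rv i"
    using assms(2) by (auto simp: board_vertices_def)
  moreover from this have "m + n + 1 - y = i" using row_vertex_inverse B by blast
  ultimately show ?thesis using ne(3) by auto
qed

lemma indep_card_le_2:
  assumes "S \<subseteq> V" "indep E S"
  shows "card S \<le> 2"
proof -
  have fin: "finite S" using assms(1) finite_board_vertices finite_subset by blast
  have no_edge: "x \<le> m \<and> m < y" if "x \<in> S" "y \<in> S" "x < y" for x y
  proof -
    have "(x, y) \<notin> E" using assms(2) that by (simp add: indep_def)
    then have "x \<in> A \<and> (\<exists>i\<in>B. y = rv i \<and> x \<le> lam i)"
      using nonedge_cell[of x y] assms(1) that by blast
    then show ?thesis using row_gt column_le(1) by blast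
  qed
  have "x = y" if "x \<in> S" "y \<in> S" "x \<le> m \<longleftrightarrow> y \<le> m" for x y
    using no_edge[of x y] no_edge[of y x] that by (cases x y rule: linorder_cases) auto
  then have "card {x \<in> S. x \<le> m} \<le> 1" "card {x \<in> S. \<not> x \<le> m} \<le> 1"
    using fin by (auto simp: card_le_Suc0_iff_eq)
  moreover have "card S \<le> card {x \<in> S. x \<le> m} + card {x \<in> S. \<not> x \<le> m}"
    by (rule order_trans[OF _ card_Un_le], rule card_mono) (use fin in auto)
  ultimately show ?thesis by linarith
qed

lemma indep_card_1: "{S. S \<subseteq> V \<and> card S = 1 \<and> indep E S} = (\<lambda>v. {v}) ` V"
proof -
  have "(v, v) \<notin> E" for v by (simp add: graph_edges_def)
  then show ?thesis by (auto simp: card_1_singleton_iff indep_def)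
qed

lemma indep_card_2:
  "{S. S \<subseteq> V \<and> card S = 2 \<and> indep E S} = (\<lambda>(i, a). {a, rv i}) ` subcells lam A B"
proof (intro equalityI subsetI)
  fix S assume "S \<in> {S. S \<subseteq> V \<and> card S = 2 \<and> indep E S}"
  then have S: "S \<subseteq> V" "card S = 2" "indep E S" by auto
  then obtain x y where xy: "S = {x, y}" "x < y"
    by (metis card_2_iff insert_commute linorder_neqE_nat)
  then have "(x, y) \<notin> E" using S(3) by (simp add: indep_def)
  then have "x \<in> A \<and> (\<exists>i\<in>B. y = rv i \<and> x \<le> lam i)"
    using nonedge_cell[of x y] S(1) xy by simp
  then show "S \<in> (\<lambda>(i, a). {a, rv i}) ` subcells lam A B"
    using xy(1) by (auto simp: subcells_def image_iff)
next
  fix S assume "S \<in> (\<lambda>(i, a). {a, rv i}) ` subcells lam A B"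
  then obtain i a where S: "S = {a, rv i}" "i \<in> B" "a \<in> A" "a \<le> lam i"
    by (auto simp: subcells_def)
  have "a < rv i" "a \<le> m" using row_gt[OF S(2)] column_le[OF S(3)] by auto
  moreover have "m + n + 1 - rv i = i" using row_vertex_inverse S(2) B by blast
  ultimately show "S \<in> {S. S \<subseteq> V \<and> card S = 2 \<and> indep E S}"
    using S row_gt[OF S(2)] by (auto simp: board_vertices_def indep_def graph_edges_def)
qed

lemma card_edges_into_indep:
  assumes "S \<subseteq> V" "indep E S"
  shows "card {(a, b). (a, b) \<in> E \<and> a \<in> V - S \<and> b \<in> S} = (\<Sum>v\<in>S. card {x \<in> V. (x, v) \<in> E})"
proof -
  have "{(a, b). (a, b) \<in> E \<and> a \<in> V - S \<and> b \<in> S} = prod.swap ` (SIGMA v:S. {x \<in> V. (x, v) \<in> E})"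
    using assms by (auto simp: indep_def image_iff)
  moreover have "card (prod.swap ` (SIGMA v:S. {x \<in> V. (x, v) \<in> E})) = card (SIGMA v:S. {x \<in> V. (x, v) \<in> E})"
    by (rule card_image) simp
  moreover have "finite S" using assms(1) finite_board_vertices finite_subset by blast
  ultimately show ?thesis using finite_board_vertices by (simp add: card_SigmaI)
qed

lemma card_edges_into_column:
  assumes "a \<in> A"
  shows "card {x \<in> V. (x, a) \<in> E} = card {x \<in> A. x < a}"
proof -
  have "(x, a) \<in> E \<longleftrightarrow> x < a" if "x \<in> A" for x
    using column_le[OF assms] column_le[OF that] by (auto simp: graph_edges_def)
  moreover have "(rv i, a) \<notin> E" if "i \<in> B" for i
    using column_le[OF assms] row_gt[OF that] by (auto simp: graph_edges_def)
  ultimately have "{x \<in> V. (x, a) \<in> E} = {x \<in> A. x < a}"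
    by (auto simp: board_vertices_def)
  then show ?thesis by simp
qed

lemma card_edges_into_row:
  assumes "i \<in> B"
  shows "card {x \<in> V. (x, rv i) \<in> E} = card {x \<in> A. lam i < x} + card {j \<in> B. i < j}"
proof -
  have i: "m + n + 1 - rv i = i" "m < rv i" "rv i \<le> m + n"
    using assms B row_vertex_inverse row_vertex_bounds by blast+
  have less: "rv j < rv i \<longleftrightarrow> i < j" if "j \<in> B" for j
    using that assms B row_vertex_less_iff by blast
  have "{x \<in> V. (x, rv i) \<in> E} = {x \<in> A. lam i < x} \<union> rv ` {j \<in> B. i < j}"
  proof -
    have "(x, rv i) \<in> E \<longleftrightarrow> lam i < x" if "x \<in> A" for x
      using column_le[OF that] i by (auto simp: graph_edges_def)
    moreover have "(rv j, rv i) \<in> E \<longleftrightarrow> i < j" if "j \<in> B" for j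
      using row_gt[OF that] i less[OF that] by (auto simp: graph_edges_def)
    ultimately show ?thesis by (auto simp: board_vertices_def)
  qed
  moreover have "card ({x \<in> A. lam i < x} \<union> rv ` {j \<in> B. i < j})
      = card {x \<in> A. lam i < x} + card (rv ` {j \<in> B. i < j})"
    using finA finB disjoint_vertices by (intro card_Un_disjoint) auto
  moreover have "card (rv ` {j \<in> B. i < j}) = card {j \<in> B. i < j}"
    by (intro card_image inj_on_subset[OF inj_on_row_vertex[OF B]]) auto
  ultimately show ?thesis by simp
qed

lemma board_vertices_delete_column: "a \<in> A \<Longrightarrow> V - {a} = board_vertices n m (A - {a}) B"
  using disjoint_vertices by (auto simp: board_vertices_def)

lemma board_vertices_delete_row: "i \<in> B \<Longrightarrow> V - {rv i} = board_vertices n m A (B - {i})"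
  using disjoint_vertices inj_on_row_vertex[OF B, of m] by (auto simp: board_vertices_def inj_on_def)

text \<open>The case of a largest colour used once: the class is a column or a row.\<close>

lemma color_sum_remove_single_max:
  assumes "\<And>x. x \<in># \<alpha> \<Longrightarrow> x \<le> c" "count \<alpha> c = 1"
  shows "color_sum E V \<alpha> =
     (\<Sum>a\<in>A. q ^ card {x \<in> A. x < a}
        * color_sum E (board_vertices n m (A - {a}) B) (filter_mset (\<lambda>x. x \<noteq> c) \<alpha>))
   + (\<Sum>b\<in>B. q ^ (card {x \<in> A. lam b < x} + card {i \<in> B. b < i})
        * color_sum E (board_vertices n m A (B - {b})) (filter_mset (\<lambda>x. x \<noteq> c) \<alpha>))"
proof -
  let ?\<alpha> = "filter_mset (\<lambda>x. x \<noteq> c) \<alpha>"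
  have ind: "indep E {v}" for v by (simp add: indep_def graph_edges_def)
  have "color_sum E V \<alpha> = (\<Sum>S\<in>(\<lambda>v. {v}) ` V. q ^ card {(a, b). (a, b) \<in> E \<and> a \<in> V - S \<and> b \<in> S}
       * color_sum E (V - S) ?\<alpha>)"
    using color_sum_remove_max[where E = E and \<alpha> = \<alpha> and c = c, OF finite_board_vertices assms(1)] unfolding assms(2) indep_card_1 .
  also have "\<dots> = (\<Sum>v\<in>V. q ^ card {(a, b). (a, b) \<in> E \<and> a \<in> V - {v} \<and> b \<in> {v}} * color_sum E (V - {v}) ?\<alpha>)"
    by (subst sum.reindex) (simp_all add: inj_on_def)
  also have "\<dots> = (\<Sum>v\<in>V. q ^ card {x \<in> V. (x, v) \<in> E} * color_sum E (V - {v}) ?\<alpha>)"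
  proof (rule sum.cong[OF refl])
    fix v assume "v \<in> V"
    then have "card {(a, b). (a, b) \<in> E \<and> a \<in> V - {v} \<and> b \<in> {v}} = card {x \<in> V. (x, v) \<in> E}"
      using card_edges_into_indep[OF _ ind, of v] by simp
    then show "q ^ card {(a, b). (a, b) \<in> E \<and> a \<in> V - {v} \<and> b \<in> {v}} * color_sum E (V - {v}) ?\<alpha>
       = q ^ card {x \<in> V. (x, v) \<in> E} * color_sum E (V - {v}) ?\<alpha>" by (simp only:)
  qed
  also have "\<dots> = (\<Sum>v\<in>A. q ^ card {x \<in> V. (x, v) \<in> E} * color_sum E (V - {v}) ?\<alpha>)
      + (\<Sum>v\<in>rv ` B. q ^ card {x \<in> V. (x, v) \<in> E} * color_sum E (V - {v}) ?\<alpha>)"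
    using sum.union_disjoint[OF finA finite_imageI[OF finB] disjoint_vertices]
    by (simp only: board_vertices_def)
  also have "(\<Sum>v\<in>rv ` B. q ^ card {x \<in> V. (x, v) \<in> E} * color_sum E (V - {v}) ?\<alpha>)
      = (\<Sum>b\<in>B. q ^ card {x \<in> V. (x, rv b) \<in> E} * color_sum E (V - {rv b}) ?\<alpha>)"
    by (subst sum.reindex[OF inj_on_row_vertex[OF B]]) simp
  finally show ?thesis
    by (simp only: card_edges_into_column card_edges_into_row board_vertices_delete_column
        board_vertices_delete_row cong: sum.cong)
qed

text \<open>The case of a largest colour used twice: the class is the column and the row of a cell.\<close>

lemma color_sum_remove_double_max:
  assumes "\<And>x. x \<in># \<alpha> \<Longrightarrow> x \<le> c" "count \<alpha> c = 2"
  shows "color_sum E V \<alpha> = (\<Sum>i\<in>B. \<Sum>a\<in>row_set lam A i.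
       q ^ (card {x \<in> A. x < a} + (card {x \<in> A. lam i < x} + card {j \<in> B. i < j}))
         * color_sum E (board_vertices n m (A - {a}) (B - {i})) (filter_mset (\<lambda>x. x \<noteq> c) \<alpha>))"
proof -
  let ?\<alpha> = "filter_mset (\<lambda>x. x \<noteq> c) \<alpha>"
  have inj: "inj_on (\<lambda>(i, a). {a, rv i}) (subcells lam A B)"
  proof (rule inj_onI, clarify)
    fix i a j b assume h: "(i, a) \<in> subcells lam A B" "(j, b) \<in> subcells lam A B" "{a, rv i} = {b, rv j}"
    then have "a = b \<and> rv i = rv j"
      using disjoint_vertices by (auto simp: subcells_def doubleton_eq_iff)
    then show "i = j \<and> a = b"
      using h inj_on_row_vertex[OF B, of m] by (auto simp: subcells_def inj_on_def)
  qed
  define f where "f S = q ^ card {(a, b). (a, b) \<in> E \<and> a \<in> V - S \<and> b \<in> S} * color_sum E (V - S) ?\<alpha>" for S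
  have "color_sum E V \<alpha> = (\<Sum>S\<in>(\<lambda>(i, a). {a, rv i}) ` subcells lam A B. f S)"
    using color_sum_remove_max[where E = E and \<alpha> = \<alpha> and c = c, OF finite_board_vertices assms(1)]
    unfolding assms(2) indep_card_2 f_def .
  also have "\<dots> = (\<Sum>(i, a)\<in>subcells lam A B. f {a, rv i})"
    unfolding sum.reindex[OF inj] by (simp add: case_prod_unfold)
  also have "\<dots> = (\<Sum>(i, a)\<in>subcells lam A B. q ^ (card {x \<in> A. x < a} + (card {x \<in> A. lam i < x} + card {j \<in> B. i < j}))
         * color_sum E (board_vertices n m (A - {a}) (B - {i})) ?\<alpha>)"
  proof (rule sum.cong[OF refl], clarify)
    fix i a assume ia: "(i, a) \<in> subcells lam A B"
    then have i: "i \<in> B" and a: "a \<in> A" by (auto simp: subcells_def)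
    have "{a, rv i} \<in> {S. S \<subseteq> V \<and> card S = 2 \<and> indep E S}"
      unfolding indep_card_2 using ia by force
    then have S: "{a, rv i} \<subseteq> V" "indep E {a, rv i}" by auto
    have ne: "a \<noteq> rv i" using a i disjoint_vertices by auto
    have "V - {a, rv i} = board_vertices n m (A - {a}) (B - {i})"
      using a i disjoint_vertices inj_on_row_vertex[OF B, of m]
      by (auto simp: board_vertices_def inj_on_def)
    moreover have "card {(x, y). (x, y) \<in> E \<and> x \<in> V - {a, rv i} \<and> y \<in> {a, rv i}}
        = card {x \<in> A. x < a} + (card {x \<in> A. lam i < x} + card {j \<in> B. i < j})"
      using card_edges_into_indep[OF S] ne card_edges_into_column[OF a] card_edges_into_row[OF i]
      by simp
    ultimately show "f {a, rv i} =
        q ^ (card {x \<in> A. x < a} + (card {x \<in> A. lam i < x} + card {j \<in> B. i < j}))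
         * color_sum E (board_vertices n m (A - {a}) (B - {i})) ?\<alpha>"
      by (simp only: f_def)
  qed
  also have "subcells lam A B = (SIGMA i:B. row_set lam A i)"
    by (auto simp: subcells_def row_set_def)
  finally show ?thesis using finA finB by (simp add: sum.Sigma)
qed

end

lemma doubled_subset: "{c. count \<alpha> c = 2} \<subseteq> set_mset \<alpha>"
proof
  fix c assume "c \<in> {c. count \<alpha> c = 2}"
  then have "count \<alpha> c > 0" by simp
  then show "c \<in># \<alpha>" by (rule count_greater_zero_iff[THEN iffD1])
qed

lemma twice_card_doubled_le_size:
  "2 * card {c. count \<alpha> c = 2} \<le> size \<alpha>"
proof -
  have "(\<Sum>c\<in>{c. count \<alpha> c = 2}. count \<alpha> c) \<le> (\<Sum>c\<in>set_mset \<alpha>. count \<alpha> c)"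
    by (intro sum_mono2 doubled_subset) simp_all
  then show ?thesis by (simp add: size_multiset_overloaded_eq)
qed

lemma size_filter_neq: "size \<alpha> = size (filter_mset (\<lambda>x. x \<noteq> c) \<alpha>) + count \<alpha> c"
  using arg_cong[OF multiset_partition[of \<alpha> "\<lambda>x. x = c"], of size]
  by (simp add: filter_eq_replicate_mset)

theorem color_sum_eq_monomial_coeff:
  assumes lam: "partition_in_board n m lam"
    and "A \<subseteq> {1..m}" "B \<subseteq> {1..n}" "size \<alpha> = card A + card B" "\<And>c. count \<alpha> c \<le> 2"
  shows "color_sum (graph_edges n m lam) (board_vertices n m A B) \<alpha>
     = monomial_coeff lam A B (card {c. count \<alpha> c = 2})"
  using assms(2-)
proof (induction "size \<alpha>" arbitrary: A B \<alpha> rule: less_induct)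
  case less
  note A = less.prems(1) and B = less.prems(2) and size = less.prems(3) and le2 = less.prems(4)
  let ?E = "graph_edges n m lam" and ?V = "board_vertices n m"
  have fin: "finite A" "finite B" using A B finite_subset by blast+
  have anti: "\<forall>i\<in>B. \<forall>j\<in>B. i \<le> j \<longrightarrow> lam j \<le> lam i"
    using lam B by (auto simp: partition_in_board_def subset_iff)
  show ?case
  proof (cases "\<alpha> = {#}")
    case True
    then have AB: "A = {}" "B = {}" using size fin by auto
    \<comment> \<open>The empty graph has one colouring, and \<open>c\<^sub>0 = 1\<close> for \<open>N = 0\<close>.\<close>
    have "colorings ?E {} {#} = {\<lambda>_. undefined}" by (auto simp: colorings_def)
    then show ?thesis
      by (simp add: AB True board_vertices_def color_sum_def ascents_def monomial_coeff_empty)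
  next
    case False
    define c where "c = Max (set_mset \<alpha>)"
    have c: "c \<in># \<alpha>" "\<And>x. x \<in># \<alpha> \<Longrightarrow> x \<le> c" using False by (simp_all add: c_def)
    define \<alpha>' where "\<alpha>' = filter_mset (\<lambda>x. x \<noteq> c) \<alpha>"
    have size': "size \<alpha> = size \<alpha>' + count \<alpha> c" unfolding \<alpha>'_def by (rule size_filter_neq)
    have smaller: "size \<alpha>' < size \<alpha>" using size' c(1) by simp
    have le2': "count \<alpha>' x \<le> 2" for x using le2[of x] by (simp add: \<alpha>'_def)
    have "count \<alpha> c \<noteq> 0" using c(1) by simp
    then consider "count \<alpha> c = 1" | "count \<alpha> c = 2" using le2[of c] by linarith
    then show ?thesis
    proof cases
      case 1
      define r where "r = card {x. count \<alpha>' x = 2}"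
      have r: "card {x. count \<alpha> x = 2} = r"
      proof -
        have "{x. count \<alpha> x = 2} = {x. count \<alpha>' x = 2}" using 1 by (auto simp: \<alpha>'_def)
        then show ?thesis by (simp add: r_def)
      qed
      define N where "N = size \<alpha>'"
      have N: "card A + card B = Suc N" using size size' 1 by (simp add: N_def)
      have "2 * r < Suc N" using twice_card_doubled_le_size[of \<alpha>'] by (simp add: r_def N_def)
      note del = monomial_coeff_delete_vertex[OF fin anti N this]
      have colA: "color_sum ?E (?V (A - {a}) B) \<alpha>' = monomial_coeff lam (A - {a}) B r" if "a \<in> A" for a
        unfolding r_def
        by (rule less.hyps[OF smaller _ B _ le2'])
          (use A N card_Suc_Diff1[OF fin(1) that] in \<open>auto simp: N_def\<close>)
      have colB: "color_sum ?E (?V A (B - {b})) \<alpha>' = monomial_coeff lam A (B - {b}) r" if "b \<in> B" for b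
        unfolding r_def
        by (rule less.hyps[OF smaller A _ _ le2'])
          (use B N card_Suc_Diff1[OF fin(2) that] in \<open>auto simp: N_def\<close>)
      show ?thesis
        unfolding r del[symmetric]
        by (subst color_sum_remove_single_max[OF A B c(2) 1])
          (simp_all only: colA colB \<alpha>'_def[symmetric] cong: sum.cong)
    next
      case 2
      define r where "r = card {x. count \<alpha>' x = 2}"
      have r: "card {x. count \<alpha> x = 2} = Suc r"
      proof -
        have "{x. count \<alpha> x = 2} = insert c {x. count \<alpha>' x = 2}" using 2 by (auto simp: \<alpha>'_def)
        moreover have "finite {x. count \<alpha>' x = 2}"
          by (rule finite_subset[OF doubled_subset]) simp
        moreover have "c \<notin> {x. count \<alpha>' x = 2}" by (simp add: \<alpha>'_def)
        ultimately show ?thesis by (simp add: r_def)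
      qed
      define N where "N = size \<alpha>'"
      have N: "card A + card B = N + 2" using size size' 2 by (simp add: N_def)
      have col: "color_sum ?E (?V (A - {a}) (B - {i})) \<alpha>' = monomial_coeff lam (A - {a}) (B - {i}) r"
        if i: "i \<in> B" and "a \<in> row_set lam A i" for i a
      proof -
        have a: "a \<in> A" using that by (simp add: row_set_def)
        have "size \<alpha>' = card (A - {a}) + card (B - {i})"
          using N card_Suc_Diff1[OF fin(1) a] card_Suc_Diff1[OF fin(2) i] unfolding N_def by linarith
        then show ?thesis
          unfolding r_def using A B by (intro less.hyps[OF smaller _ _ _ le2']) auto
      qed
      show ?thesis
        unfolding r monomial_coeff_delete_pair[OF fin anti N, symmetric]
        by (subst color_sum_remove_double_max[OF A B c(2) 2])
          (simp_all only: col \<alpha>'_def[symmetric] cong: sum.cong)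
    qed
  qed
qed

section \<open>Hit numbers\<close>

lemma nonzero_row_le:
  assumes "partition_in_board n m lam" "lam i \<noteq> 0"
  shows "i \<le> n"
proof (rule ccontr)
  assume "\<not> i \<le> n"
  then show False using assms by (simp add: partition_in_board_def)
qed

lemma cells_eq_subcells:
  assumes "partition_in_board n m lam"
  shows "cells lam = subcells lam {1..m} {1..n}"
proof -
  have "i \<le> n \<and> j \<le> m" if "1 \<le> i" "1 \<le> j" "j \<le> lam i" for i j
  proof
    show "i \<le> n" using that by (intro nonzero_row_le[OF assms]) simp
    have "lam i \<le> lam 1" "lam 1 \<le> m" using that(1) assms by (auto simp: partition_in_board_def)
    then show "j \<le> m" using that(3) by simp
  qed
  then show ?thesis by (auto simp: cells_def subcells_def)
qed

lemma qrook_eq_sub_rook: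
  assumes "partition_in_board n m lam"
  shows "qrook k lam = sub_rook lam {1..m} {1..n} k"
  by (simp add: qrook_def sub_rook_def rook_placements_def sub_placements_def rook_inv_def
      sub_inv_def cells_eq_subcells[OF assms])

lemma qrook_eq_0:
  assumes "partition_in_board n m lam" "num_parts lam < i"
  shows "qrook i lam = 0"
proof -
  let ?P = "{i \<in> {1..n}. lam i \<noteq> 0}"
  have "{i. 1 \<le> i \<and> lam i \<noteq> 0} = ?P"
    using nonzero_row_le[OF assms(1)] by auto
  then have "card ?P < i" using assms(2) by (simp add: num_parts_def)
  moreover have "subcells lam {1..m} {1..n} = subcells lam {1..m} ?P"
    by (auto simp: subcells_def)
  then have "sub_rook lam {1..m} {1..n} i = sub_rook lam {1..m} ?P i" by (rule sub_rook_cong)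
  ultimately show ?thesis
    using sub_rook_eq_0[of "{1..m}" ?P i lam] by (simp add: qrook_eq_sub_rook[OF assms(1)])
qed

lemma coeff_times_linear:
  fixes p :: "'a :: comm_ring_1 poly"
  shows "coeff (p * (1 - smult c [:0, 1:])) (Suc j) = coeff p (Suc j) - c * coeff p j"
    and "coeff (p * (1 - smult c [:0, 1:])) 0 = coeff p 0"
proof -
  have "p * (1 - smult c [:0, 1:]) = p - smult c (pCons 0 p)"
    by (simp add: right_diff_distrib)
  then show "coeff (p * (1 - smult c [:0, 1:])) (Suc j) = coeff p (Suc j) - c * coeff p j"
    and "coeff (p * (1 - smult c [:0, 1:])) 0 = coeff p 0"
    by (simp_all only:) simp_all
qed

text \<open>The \<open>q\<close>-binomial theorem for \<open>(x;q)\<^sub>i\<close>.\<close>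

lemma coeff_qpoch_poly:
  "coeff (qpoch_poly i) j =
     (if j \<le> i then (-1) ^ j * q ^ (j choose 2) * (qfact i / (qfact j * qfact (i - j))) else 0)"
proof (induction i arbitrary: j)
  case 0
  then show ?case by (cases j) (simp_all add: qpoch_poly_def numeral_2_eq_2)
next
  case (Suc i)
  have step: "qpoch_poly (Suc i) = qpoch_poly i * (1 - smult (q ^ i) [:0, 1:])"
    by (simp add: qpoch_poly_def)
  show ?case
  proof (cases j)
    case 0
    then show ?thesis unfolding step coeff_times_linear 0 Suc.IH by (simp add: numeral_2_eq_2 del: qfact_Suc)
  next
    case (Suc l)
    note j = Suc
    consider "i < l" | "l = i" | "l < i" by linarith
    then show ?thesis
    proof cases
      case 1
      then show ?thesis unfolding j step coeff_times_linear Suc.IH by simp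
    next
      case 2
      then show ?thesis
        unfolding j step coeff_times_linear Suc.IH by (simp add: choose_2_Suc power_add del: qfact_Suc)
    next
      case 3
      then obtain d where d: "i = l + Suc d" using less_iff_Suc_add by auto
      have split: "qint (Suc i) = qint (Suc d) + q ^ Suc d * qint (Suc l)"
        using qint_add[of "Suc d" "Suc l"] d by (simp add: add.commute)
      have "coeff (qpoch_poly (Suc i)) (Suc l)
          = (-1) ^ Suc l * q ^ (Suc l choose 2) * (qfact i / (qfact (Suc l) * qfact d))
            - q ^ i * ((-1) ^ l * q ^ (l choose 2) * (qfact i / (qfact l * qfact (Suc d))))"
        using d unfolding step coeff_times_linear Suc.IH by (simp del: qfact_Suc)
      also have "q ^ i * ((-1) ^ l * q ^ (l choose 2) * (qfact i / (qfact l * qfact (Suc d))))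
          = - ((-1) ^ Suc l * q ^ (Suc l choose 2) * (q ^ Suc d * qfact i / (qfact l * qfact (Suc d))))"
        by (simp add: d choose_2_Suc power_add mult_ac del: qfact_Suc)
      also have "(-1) ^ Suc l * q ^ (Suc l choose 2) * (qfact i / (qfact (Suc l) * qfact d))
          - - ((-1) ^ Suc l * q ^ (Suc l choose 2) * (q ^ Suc d * qfact i / (qfact l * qfact (Suc d))))
          = (-1) ^ Suc l * q ^ (Suc l choose 2) * (qfact i / (qfact (Suc l) * qfact d)
             + q ^ Suc d * qfact i / (qfact l * qfact (Suc d)))"
        by (simp only: distrib_left diff_minus_eq_add)
      also have "qfact i / (qfact (Suc l) * qfact d) + q ^ Suc d * qfact i / (qfact l * qfact (Suc d))
          = qfact (Suc i) / (qfact (Suc l) * qfact (Suc d))"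
      proof -
        have 1: "qfact i / (qfact (Suc l) * qfact d) = qint (Suc d) * qfact i / (qfact (Suc l) * qfact (Suc d))"
          by simp
        have 2: "q ^ Suc d * qfact i / (qfact l * qfact (Suc d))
            = q ^ Suc d * qint (Suc l) * qfact i / (qfact (Suc l) * qfact (Suc d))"
          by simp
        show ?thesis
          unfolding 1 2 add_divide_distrib [symmetric] distrib_right [symmetric] split [symmetric]
            qfact_Suc[of i] ..
      qed
      finally show ?thesis using d by (simp add: j del: qfact_Suc)
    qed
  qed
qed

lemma qhit_eq:
  "qhit j N lam = (\<Sum>i\<le>N. qrook i lam * (qfact (N - i) * (-1) ^ i * q ^ (N * i - (i choose 2))
       * coeff (qpoch_poly i) j)) / q ^ card (cells lam)"
  by (simp add: qhit_def qhit_poly_def coeff_sum power_int_minus divide_inverse mult_ac)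

lemma choose_2_add: "(j + x choose 2) = (j choose 2) + j * x + (x choose 2)"
  by (induction x) (simp_all add: choose_2_Suc numeral_2_eq_2[symmetric])

lemma choose_2_twice: "(x choose 2) + (Suc x choose 2) = x * x"
  by (induction x) (simp_all add: choose_2_Suc)

lemma gen_weight_eq_qhit_term:
  "gen_weight j x t = q ^ j * qfact j * qint (x + t + 1) *
     (qfact t * (-1) ^ (j + x) * q ^ ((j + x + t) * (j + x) - (j + x choose 2))
       * coeff (qpoch_poly (j + x)) j)"
proof -
  have "(j choose 2) + (j + x + t) * (j + x)
      = (j + x choose 2) + (j * j + j * x + (Suc x choose 2) + t * (j + x))"
    using choose_2_twice[of x] by (simp add: choose_2_add algebra_simps)
  then have expo: "j + j * j + j * x + (Suc x choose 2) + t * (j + x)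
      = j + ((j + x + t) * (j + x) - (j + x choose 2)) + (j choose 2)"
    using choose_2_twice[of "j + x"] by (simp add: algebra_simps)
  show ?thesis
    unfolding gen_weight_def expo
    by (simp add: coeff_qpoch_poly power_add mult_ac)
qed

text \<open>The sum defining \<open>H\<^sub>j\<^bsup>N-j-1\<^esup>\<close> stops at \<open>i = N - j - 1\<close>. As \<open>2 j < N\<close>, this bound is at least
  \<open>min m n\<close>, beyond which the rook numbers vanish.\<close>

lemma elem_coeff_eq_qhit:
  assumes "partition_in_board n m lam" "2 * j < m + n"
  shows "elem_coeff lam {1..m} {1..n} j
     = q ^ j * qfact j * qint (n + m - 2 * j) * qhit j (m + n - j - 1) lam"
proof -
  define K where "K = m + n - j - 1"
  have min: "min m n \<le> K" using assms(2) unfolding K_def by linarith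
  have "elem_weight (m + n) j i = q ^ j * qfact j * qint (n + m - 2 * j) *
     (qfact (K - i) * (-1) ^ i * q ^ (K * i - (i choose 2)) * coeff (qpoch_poly i) j)" if "i \<le> K" for i
  proof (cases "j \<le> i")
    case True
    define x t where "x = i - j" and "t = K - i"
    have i: "i = j + x" "K = j + x + t" "n + m - 2 * j = x + t + 1" "m + n - 1 - i - j = t" "i + j < m + n"
      using True that assms(2) by (auto simp: x_def t_def K_def)
    have "elem_weight (m + n) j i = gen_weight j x t"
      using True i(4,5) by (simp add: elem_weight_def x_def)
    then show ?thesis unfolding gen_weight_eq_qhit_term i(2,3) unfolding i(1) by simp
  next
    case False
    then show ?thesis by (simp add: elem_weight_eq_0 coeff_qpoch_poly)
  qed
  then have "(\<Sum>i\<le>K. sub_rook lam {1..m} {1..n} i * elem_weight (m + n) j i)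
      = q ^ j * qfact j * qint (n + m - 2 * j) * (\<Sum>i\<le>K. qrook i lam *
         (qfact (K - i) * (-1) ^ i * q ^ (K * i - (i choose 2)) * coeff (qpoch_poly i) j))"
    unfolding sum_distrib_left qrook_eq_sub_rook[OF assms(1)] by (intro sum.cong refl) simp
  moreover have "elem_coeff lam {1..m} {1..n} j =
     (\<Sum>i\<le>K. sub_rook lam {1..m} {1..n} i * elem_weight (m + n) j i) / q ^ card (cells lam)"
    using elem_coeff_bound[of "{1..m}" "{1..n}" K lam j] min by (simp add: cells_eq_subcells[OF assms(1)])
  ultimately show ?thesis unfolding qhit_eq K_def[symmetric] by simp
qed

text \<open>For \<open>k = \<ell>(\<lambda>)\<close> only \<open>R\<^sub>k\<close> contributes to \<open>c\<^sub>k\<close> and to \<open>H\<^sub>k\<^bsup>N-k\<^esup>\<close>. This formula, unlike that of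
  \<open>elem_coeff_eq_qhit\<close>, includes the case \<open>2 k = N\<close>.\<close>

lemma elem_coeff_top:
  assumes lam: "partition_in_board n m lam" and k: "num_parts lam = k" "2 * k \<le> m + n"
  shows "elem_coeff lam {1..m} {1..n} k = qfact k * qhit k (n + m - k) lam"
    and "k < j \<Longrightarrow> elem_coeff lam {1..m} {1..n} j = 0"
proof -
  let ?R = "\<lambda>i. sub_rook lam {1..m} {1..n} i"
  have R0: "?R i = 0" if "k < i" for i
    using qrook_eq_0[OF lam, of i] that k(1) by (simp add: qrook_eq_sub_rook[OF lam])
  have E: "elem_coeff lam {1..m} {1..n} j = (\<Sum>i\<le>m + n. ?R i * elem_weight (m + n) j i) / q ^ card (cells lam)" for j
    by (simp add: elem_coeff_def cells_eq_subcells[OF lam])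
  show "elem_coeff lam {1..m} {1..n} j = 0" if "k < j"
  proof -
    have "?R i * elem_weight (m + n) j i = 0" for i
      using R0[of i] elem_weight_eq_0(2)[of i j] that by (cases "k < i") auto
    then have "(\<Sum>i\<le>m + n. ?R i * elem_weight (m + n) j i) = 0" by (intro sum.neutral ballI)
    then show ?thesis unfolding E by (simp only: div_0)
  qed
  have "(\<Sum>i\<le>m + n. ?R i * elem_weight (m + n) k i) = ?R k * elem_weight (m + n) k k"
  proof -
    have "(\<Sum>i\<le>m + n. ?R i * elem_weight (m + n) k i) = (\<Sum>i\<in>{k}. ?R i * elem_weight (m + n) k i)"
    proof (rule sum.mono_neutral_right)
      show "\<forall>i\<in>{..m + n} - {k}. ?R i * elem_weight (m + n) k i = 0"
        using R0 elem_weight_eq_0(2)[of _ k] by (metis DiffD2 linorder_neqE_nat mult_eq_0_iff singletonI)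
    qed (use k(2) in auto)
    then show ?thesis by simp
  qed
  moreover have "elem_weight (m + n) k k = qfact k * (q ^ ((m + n - k) * k) * qfact (m + n - k - k))"
  proof (cases "2 * k = m + n")
    case True
    then have "m + n - k = k" by simp
    then show ?thesis using True by (simp add: elem_weight_def)
  next
    case False
    define t where "t = m + n - 1 - k - k"
    have t: "m + n - k = k + t + 1" "m + n - k - k = Suc t" "k + k < m + n" using False k(2) by (auto simp: t_def)
    then have "elem_weight (m + n) k k = gen_weight k 0 t" by (simp add: elem_weight_def t_def)
    also have "\<dots> = qfact k * q ^ (k + k * k + t * k) * qfact (Suc t)"
      by (simp add: gen_weight_def numeral_2_eq_2)
    also have "k + k * k + t * k = (m + n - k) * k" unfolding t(1) by (simp add: algebra_simps)
    finally show ?thesis unfolding t(2) by (simp only: mult.assoc)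
  qed
  moreover have "(\<Sum>i\<le>m + n - k. qrook i lam * (qfact (m + n - k - i) * (-1) ^ i
        * q ^ ((m + n - k) * i - (i choose 2)) * coeff (qpoch_poly i) k))
      = ?R k * (q ^ ((m + n - k) * k) * qfact (m + n - k - k))"
  proof -
    let ?f = "\<lambda>i. qrook i lam * (qfact (m + n - k - i) * (-1) ^ i
        * q ^ ((m + n - k) * i - (i choose 2)) * coeff (qpoch_poly i) k)"
    have "(\<Sum>i\<le>m + n - k. ?f i) = (\<Sum>i\<in>{k}. ?f i)"
    proof (rule sum.mono_neutral_right)
      show "\<forall>i\<in>{..m + n - k} - {k}. ?f i = 0"
      proof
        fix i assume "i \<in> {..m + n - k} - {k}"
        then consider "i < k" | "k < i" by fastforce
        then show "?f i = 0"
          by cases (simp_all add: coeff_qpoch_poly qrook_eq_sub_rook[OF lam] R0[simplified])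
      qed
    qed (use k(2) in auto)
    also have "\<dots> = ?R k * (q ^ ((m + n - k) * k) * qfact (m + n - k - k))"
    proof -
      have "(k choose 2) \<le> (m + n - k) * k"
      proof -
        have "(k choose 2) \<le> k * k" using choose_2_twice[of k] by linarith
        also have "\<dots> \<le> (m + n - k) * k" using k(2) by (intro mult_le_mono1) linarith
        finally show ?thesis .
      qed
      then have "q ^ ((m + n - k) * k) = q ^ ((m + n - k) * k - (k choose 2)) * q ^ (k choose 2)"
        by (simp flip: power_add)
      then show ?thesis
        by (simp add: coeff_qpoch_poly qrook_eq_sub_rook[OF lam] mult_ac)
    qed
    finally show ?thesis .
  qed
  ultimately show "elem_coeff lam {1..m} {1..n} k = qfact k * qhit k (n + m - k) lam"
    unfolding E qhit_eq add.commute[of n m] by simp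
qed

section \<open>Products of two elementary symmetric functions\<close>

lemma elem_sym_eq:
  "elem_sym r \<beta> = (if 0 \<notin># \<beta> \<and> (\<forall>c. count \<beta> c \<le> 1) \<and> size \<beta> = r then 1 else 0)"
proof -
  let ?X = "{S \<in> {S. S \<subseteq> {1..} \<and> finite S \<and> card S = r}. mset_set S = \<beta>}"
  have eq: "?X = (if 0 \<notin># \<beta> \<and> (\<forall>c. count \<beta> c \<le> 1) \<and> size \<beta> = r then {set_mset \<beta>} else {})"
  proof (cases "0 \<notin># \<beta> \<and> (\<forall>c. count \<beta> c \<le> 1) \<and> size \<beta> = r")
    case True
    have set_like: "mset_set (set_mset \<beta>) = \<beta>"
    proof (rule multiset_eqI)
      fix c
      have "count \<beta> c \<le> 1" using True by blast
      moreover have "c \<in># \<beta> \<longleftrightarrow> count \<beta> c \<noteq> 0" by simp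
      ultimately show "count (mset_set (set_mset \<beta>)) c = count \<beta> c"
        unfolding count_mset_set' by (cases "count \<beta> c") simp_all
    qed
    have card: "card (set_mset \<beta>) = r"
      using True arg_cong[OF set_like, of size] by simp
    have pos: "set_mset \<beta> \<subseteq> {1..}"
    proof
      fix c assume "c \<in># \<beta>"
      then have "c \<noteq> 0" using True by (cases "c = 0") simp_all
      then show "c \<in> {1..}" by simp
    qed
    have "?X = {set_mset \<beta>}"
    proof (intro equalityI subsetI)
      fix S assume "S \<in> ?X"
      then have "finite S" "mset_set S = \<beta>" by auto
      then show "S \<in> {set_mset \<beta>}" using finite_set_mset_mset_set[of S] by simp
    next
      fix S assume "S \<in> {set_mset \<beta>}"
      then show "S \<in> ?X" using set_like card pos by simp
    qed
    then show ?thesis unfolding if_P[OF True] .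
  next
    case False
    have "0 \<notin># \<beta> \<and> (\<forall>c. count \<beta> c \<le> 1) \<and> size \<beta> = r" if "S \<in> ?X" for S
    proof -
      have S: "S \<subseteq> {1..}" "finite S" "card S = r" "\<beta> = mset_set S" using that by auto
      have "count \<beta> c \<le> 1" for c unfolding S(4) count_mset_set' by simp
      moreover have "0 \<notin># \<beta>" "size \<beta> = r" using S by auto
      ultimately show ?thesis by blast
    qed
    then have "?X = {}" using False by blast
    then show ?thesis unfolding if_not_P[OF False] .
  qed
  show ?thesis unfolding elem_sym_def formal_sum_def eq by simp
qed

text \<open>A factorisation of the monomial into two square-free ones is given by the set \<open>T\<close> of simple
  variables put into the second factor.\<close>

lemma elem_sym2_eq:
  assumes "size \<alpha> = N" "j \<le> N"
  shows "elem_sym2 (N - j) j \<alpha> = (if 0 \<notin># \<alpha> \<and> (\<forall>c. count \<alpha> c \<le> 2)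
      then of_nat (split_count N (card {c. count \<alpha> c = 2}) j) else 0)"
proof -
  let ?P = "{(\<beta>, \<gamma>). \<beta> + \<gamma> = \<alpha>}"
  let ?ok = "\<lambda>\<beta>. 0 \<notin># \<beta> \<and> (\<forall>c. count \<beta> c \<le> (1::nat))"
  let ?Q = "{(\<beta>, \<gamma>). \<beta> + \<gamma> = \<alpha> \<and> ?ok \<beta> \<and> ?ok \<gamma> \<and> size \<gamma> = j}"
  have "elem_sym2 (N - j) j \<alpha> = (\<Sum>p\<in>?P. if p \<in> ?Q then 1 else 0)"
    unfolding elem_sym2_def series_mult_def
  proof (rule sum.cong[OF refl], clarify)
    fix \<beta> \<gamma> assume "\<alpha> = \<beta> + \<gamma>"
    then have "size \<beta> = N - j \<longleftrightarrow> size \<gamma> = j" using assms by auto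
    then show "elem_sym (N - j) \<beta> * elem_sym j \<gamma> = (if (\<beta>, \<gamma>) \<in> {(\<beta>', \<gamma>'). \<beta>' + \<gamma>' = \<beta> + \<gamma> \<and> ?ok \<beta>' \<and> ?ok \<gamma>' \<and> size \<gamma>' = j} then 1 else 0)"
      by (auto simp: elem_sym_eq)
  qed
  also have "\<dots> = of_nat (card ?Q)"
  proof -
    have "?P \<inter> {p. p \<in> ?Q} = ?Q" by auto
    then show ?thesis using finite_multiset_splits[of \<alpha>] by (simp add: sum.If_cases del: mem_Collect_eq)
  qed
  finally have card: "elem_sym2 (N - j) j \<alpha> = of_nat (card ?Q)" .
  show ?thesis
  proof (cases "0 \<notin># \<alpha> \<and> (\<forall>c. count \<alpha> c \<le> 2)")
    case False
    have "?Q = {}"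
    proof (rule ccontr)
      assume "?Q \<noteq> {}"
      then obtain \<beta> \<gamma> where h: "\<alpha> = \<beta> + \<gamma>" "?ok \<beta>" "?ok \<gamma>" by auto
      have "count \<alpha> c \<le> 2" for c
      proof -
        have "count \<beta> c \<le> 1" "count \<gamma> c \<le> 1" using h(2,3) by auto
        then show ?thesis using h(1) by simp
      qed
      then show False using False h by simp
    qed
    then have "card ?Q = 0" by (simp only: card.empty)
    then show ?thesis unfolding card if_not_P[OF False] by (simp only: of_nat_0)
  next
    case True
    define D S where "D = {c. count \<alpha> c = 2}" and "S = {c. count \<alpha> c = 1}"
    have fin: "finite D" "finite S" 
      unfolding D_def S_def by (auto intro!: finite_subset[of _ "set_mset \<alpha>"] simp: count_greater_zero_iff[symmetric] simp del: count_greater_zero_iff)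
    have DS: "D \<inter> S = {}" "set_mset \<alpha> = D \<union> S"
    proof -
      show "D \<inter> S = {}" by (auto simp: D_def S_def)
      have "c \<in># \<alpha> \<longleftrightarrow> c \<in> D \<union> S" for c
      proof -
        have "count \<alpha> c \<le> 2" using True by blast
        then have "count \<alpha> c > 0 \<longleftrightarrow> count \<alpha> c = 2 \<or> count \<alpha> c = 1" by linarith
        then show ?thesis by (simp add: D_def S_def)
      qed
      then show "set_mset \<alpha> = D \<union> S" by blast
    qed
    have \<alpha>: "\<alpha> = mset_set D + mset_set D + mset_set S"
    proof (rule multiset_eqI)
      fix c
      have "count \<alpha> c \<le> 2" using True by blast
      then consider "count \<alpha> c = 0" | "count \<alpha> c = 1" | "count \<alpha> c = 2" by linarith
      then show "count \<alpha> c = count (mset_set D + mset_set D + mset_set S) c"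
        using fin by cases (simp_all add: count_mset_set' D_def S_def)
    qed
    have N: "N = 2 * card D + card S" using arg_cong[OF \<alpha>, of size] assms(1) by simp
    have nonzero: "0 \<notin> D" "0 \<notin> S" using True DS by auto
    have D_le: "card D \<le> j" if "(\<beta>, \<gamma>) \<in> ?Q" for \<beta> \<gamma>
    proof -
      have h: "\<beta> + \<gamma> = \<alpha>" "\<forall>c. count \<beta> c \<le> 1" "size \<gamma> = j" using that by auto
      have "c \<in># \<gamma>" if "c \<in> D" for c
      proof -
        have "count \<beta> c + count \<gamma> c = 2" using that h(1) by (auto simp: D_def)
        moreover have "count \<beta> c \<le> 1" using h(2) by blast
        ultimately have "count \<gamma> c > 0" by linarith
        then show ?thesis by simp
      qed
      then have "mset_set D \<subseteq># \<gamma>"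
        using fin by (intro mset_subset_eqI) (auto simp: count_mset_set' Suc_le_eq)
      from size_mset_mono[OF this] have "card D \<le> size \<gamma>" by simp
      then show ?thesis using h(3) by simp
    qed
    show ?thesis
    proof (cases "card D \<le> j")
      case False
      then have "?Q = {}" using D_le by blast
      then have "card ?Q = 0" by (simp only: card.empty)
      then show ?thesis using False card by (simp add: split_count_def D_def)
    next
      case jD: True
      have Q_form: "mset_set (D \<union> (S - set_mset \<gamma> \<inter> S)) = \<beta> \<and> mset_set (D \<union> set_mset \<gamma> \<inter> S) = \<gamma>"
        if "(\<beta>, \<gamma>) \<in> ?Q" for \<beta> \<gamma>
      proof -
        have "\<alpha> = \<beta> + \<gamma>" and ok: "\<forall>c. count \<beta> c \<le> 1" "\<forall>c. count \<gamma> c \<le> 1"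
          using that by auto
        then have sum: "count \<alpha> c = count \<beta> c + count \<gamma> c" for c by simp
        have eq: "count \<beta> c = (if c \<in> D \<union> (S - set_mset \<gamma> \<inter> S) then 1 else 0) \<and>
            count \<gamma> c = (if c \<in> D \<union> set_mset \<gamma> \<inter> S then 1 else 0)" for c
        proof -
          have in_\<gamma>: "c \<in># \<gamma> \<longleftrightarrow> count \<gamma> c \<noteq> 0" by simp
          have "count \<beta> c \<le> 1" "count \<gamma> c \<le> 1" using ok by blast+
          then consider "count \<beta> c = 0" "count \<gamma> c = 0" | "count \<beta> c = 0" "count \<gamma> c = 1"
            | "count \<beta> c = 1" "count \<gamma> c = 0" | "count \<beta> c = 1" "count \<gamma> c = 1"
            by linarith
          then show ?thesis
            by cases (simp_all only: D_def S_def sum Un_iff Diff_iff Int_iff mem_Collect_eq in_\<gamma>, simp_all)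
        qed
        have "finite (D \<union> (S - set_mset \<gamma> \<inter> S))" "finite (D \<union> set_mset \<gamma> \<inter> S)" using fin by auto
        then have "count (mset_set (D \<union> (S - set_mset \<gamma> \<inter> S))) c = count \<beta> c"
          "count (mset_set (D \<union> set_mset \<gamma> \<inter> S)) c = count \<gamma> c" for c
          by (simp_all only: count_mset_set' eq simp_thms)
        then show ?thesis by (intro conjI multiset_eqI)
      qed
      have "bij_betw (\<lambda>T. (mset_set (D \<union> (S - T)), mset_set (D \<union> T)))
         {T. T \<subseteq> S \<and> card T = j - card D} ?Q"
      proof (rule bij_betw_byWitness[where f' = "\<lambda>(\<beta>, \<gamma>). set_mset \<gamma> \<inter> S"])
        show "\<forall>T\<in>{T. T \<subseteq> S \<and> card T = j - card D}.
            (case (mset_set (D \<union> (S - T)), mset_set (D \<union> T)) of (\<beta>, \<gamma>) \<Rightarrow> set_mset \<gamma> \<inter> S) = T"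
          using DS(1) fin finite_subset[of _ S] by auto
        show "\<forall>p\<in>?Q. (mset_set (D \<union> (S - (case p of (\<beta>, \<gamma>) \<Rightarrow> set_mset \<gamma> \<inter> S))),
            mset_set (D \<union> (case p of (\<beta>, \<gamma>) \<Rightarrow> set_mset \<gamma> \<inter> S))) = p"
          using Q_form by auto
        show "(\<lambda>(\<beta>, \<gamma>). set_mset \<gamma> \<inter> S) ` ?Q \<subseteq> {T. T \<subseteq> S \<and> card T = j - card D}"
        proof (rule image_subsetI)
          fix p assume "p \<in> ?Q"
          then obtain \<beta> \<gamma> where p: "p = (\<beta>, \<gamma>)" and Q: "(\<beta>, \<gamma>) \<in> ?Q" by blast
          let ?T = "set_mset \<gamma> \<inter> S"
          have "D \<inter> ?T = {}" using DS(1) by blast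
          then have "card (D \<union> ?T) = card D + card ?T" using fin by (intro card_Un_disjoint) auto
          moreover have "card (D \<union> ?T) = j"
            using arg_cong[OF conjunct2[OF Q_form[OF Q]], of size] Q fin by simp
          ultimately show "(case p of (\<beta>, \<gamma>) \<Rightarrow> set_mset \<gamma> \<inter> S) \<in> {T. T \<subseteq> S \<and> card T = j - card D}"
            by (simp add: p)
        qed
        show "(\<lambda>T. (mset_set (D \<union> (S - T)), mset_set (D \<union> T))) ` {T. T \<subseteq> S \<and> card T = j - card D} \<subseteq> ?Q"
        proof (rule image_subsetI)
          fix T assume "T \<in> {T. T \<subseteq> S \<and> card T = j - card D}"
          then have T: "T \<subseteq> S" "card T = j - card D" by auto
          have finT: "finite T" using T(1) fin(2) finite_subset by blast
          have "mset_set (D \<union> (S - T)) + mset_set (D \<union> T) = \<alpha>"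
            unfolding \<alpha> by (rule multiset_eqI) (use fin finT T(1) DS(1) in \<open>auto simp: count_mset_set'\<close>)
          moreover have "size (mset_set (D \<union> T)) = j"
          proof -
            have "D \<inter> T = {}" using DS(1) T(1) by blast
            then show ?thesis using fin finT T(2) jD by (simp add: card_Un_disjoint)
          qed
          moreover have "?ok (mset_set (D \<union> (S - T)))" "?ok (mset_set (D \<union> T))"
            using nonzero T(1) fin finT by (auto simp: count_mset_set')
          ultimately show "(mset_set (D \<union> (S - T)), mset_set (D \<union> T)) \<in> ?Q" by blast
        qed
      qed
      then have "card ?Q = card {T. T \<subseteq> S \<and> card T = j - card D}"
        by (rule bij_betw_same_card[symmetric])
      also have "\<dots> = split_count N (card D) j"
        using jD fin N by (simp add: n_subsets split_count_def)
      finally show ?thesis using card True by (simp add: D_def)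
    qed
  qed
qed

lemma elem_sym2_eq_0:
  assumes "size \<alpha> \<noteq> a + b"
  shows "elem_sym2 a b \<alpha> = 0"
proof -
  have "elem_sym a \<beta> * elem_sym b \<gamma> = 0" if "\<beta> + \<gamma> = \<alpha>" for \<beta> \<gamma>
    using that assms by (auto simp: elem_sym_eq)
  then show ?thesis unfolding elem_sym2_def series_mult_def by (intro sum.neutral) auto
qed

section \<open>The elementary expansion\<close>

lemma board_vertices_full: "board_vertices n m {1..m} {1..n} = {1..m + n}"
proof -
  have "v \<in> row_vertex n m ` {1..n}" if "m < v" "v \<le> m + n" for v
    using that by (intro image_eqI[of _ _ "m + n + 1 - v"]) (auto simp: row_vertex_def)
  then have "{1..m + n} - {1..m} \<subseteq> row_vertex n m ` {1..n}" by (auto simp: not_le)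
  moreover have "row_vertex n m ` {1..n} \<subseteq> {1..m + n}"
  proof (rule image_subsetI)
    fix i assume "i \<in> {1..n}"
    from row_vertex_bounds[OF this, of m] show "row_vertex n m i \<in> {1..m + n}" by simp
  qed
  moreover have "{1..m} \<subseteq> {1..m + n}" by simp
  ultimately show ?thesis unfolding board_vertices_def by blast
qed

lemma chromatic_qsym_eq_color_sum:
  "chromatic_qsym n m lam \<alpha> = (if 0 \<in># \<alpha> then 0 else color_sum (graph_edges n m lam) {1..m + n} \<alpha>)"
proof -
  let ?E = "graph_edges n m lam" and ?V = "{1..m + n}"
  let ?X = "{\<kappa> \<in> proper_colorings n m lam. image_mset \<kappa> (mset_set ?V) = \<alpha>}"
  have EV: "a \<in> ?V \<and> b \<in> ?V" if "(a, b) \<in> ?E" for a b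
    using that by (auto simp: graph_edges_def)
  have asc: "asc n m lam \<kappa> = ascents ?E ?V \<kappa>" for \<kappa>
    unfolding asc_def ascents_def using EV by (intro arg_cong[where f = card]) auto
  have in_alpha: "\<kappa> v \<in># \<alpha>" if "image_mset \<kappa> (mset_set ?V) = \<alpha>" "v \<in> ?V" for \<kappa> v
    using that by (auto simp flip: that(1))
  show ?thesis
  proof (cases "0 \<in># \<alpha>")
    case True
    have X: "?X = {}"
    proof (rule ccontr)
      assume "?X \<noteq> {}"
      then obtain \<kappa> where \<kappa>: "\<kappa> \<in> ?V \<rightarrow>\<^sub>E {1..}" "image_mset \<kappa> (mset_set ?V) = \<alpha>"
        by (auto simp: proper_colorings_def)
      then obtain v where "v \<in> ?V" "\<kappa> v = 0" using True by (auto simp flip: \<kappa>(2))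
      moreover have "\<kappa> v \<in> {1..}" using \<kappa>(1) \<open>v \<in> ?V\<close> by (rule PiE_mem)
      ultimately show False by simp
    qed
    show ?thesis unfolding chromatic_qsym_def formal_sum_def X using True by simp
  next
    case False
    have X: "?X = colorings ?E ?V \<alpha>"
    proof (intro equalityI subsetI)
      fix \<kappa> assume "\<kappa> \<in> ?X"
      then show "\<kappa> \<in> colorings ?E ?V \<alpha>"
        by (auto simp: proper_colorings_def colorings_def PiE_iff)
    next
      fix \<kappa> assume \<kappa>: "\<kappa> \<in> colorings ?E ?V \<alpha>"
      have "\<kappa> v \<in> {1..}" if "v \<in> ?V" for v
      proof -
        have "\<kappa> v \<in># \<alpha>" using in_alpha[of \<kappa> v] \<kappa> that by (simp add: colorings_def)
        then have "\<kappa> v \<noteq> 0" using False by metis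
        then show ?thesis by simp
      qed
      then show "\<kappa> \<in> ?X"
        using \<kappa> EV by (auto simp: proper_colorings_def colorings_def PiE_iff)
    qed
    show ?thesis
      unfolding chromatic_qsym_def formal_sum_def X color_sum_def using False by (simp add: asc)
  qed
qed

text \<open>No colour can be used three times, as independent sets have at most two elements.\<close>

lemma color_sum_eq_0:
  assumes "A \<subseteq> {1..m}" "B \<subseteq> {1..n}"
    and "size \<alpha> \<noteq> card A + card B \<or> (\<exists>c. 2 < count \<alpha> c)"
  shows "color_sum (graph_edges n m lam) (board_vertices n m A B) \<alpha> = 0"
proof -
  let ?E = "graph_edges n m lam" and ?V = "board_vertices n m A B"
  note finV = finite_board_vertices[OF assms(1,2)]
  have False if \<kappa>: "\<kappa> \<in> colorings ?E ?V \<alpha>" for \<kappa>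
  proof -
    have mon: "image_mset \<kappa> (mset_set ?V) = \<alpha>"
      and proper: "\<forall>a\<in>?V. \<forall>b\<in>?V. (a, b) \<in> ?E \<longrightarrow> \<kappa> a \<noteq> \<kappa> b"
      using \<kappa> by (auto simp: colorings_def)
    have "size \<alpha> = card A + card B"
      using arg_cong[OF mon, of size] card_board_vertices[OF assms(1,2)] by simp
    then obtain c where c: "2 < count \<alpha> c" using assms(3) by auto
    define S where "S = {v \<in> ?V. \<kappa> v = c}"
    have S: "S \<subseteq> ?V" "\<And>v. v \<in> S \<Longrightarrow> \<kappa> v = c" "\<And>v. v \<in> ?V - S \<Longrightarrow> \<kappa> v \<noteq> c" by (auto simp: S_def)
    have "indep ?E S"
      unfolding indep_def
    proof (intro ballI notI)
      fix a b assume "a \<in> S" "b \<in> S" "(a, b) \<in> ?E"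
      moreover from this have "\<kappa> a \<noteq> \<kappa> b" using proper S(1) by blast
      ultimately show False using S(2)[of a] S(2)[of b] by simp
    qed
    then have "card S \<le> 2" using indep_card_le_2[OF assms(1,2) S(1)] by blast
    moreover have "count \<alpha> c = card S"
      using image_mset_color_class(1)[where \<kappa> = \<kappa> and c = c, OF finV S] mon by simp
    ultimately show False using c by simp
  qed
  then have "colorings ?E ?V \<alpha> = {}" by blast
  then show ?thesis by (simp add: color_sum_def)
qed

theorem theorem1p2:
  fixes n m k :: nat and lam :: "nat \<Rightarrow> nat"
  assumes "partition_in_board n m lam"
    and "num_parts lam = k"
    and "k \<le> lam 1"
  shows "chromatic_qsym n m lam =
    (\<lambda>\<alpha>. qfact k * qhit k (n + m - k) lam * elem_sym2 (m + n - k) k \<alpha>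
        + (\<Sum>j<k. q ^ j * qfact j * qint (n + m - 2 * j) * qhit j (m + n - j - 1) lam
                    * elem_sym2 (m + n - j) j \<alpha>))"
proof
  fix \<alpha>
  let ?c = "elem_coeff lam {1..m} {1..n}" and ?N = "m + n"
  have "k \<le> m" using assms(1,3) by (auto simp: partition_in_board_def)
  moreover have "k \<le> n"
  proof -
    have "{i. 1 \<le> i \<and> lam i \<noteq> 0} \<subseteq> {1..n}"
      using nonzero_row_le[OF assms(1)] by auto
    from card_mono[OF _ this] show ?thesis using assms(2) by (simp add: num_parts_def)
  qed
  ultimately have k: "2 * k \<le> ?N" by simp
  note top = elem_coeff_top[OF assms(1,2) k]
  have "(\<Sum>j<k. q ^ j * qfact j * qint (n + m - 2 * j) * qhit j (m + n - j - 1) lam * elem_sym2 (m + n - j) j \<alpha>)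
      = (\<Sum>j<k. ?c j * elem_sym2 (?N - j) j \<alpha>)"
    using k by (intro sum.cong refl) (simp add: elem_coeff_eq_qhit[OF assms(1)] del: One_nat_def)
  then have rhs: "qfact k * qhit k (n + m - k) lam * elem_sym2 (m + n - k) k \<alpha>
        + (\<Sum>j<k. q ^ j * qfact j * qint (n + m - 2 * j) * qhit j (m + n - j - 1) lam
                    * elem_sym2 (m + n - j) j \<alpha>)
      = (\<Sum>j\<le>k. ?c j * elem_sym2 (?N - j) j \<alpha>)"
    by (simp add: top(1) lessThan_Suc_atMost [symmetric] del: One_nat_def)
  note color = chromatic_qsym_eq_color_sum[of n m lam \<alpha>, folded board_vertices_full]
  show "chromatic_qsym n m lam \<alpha> = qfact k * qhit k (n + m - k) lam * elem_sym2 (m + n - k) k \<alpha>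
        + (\<Sum>j<k. q ^ j * qfact j * qint (n + m - 2 * j) * qhit j (m + n - j - 1) lam
                    * elem_sym2 (m + n - j) j \<alpha>)"
  proof (cases "size \<alpha> = ?N \<and> 0 \<notin># \<alpha> \<and> (\<forall>c. count \<alpha> c \<le> 2)")
    case True
    let ?r = "card {c. count \<alpha> c = 2}"
    have "chromatic_qsym n m lam \<alpha> = monomial_coeff lam {1..m} {1..n} ?r"
      unfolding color using True color_sum_eq_monomial_coeff[OF assms(1), of "{1..m}" "{1..n}" \<alpha>] by simp
    also have "\<dots> = (\<Sum>j\<le>?N. ?c j * of_nat (split_count ?N ?r j))"
      by (simp add: monomial_coeff_def)
    also have "\<dots> = (\<Sum>j\<le>k. ?c j * of_nat (split_count ?N ?r j))"
      using k top(2) by (intro sum.mono_neutral_right) auto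
    also have "\<dots> = (\<Sum>j\<le>k. ?c j * elem_sym2 (?N - j) j \<alpha>)"
      using True k by (intro sum.cong refl) (simp add: elem_sym2_eq)
    finally show ?thesis unfolding rhs .
  next
    case False
    have "elem_sym2 (?N - j) j \<alpha> = 0" if "j \<le> k" for j
    proof (cases "size \<alpha> = ?N")
      case True
      then show ?thesis using False that k elem_sym2_eq[OF True, of j] by auto
    next
      case False
      then show ?thesis using that k by (intro elem_sym2_eq_0) auto
    qed
    moreover have "chromatic_qsym n m lam \<alpha> = 0"
      unfolding color using False color_sum_eq_0[of "{1..m}" m "{1..n}" n \<alpha> lam] by (auto simp: not_le)
    ultimately show ?thesis unfolding rhs by simp
  qed
qed

end
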